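(* Let the data $X,U,A,B,f,g,I_k,\phi$ and the operators $S_\alpha(t)$ be as in the context, with $M=CM_0$ and $M_B=\|B\|$. Suppose there are $p$ with $0<p<\alpha-1$, functions $L_1,L_2,M_1\in L^{1/p}([0,T],\mathbb{R}^+)$ and constants $l_1,l_2,l_g>0$ such that the following hold. (A.1) For all $t\in[0,T]$, $x,y\in X$, $\varphi,\psi\in\mathcal{C}_r$: $\|f(t,x,\varphi)\|_X\le M_1(t)$ and $\|f(t,x,\varphi)-f(t,y,\psi)\|_X\le L_1(t)\|x-y\|_X+L_2(t)\|\varphi-\psi\|_r$. (A.2) $f$ is continuous and compact on $[0,T]\times X\times\mathcal{C}_r$ (i.e. continuous, with images of bounded sets relatively compact). (A.3) Each $I_k$ ($k=1,\dots,K$) is continuous, with $\|I_k(x)\|_X\le l_1$ and $\|I_k(x)-I_k(y)\|_X\le l_2\|x-y\|_X$ for all $x,y\in X$. (A.4) $g$ is continuous and satisfies $\|g(\varphi)(s)-g(\psi)(s)\|_X\le l_g\|\varphi-\psi\|_r$ for all $\varphi,\psi\in\mathcal{C}_r$ and $s\in[-r,0]$, and $g$ acts pointwise: $g(x_t)(s)=g(x(t+s))$ for $t\in[0,T]$, $s\in[-r,0]$ (on the right, $g$ denotes a map $X\to X$). (A.5) With $\Gamma_0^T=\int_0^T S_\alpha(T-s)BB^*S_\alpha^*(T-s)\,ds$ and $\mathcal{J}:X\to X^*$ the duality mapping, for each $h\in X$ and $\delta>0$ the element $z_\delta(h)=\delta(\delta I+\Gamma_0^T\mathcal{J})^{-1}(h)$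 is a solution of $\delta z_\delta+\Gamma_0^T\mathcal{J}(z_\delta)=\delta h$, and for each $h\in X$, $z_\delta(h)\to 0$ in the norm (strong) topology of $X$ as $\delta\to0^+$. (A.6) For a given $\varepsilon>0$, $$M\Big(Kl_2+l_g+T^{1-p}\big(\|L_1\|_{L^{1/p}}+\|L_2\|_{L^{1/p}}\big)\Big)\Big(1+\frac{MM_B^2T}{\varepsilon}\Big)<1 .$$ Then the impulsive fractional delay system described in the context is approximately controllable on $[0,T]$, i.e. its reachable set $\mathrm{R}(T)$ satisfies $\overline{\mathrm{R}(T)}=X$.
   Context: Setting. $\alpha\in(1,2)$, $T>0$, $r>0$, $0=t_0<t_1<\dots<t_K<T$. $X$ is a separable Banach space with norm $\|\cdot\|_X$; $U$ is a separable (reflexive) Hilbert space; $B:U\to X$ is a bounded linear operator. $\mathcal{C}_r=PC([-r,0],X)$ is the space of piecewise continuous functions with sup-norm $\|\cdot\|_r$. For $x:[-r,T]\to X$ and $t\in[0,T]$, $x_t(s)=x(t+s)$, $s\in[-r,0]$. Given are $f:[0,T]\times X\times\mathcal{C}_r\to X$, impulse maps $I_k:X\to X$ ($k=1,\dots,K$), $\phi\in\mathcal{C}_r$, and a map $g$ assigning to each $\psi\in\mathcal{C}_r$ an $X$-valued function $s\mapsto g(\psi)(s)$ on $[-r,0]$. The system is $$D_t^{\alpha}x(t)=Ax(t)+D_t^{\alpha-1}\big(f(t,x(t),x_t)+Bu(t)\big),\quad t\in[0,T],\ t\ne t_k,$$ $$\Delta x(t)|_{t=t_k}=I_k(x(t_k^-)),\quad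 k=1,\dots,K,\qquad x(s)+g(x_t)(s)=\phi(s),\quad s\in[-r,0].$$ Operator $A$. $A:D(A)\subset X\to X$ is closed, linear, densely defined and sectorial of type $\omega<0$ and angle $\theta$ with $0<\theta<\pi(1-\frac{\alpha}{2})$: there is $M_0>0$ such that the resolvent of $A$ exists outside $\omega+S_\theta:=\{\omega+\lambda:\lambda\in\mathbb{C},\ |\arg(-\lambda)|<\theta\}$ and $\|(\lambda-A)^{-1}\|\le M_0/|\lambda-\omega|$ for $\lambda\notin\omega+S_\theta$. Put $$S_\alpha(t)=\frac{1}{2\pi i}\int_\gamma e^{\lambda t}\lambda^{\alpha-1}(\lambda^\alpha I-A)^{-1}\,d\lambda,$$ where the path $\gamma$ lies outside the sector $\omega+S_\theta$. By a known result of Cuesta there is $C>0$ with $\|S_\alpha(t)\|\le\frac{CM_0}{1+|\omega|t^\alpha}\le CM_0=:M$ for $t\ge0$. Duality mapping. $\mathcal{J}:X\to X^*$ is the (single-valued) duality mapping, $\langle x,\mathcal{J}(x)\rangle=\|x\|_X^2=\|\mathcal{J}(x)\|_{X^*}^2$. $B^*$ and $S_\alpha^*(t)$ denote adjoints. Solution space. $PC([0,T],X)$ is the set of $x:[0,T]\to X$ continuous on $[t_0,t_1]$ and on each $(t_k,t_{k+1}]$ (with $t_{K+1}=T$), such that $x(t_k^\pm)$ exist and $x(t_k)=x(t_k^-)$, with the sup-norm. Mild solution. For $u\in L^2([0,T],U)$, a mild solution is a function $x:[-r,T]\to X$ with $x(s)=\phi(s)-g(x_t)(s)$ for $t\in[0,T]$,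 $s\in[-r,0]$, whose restriction to $[0,T]$ lies in $PC([0,T],X)$ and satisfies, for all $t\in[0,T]$, $$x(t)=S_\alpha(t)\big(\phi(0)-g(x_t)(0)\big)+\sum_{0<t_k<t}S_\alpha(t-t_k)I_k(x(t_k^-))+\int_0^tS_\alpha(t-s)Bu(s)\,ds+\int_0^tS_\alpha(t-s)f(s,x(s),x_s)\,ds .$$ Reachable set. $\mathrm{R}(T)=\{x(T;u):u\in L^2([0,T],U)\}$, where $x(\cdot;u)$ is a mild solution for the control $u$.
   Formalization: The condition x(s)+g(x_t)(s)=φ(s) is imposed at t=0 only (for all t it makes the claim false unless g is constant), and s ↦ f(s,x(s),x_s) is assumed measurable for every piecewise continuous x, as the integral in the mild solution requires. *)

theory Defs
  imports "HOL-Analysis.Analysis"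
begin

section \<open>Complex Banach and Hilbert spaces\<close>

text \<open>The resolvent of \<open>A\<close> is taken at complex points, so \<open>X\<close> and \<open>U\<close> have complex scalars.
  A separable space is one of sort \<open>second_countable_topology\<close>.\<close>

class complex_banach = banach +
  fixes scaleC :: "complex \<Rightarrow> 'a \<Rightarrow> 'a"  (infixr "*\<^sub>C" 75)
  assumes scaleC_add_right: "a *\<^sub>C (x + y) = a *\<^sub>C x + a *\<^sub>C y"
    and scaleC_add_left: "(a + b) *\<^sub>C x = a *\<^sub>C x + b *\<^sub>C x"
    and scaleC_scaleC: "a *\<^sub>C (b *\<^sub>C x) = (a * b) *\<^sub>C x"
    and scaleC_of_real: "complex_of_real c *\<^sub>C x = c *\<^sub>R x"
    and norm_scaleC: "norm (a *\<^sub>C x) = cmod a * norm x"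

class complex_hilbert = complex_banach +
  fixes cinner :: "'a \<Rightarrow> 'a \<Rightarrow> complex"
  assumes cinner_commute: "cinner x y = cnj (cinner y x)"
    and cinner_add_left: "cinner (x + y) z = cinner x z + cinner y z"
    and cinner_scaleC_left: "cinner (a *\<^sub>C x) y = a * cinner x y"
    and cinner_self: "cinner x x = complex_of_real ((norm x)\<^sup>2)"

instantiation complex :: complex_hilbert
begin
definition scaleC_complex :: "complex \<Rightarrow> complex \<Rightarrow> complex"
  where "scaleC_complex a z = a * z"
definition cinner_complex :: "complex \<Rightarrow> complex \<Rightarrow> complex"
  where "cinner_complex z w = z * cnj w"
instance
proof
  fix a b x y z :: complex and c :: real
  show "a *\<^sub>C (x + y) = a *\<^sub>C x + a *\<^sub>C y" "(a + b) *\<^sub>C x = a *\<^sub>C x + b *\<^sub>C x"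
    "a *\<^sub>C (b *\<^sub>C x) = (a * b) *\<^sub>C x" "norm (a *\<^sub>C x) = cmod a * norm x"
    "complex_of_real c *\<^sub>C x = c *\<^sub>R x"
    by (simp_all add: scaleC_complex_def algebra_simps norm_mult scaleR_conv_of_real)
  show "cinner x y = cnj (cinner y x)" "cinner (x + y) z = cinner x z + cinner y z"
    "cinner (a *\<^sub>C x) y = a * cinner x y"
    by (simp_all add: scaleC_complex_def cinner_complex_def algebra_simps)
  show "cinner x x = complex_of_real ((norm x)\<^sup>2)"
    by (simp only: cinner_complex_def complex_norm_square)
qed
end

definition bounded_clinear :: "('a::complex_banach \<Rightarrow> 'b::complex_banach) \<Rightarrow> bool"
  where "bounded_clinear L \<longleftrightarrow> bounded_linear L \<and> (\<forall>c x. L (c *\<^sub>C x) = c *\<^sub>C L x)"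

definition dual_space :: "('a::complex_banach \<Rightarrow> complex) set"
  where "dual_space = {\<xi>. bounded_clinear \<xi>}"

definition duality_set :: "'a::complex_banach \<Rightarrow> ('a \<Rightarrow> complex) set"
  where "duality_set x =
    {\<xi> \<in> dual_space. \<xi> x = complex_of_real ((norm x)\<^sup>2) \<and> (onorm \<xi>)\<^sup>2 = (norm x)\<^sup>2}"

definition banach_adjoint :: "('a \<Rightarrow> 'b) \<Rightarrow> ('b \<Rightarrow> complex) \<Rightarrow> 'a \<Rightarrow> complex"
  where "banach_adjoint L \<xi> = \<xi> \<circ> L"

text \<open>The Riesz identification of the dual of \<open>U\<close> with \<open>U\<close>; it turns the adjoint of
  \<open>B : U \<rightarrow> X\<close> into a map from the dual of \<open>X\<close> to \<open>U\<close>, so that \<open>B B\<^sup>*\<close> makes sense.\<close>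

definition riesz :: "('u::complex_hilbert \<Rightarrow> complex) \<Rightarrow> 'u"
  where "riesz \<xi> = (THE u. \<forall>v. \<xi> v = cinner v u)"

definition control_adjoint ::
    "('u::complex_hilbert \<Rightarrow> 'x::complex_banach) \<Rightarrow> ('x \<Rightarrow> complex) \<Rightarrow> 'u"
  where "control_adjoint B \<xi> = riesz (banach_adjoint B \<xi>)"


section \<open>Sectorial operators and the operators \<open>S\<^sub>\<alpha>(t)\<close>\<close>

text \<open>An unbounded operator is a pair of a domain \<open>D\<close> and a function \<open>A\<close> that only matters on \<open>D\<close>.\<close>

definition closed_densely_defined :: "'x::complex_banach set \<Rightarrow> ('x \<Rightarrow> 'x) \<Rightarrow> bool"
  where "closed_densely_defined D A \<longleftrightarrow>
    0 \<in> D \<and>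
    (\<forall>x\<in>D. \<forall>y\<in>D. x + y \<in> D \<and> A (x + y) = A x + A y) \<and>
    (\<forall>c. \<forall>x\<in>D. c *\<^sub>C x \<in> D \<and> A (c *\<^sub>C x) = c *\<^sub>C A x) \<and>
    closed {(x, A x) | x. x \<in> D} \<and>
    closure D = UNIV"

definition resolvent :: "'x::complex_banach set \<Rightarrow> ('x \<Rightarrow> 'x) \<Rightarrow> complex \<Rightarrow> 'x \<Rightarrow> 'x"
  where "resolvent D A \<zeta> = inv_into D (\<lambda>x. \<zeta> *\<^sub>C x - A x)"

definition resolvent_set :: "'x::complex_banach set \<Rightarrow> ('x \<Rightarrow> 'x) \<Rightarrow> complex set"
  where "resolvent_set D A =
    {\<zeta>. bij_betw (\<lambda>x. \<zeta> *\<^sub>C x - A x) D UNIV \<and> bounded_clinear (resolvent D A \<zeta>)}"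

text \<open>Since \<open>Arg 0 = 0\<close>, the vertex \<open>\<omega>\<close> belongs to the sector, so that no resolvent bound is
  required there.\<close>

definition sector :: "real \<Rightarrow> real \<Rightarrow> complex set"
  where "sector \<omega> \<theta> = {complex_of_real \<omega> + \<mu> | \<mu>. \<bar>Arg (- \<mu>)\<bar> < \<theta>}"

definition sectorial ::
    "'x::complex_banach set \<Rightarrow> ('x \<Rightarrow> 'x) \<Rightarrow> real \<Rightarrow> real \<Rightarrow> real \<Rightarrow> bool"
  where "sectorial D A \<omega> \<theta> M0 \<longleftrightarrow> M0 > 0 \<and>
    (\<forall>\<zeta>. \<zeta> \<notin> sector \<omega> \<theta> \<longrightarrow> \<zeta> \<in> resolvent_set D A \<and>
       onorm (resolvent D A \<zeta>) \<le> M0 / cmod (\<zeta> - complex_of_real \<omega>))"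

text \<open>Integration along the path that comes in from infinity on the ray of angle \<open>- \<beta>\<close>, follows
  the circle of radius \<open>\<rho>\<close> counterclockwise, and leaves on the ray of angle \<open>\<beta>\<close>.  If
  \<open>\<pi>/2 < \<beta> < (\<pi> - \<theta>)/\<alpha>\<close> and \<open>\<omega> < 0\<close>, then \<open>\<zeta>\<close> and \<open>\<zeta>\<^sup>\<alpha>\<close> both stay outside
  \<open>sector \<omega> \<theta>\<close> along it.\<close>

definition hankel_integral ::
    "real \<Rightarrow> real \<Rightarrow> (complex \<Rightarrow> 'x::{complex_banach, second_countable_topology}) \<Rightarrow> 'x"
  where "hankel_integral \<rho> \<beta> G =
      (LINT \<xi>:{- \<beta>..\<beta>}|lborel. (\<i> * complex_of_real \<rho> * cis \<xi>) *\<^sub>C G (complex_of_real \<rho> * cis \<xi>))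
    + (LINT s:{\<rho>..}|lborel. cis \<beta> *\<^sub>C G (complex_of_real s * cis \<beta>))
    - (LINT s:{\<rho>..}|lborel. cis (- \<beta>) *\<^sub>C G (complex_of_real s * cis (- \<beta>)))"

text \<open>At \<open>t = 0\<close> the path integral does not converge absolutely; as usual \<open>S\<^sub>\<alpha>(0)\<close> is the identity,
  the strong limit as \<open>t\<close> decreases to 0.\<close>

definition S_op ::
    "real \<Rightarrow> 'x::{complex_banach, second_countable_topology} set \<Rightarrow> ('x \<Rightarrow> 'x) \<Rightarrow>
     real \<Rightarrow> real \<Rightarrow> real \<Rightarrow> 'x \<Rightarrow> 'x"
  where "S_op \<alpha> D A \<rho> \<beta> t x =
    (if t = 0 then x
     else (1 / (2 * complex_of_real pi * \<i>)) *\<^sub>C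
       hankel_integral \<rho> \<beta> (\<lambda>\<zeta>.
         (exp (\<zeta> * complex_of_real t) * \<zeta> powr complex_of_real (\<alpha> - 1)) *\<^sub>C
           resolvent D A (\<zeta> powr complex_of_real \<alpha>) x))"

definition controllability_operator ::
    "real \<Rightarrow> (real \<Rightarrow> 'x::{complex_banach, second_countable_topology} \<Rightarrow> 'x) \<Rightarrow>
     ('u::complex_hilbert \<Rightarrow> 'x) \<Rightarrow> ('x \<Rightarrow> complex) \<Rightarrow> 'x"
  where "controllability_operator T S B \<xi> =
    (LINT s:{0..T}|lebesgue.
       S (T - s) (B (control_adjoint B (banach_adjoint (S (T - s)) \<xi>))))"


section \<open>Function spaces\<close>

definition piecewise_continuous :: "real \<Rightarrow> real \<Rightarrow> (real \<Rightarrow> 'x::topological_space) \<Rightarrow> bool"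
  where "piecewise_continuous a b \<psi> \<longleftrightarrow>
    (\<exists>F. finite F \<and> (\<forall>s\<in>{a..b} - F. continuous (at s within {a..b}) \<psi>)) \<and>
    (\<forall>s\<in>{a<..b}. \<exists>l. (\<psi> \<longlongrightarrow> l) (at_left s)) \<and>
    (\<forall>s\<in>{a..<b}. \<exists>l. (\<psi> \<longlongrightarrow> l) (at_right s))"

text \<open>Functions on \<open>[-r, 0]\<close> are extensional, so that equality is equality on \<open>[-r, 0]\<close>.\<close>

definition PC_hist :: "real \<Rightarrow> (real \<Rightarrow> 'x::real_normed_vector) set"
  where "PC_hist r = {\<psi> \<in> extensional {- r..0}. piecewise_continuous (- r) 0 \<psi>}"

definition hist_norm :: "real \<Rightarrow> (real \<Rightarrow> 'x::real_normed_vector) \<Rightarrow> real"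
  where "hist_norm r \<psi> = (SUP s\<in>{- r..0}. norm (\<psi> s))"

text \<open>The absolute value has no effect on \<open>PC_hist r\<close>; it is there because the locale
  \<open>Metric_space\<close> wants the distance to be nonnegative outside the space too, where the
  supremum may be over an unbounded set.\<close>

definition hist_dist :: "real \<Rightarrow> (real \<Rightarrow> 'x::real_normed_vector) \<Rightarrow> (real \<Rightarrow> 'x) \<Rightarrow> real"
  where "hist_dist r \<psi> \<kappa> = \<bar>hist_norm r (\<lambda>s. \<psi> s - \<kappa> s)\<bar>"

definition hist_topology :: "real \<Rightarrow> (real \<Rightarrow> 'x::real_normed_vector) topology"
  where "hist_topology r = Metric_space.mtopology (PC_hist r) (hist_dist r)"

lemma piecewise_continuous_bdd_above:
  fixes \<psi> :: "real \<Rightarrow> 'x::real_normed_vector"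
  assumes "piecewise_continuous a b \<psi>"
  shows "bdd_above ((\<lambda>s. norm (\<psi> s)) ` {a..b})"
proof -
  have loc: "\<exists>U m. open U \<and> s \<in> U \<and> (\<forall>y\<in>U \<inter> {a..b}. norm (\<psi> y) \<le> m)"
    if s: "s \<in> {a..b}" for s
  proof -
    have ev: "\<exists>m. eventually (\<lambda>y. norm (\<psi> y) \<le> m) F" if "(\<psi> \<longlongrightarrow> l) F" for l F
    proof -
      have "eventually (\<lambda>y. dist (\<psi> y) l < 1) F"
        using that by (rule tendstoD) simp
      moreover have "norm (\<psi> y) \<le> norm l + 1" if "dist (\<psi> y) l < 1" for y
        using that norm_triangle_sub[of "\<psi> y" l] by (simp add: dist_norm)
      ultimately show ?thesis by (blast intro: eventually_mono)
    qed
    obtain m1 where m1: "s > a \<Longrightarrow> eventually (\<lambda>y. norm (\<psi> y) \<le> m1) (at_left s)"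
      using assms s ev unfolding piecewise_continuous_def
      by (metis atLeastAtMost_iff greaterThanAtMost_iff)
    obtain m2 where m2: "s < b \<Longrightarrow> eventually (\<lambda>y. norm (\<psi> y) \<le> m2) (at_right s)"
      using assms s ev unfolding piecewise_continuous_def
      by (metis atLeastAtMost_iff atLeastLessThan_iff)
    let ?m = "max (norm (\<psi> s)) (max m1 m2)"
    have L: "eventually (\<lambda>y. y \<in> {a..b} \<longrightarrow> norm (\<psi> y) \<le> ?m) (at_left s)"
    proof (cases "s > a")
      case True
      show ?thesis by (rule eventually_mono[OF m1[OF True]]) auto
    next
      case False
      show ?thesis using s False by (auto simp: eventually_at_filter)
    qed
    have R: "eventually (\<lambda>y. y \<in> {a..b} \<longrightarrow> norm (\<psi> y) \<le> ?m) (at_right s)"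
    proof (cases "s < b")
      case True
      show ?thesis by (rule eventually_mono[OF m2[OF True]]) auto
    next
      case False
      show ?thesis using s False by (auto simp: eventually_at_filter)
    qed
    have "eventually (\<lambda>y. y \<in> {a..b} \<longrightarrow> norm (\<psi> y) \<le> ?m) (at s)"
      using L R by (simp add: eventually_at_split)
    then obtain U where "open U" "s \<in> U" "\<forall>y\<in>U. y \<noteq> s \<longrightarrow> y \<in> {a..b} \<longrightarrow> norm (\<psi> y) \<le> ?m"
      unfolding eventually_at_topological by blast
    then show ?thesis
      by (intro exI[of _ U] exI[of _ ?m]) auto
  qed
  obtain U m where Um: "\<And>s. s \<in> {a..b} \<Longrightarrow>
      open (U s) \<and> s \<in> U s \<and> (\<forall>y\<in>U s \<inter> {a..b}. norm (\<psi> y) \<le> m s)"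
    using loc by metis
  have "compact {a..b}" by simp
  then obtain C where C: "C \<subseteq> {a..b}" "finite C" "{a..b} \<subseteq> (\<Union>s\<in>C. U s)"
    using Um by (elim compactE_image[of _ "{a..b}" U]) auto
  have "norm (\<psi> y) \<le> Max (insert 0 (m ` C))" if y: "y \<in> {a..b}" for y
  proof -
    obtain s where s: "s \<in> C" "y \<in> U s" using C(3) y by auto
    then have "norm (\<psi> y) \<le> m s" using Um C(1) y by blast
    also have "m s \<le> Max (insert 0 (m ` C))" using s C(2) by (intro Max_ge) auto
    finally show ?thesis .
  qed
  then show ?thesis by (intro bdd_aboveI2)
qed

lemma Metric_space_PC_hist:
  fixes r :: real
  assumes "r > 0"
  shows "Metric_space (PC_hist r :: (real \<Rightarrow> 'x::real_normed_vector) set) (hist_dist r)"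
proof -
  let ?I = "{- r..0}"
  have bdd: "bdd_above ((\<lambda>s. norm (\<psi> s - \<kappa> s)) ` ?I)"
    if "\<psi> \<in> PC_hist r" "\<kappa> \<in> PC_hist r" for \<psi> \<kappa> :: "real \<Rightarrow> 'x"
  proof -
    have "\<exists>p. \<forall>s\<in>?I. norm (\<eta> s) \<le> p" if "\<eta> \<in> PC_hist r" for \<eta> :: "real \<Rightarrow> 'x"
      using that piecewise_continuous_bdd_above[of "- r" 0 \<eta>]
      unfolding PC_hist_def bdd_above_def by auto
    then obtain p q where "\<forall>s\<in>?I. norm (\<psi> s) \<le> p" "\<forall>s\<in>?I. norm (\<kappa> s) \<le> q"
      using \<open>\<psi> \<in> PC_hist r\<close> \<open>\<kappa> \<in> PC_hist r\<close> by blast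
    then have "norm (\<psi> s - \<kappa> s) \<le> p + q" if "s \<in> ?I" for s
      using that norm_triangle_ineq4[of "\<psi> s" "\<kappa> s"] by (meson add_mono order_trans)
    then show ?thesis by (intro bdd_aboveI2)
  qed
  have upper: "norm (\<psi> s - \<kappa> s) \<le> hist_norm r (\<lambda>s. \<psi> s - \<kappa> s)"
    if "\<psi> \<in> PC_hist r" "\<kappa> \<in> PC_hist r" "s \<in> ?I" for \<psi> \<kappa> :: "real \<Rightarrow> 'x" and s
    unfolding hist_norm_def using bdd[OF that(1,2)] that(3) by (intro cSUP_upper)
  have pos: "0 \<le> hist_norm r (\<lambda>s. \<psi> s - \<kappa> s)"
    if "\<psi> \<in> PC_hist r" "\<kappa> \<in> PC_hist r" for \<psi> \<kappa> :: "real \<Rightarrow> 'x"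
    using order_trans[OF norm_ge_zero upper[OF that, of 0]] assms by simp
  have upper': "norm (\<psi> s - \<kappa> s) \<le> hist_dist r \<psi> \<kappa>"
    if "\<psi> \<in> PC_hist r" "\<kappa> \<in> PC_hist r" "s \<in> ?I" for \<psi> \<kappa> :: "real \<Rightarrow> 'x" and s
    using upper[OF that] unfolding hist_dist_def by linarith
  show ?thesis
  proof
    fix \<psi> \<kappa> :: "real \<Rightarrow> 'x"
    show "0 \<le> hist_dist r \<psi> \<kappa>" by (simp add: hist_dist_def)
    show "hist_dist r \<psi> \<kappa> = hist_dist r \<kappa> \<psi>"
      by (simp add: hist_dist_def hist_norm_def norm_minus_commute)
  next
    fix \<psi> \<kappa> :: "real \<Rightarrow> 'x"
    assume M: "\<psi> \<in> PC_hist r" "\<kappa> \<in> PC_hist r"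
    show "hist_dist r \<psi> \<kappa> = 0 \<longleftrightarrow> \<psi> = \<kappa>"
    proof
      assume "hist_dist r \<psi> \<kappa> = 0"
      then have "\<psi> s = \<kappa> s" if "s \<in> ?I" for s
        using upper'[OF M that] by simp
      then show "\<psi> = \<kappa>"
        using M unfolding PC_hist_def by (intro extensionalityI[of _ ?I]) auto
    next
      assume "\<psi> = \<kappa>"
      then show "hist_dist r \<psi> \<kappa> = 0"
        using assms by (simp add: hist_dist_def hist_norm_def)
    qed
  next
    fix \<psi> \<kappa> \<eta> :: "real \<Rightarrow> 'x"
    assume M: "\<psi> \<in> PC_hist r" "\<kappa> \<in> PC_hist r" "\<eta> \<in> PC_hist r"
    have "hist_norm r (\<lambda>s. \<psi> s - \<eta> s) \<le> hist_dist r \<psi> \<kappa> + hist_dist r \<kappa> \<eta>"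
      unfolding hist_norm_def
    proof (rule cSUP_least)
      fix s assume s: "s \<in> ?I"
      have "norm (\<psi> s - \<eta> s) \<le> norm (\<psi> s - \<kappa> s) + norm (\<kappa> s - \<eta> s)"
        using norm_triangle_ineq[of "\<psi> s - \<kappa> s" "\<kappa> s - \<eta> s"] by simp
      with upper'[OF M(1,2) s] upper'[OF M(2,3) s]
      show "norm (\<psi> s - \<eta> s) \<le> hist_dist r \<psi> \<kappa> + hist_dist r \<kappa> \<eta>" by linarith
    qed (use assms in simp)
    then show "hist_dist r \<psi> \<eta> \<le> hist_dist r \<psi> \<kappa> + hist_dist r \<kappa> \<eta>"
      using pos[OF M(1,3)] by (simp add: hist_dist_def[of r \<psi> \<eta>])
  qed
qed

definition segment :: "real \<Rightarrow> (real \<Rightarrow> 'x) \<Rightarrow> real \<Rightarrow> real \<Rightarrow> 'x"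
  where "segment r x t = restrict (\<lambda>s. x (t + s)) {- r..0}"

text \<open>The impulse times are \<open>tt 1, \<dots>, tt K\<close>, with \<open>tt 0 = 0\<close> and \<open>tt (Suc K) = T\<close>.\<close>

definition PC_space :: "nat \<Rightarrow> (nat \<Rightarrow> real) \<Rightarrow> (real \<Rightarrow> 'x::topological_space) set"
  where "PC_space K tt = {x.
    continuous_on {tt 0..tt 1} x \<and>
    (\<forall>k\<in>{1..K}. continuous_on {tt k<..tt (Suc k)} x \<and>
       (x \<longlongrightarrow> x (tt k)) (at_left (tt k)) \<and>
       (\<exists>l. (x \<longlongrightarrow> l) (at_right (tt k))))}"

text \<open>The functions on \<open>[-r, T]\<close> whose segments lie in \<open>PC_hist r\<close> and whose restriction to
  \<open>[0, T]\<close> lies in \<open>PC_space K tt\<close>.  Values outside \<open>[-r, T]\<close> play no role.\<close>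

definition state_space :: "real \<Rightarrow> nat \<Rightarrow> (nat \<Rightarrow> real) \<Rightarrow> (real \<Rightarrow> 'x::real_normed_vector) set"
  where "state_space r K tt = {x. segment r x 0 \<in> PC_hist r \<and> x \<in> PC_space K tt}"

definition Lp_nonneg :: "real \<Rightarrow> real \<Rightarrow> (real \<Rightarrow> real) set"
  where "Lp_nonneg q T = {h. (\<forall>t\<in>{0..T}. 0 \<le> h t) \<and>
    set_borel_measurable lebesgue {0..T} h \<and>
    set_integrable lebesgue {0..T} (\<lambda>t. \<bar>h t\<bar> powr q)}"

definition Lp_norm :: "real \<Rightarrow> real \<Rightarrow> (real \<Rightarrow> real) \<Rightarrow> real"
  where "Lp_norm q T h = (LINT t:{0..T}|lebesgue. \<bar>h t\<bar> powr q) powr (1 / q)"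

definition L2_controls :: "real \<Rightarrow> (real \<Rightarrow> 'u::{complex_hilbert, second_countable_topology}) set"
  where "L2_controls T = {u. set_borel_measurable lebesgue {0..T} u \<and>
    set_integrable lebesgue {0..T} (\<lambda>t. (norm (u t))\<^sup>2)}"


section \<open>Mild solutions and approximate controllability\<close>

text \<open>The nonlocal history condition \<open>x(s) + g(x\<^sub>t)(s) = \<phi>(s)\<close>, \<open>s \<in> [-r, 0]\<close>, is imposed at the
  initial time \<open>t = 0\<close>, where the segment \<open>x\<^sub>0\<close> is the history itself.  At \<open>s = 0\<close> it then agrees
  with the integral equation at time \<open>0\<close>.  If it were imposed for all \<open>t \<in> [0, T]\<close> at once, its
  instance \<open>s = 0\<close> would make \<open>g(x\<^sub>t)(0)\<close> independent of \<open>t\<close>; for \<open>g\<close> acting pointwise as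
  \<open>v \<mapsto> c v\<close>, with \<open>c > 0\<close>, every solution would be constant on \<open>[0, T]\<close>.\<close>

definition mild_solution ::
    "real \<Rightarrow> real \<Rightarrow> nat \<Rightarrow> (nat \<Rightarrow> real) \<Rightarrow>
     (real \<Rightarrow> 'x::{complex_banach, second_countable_topology} \<Rightarrow> 'x) \<Rightarrow>
     ('u::{complex_hilbert, second_countable_topology} \<Rightarrow> 'x) \<Rightarrow>
     (real \<Rightarrow> 'x \<Rightarrow> (real \<Rightarrow> 'x) \<Rightarrow> 'x) \<Rightarrow> (nat \<Rightarrow> 'x \<Rightarrow> 'x) \<Rightarrow>
     ((real \<Rightarrow> 'x) \<Rightarrow> real \<Rightarrow> 'x) \<Rightarrow> (real \<Rightarrow> 'x) \<Rightarrow>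
     (real \<Rightarrow> 'u) \<Rightarrow> (real \<Rightarrow> 'x) \<Rightarrow> bool"
  where "mild_solution r T K tt S B f I g \<phi> u x \<longleftrightarrow>
    x \<in> state_space r K tt \<and>
    (\<forall>s\<in>{- r..0}. x s = \<phi> s - g (segment r x 0) s) \<and>
    (\<forall>t\<in>{0..T}.
      set_integrable lebesgue {0..t} (\<lambda>s. S (t - s) (B (u s))) \<and>
      set_integrable lebesgue {0..t} (\<lambda>s. S (t - s) (f s (x s) (segment r x s))) \<and>
      x t = S t (\<phi> 0 - g (segment r x t) 0)
        + (\<Sum>k | k \<in> {1..K} \<and> tt k < t. S (t - tt k) (I k (Lim (at_left (tt k)) x)))
        + (LINT s:{0..t}|lebesgue. S (t - s) (B (u s)))
        + (LINT s:{0..t}|lebesgue. S (t - s) (f s (x s) (segment r x s))))"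

definition reachable_set ::
    "real \<Rightarrow> real \<Rightarrow> nat \<Rightarrow> (nat \<Rightarrow> real) \<Rightarrow>
     (real \<Rightarrow> 'x::{complex_banach, second_countable_topology} \<Rightarrow> 'x) \<Rightarrow>
     ('u::{complex_hilbert, second_countable_topology} \<Rightarrow> 'x) \<Rightarrow>
     (real \<Rightarrow> 'x \<Rightarrow> (real \<Rightarrow> 'x) \<Rightarrow> 'x) \<Rightarrow> (nat \<Rightarrow> 'x \<Rightarrow> 'x) \<Rightarrow>
     ((real \<Rightarrow> 'x) \<Rightarrow> real \<Rightarrow> 'x) \<Rightarrow> (real \<Rightarrow> 'x) \<Rightarrow> 'x set"
  where "reachable_set r T K tt S B f I g \<phi> =
    {x T | x u. u \<in> L2_controls T \<and> mild_solution r T K tt S B f I g \<phi> u x}"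

definition approximately_controllable ::
    "real \<Rightarrow> real \<Rightarrow> nat \<Rightarrow> (nat \<Rightarrow> real) \<Rightarrow>
     (real \<Rightarrow> 'x::{complex_banach, second_countable_topology} \<Rightarrow> 'x) \<Rightarrow>
     ('u::{complex_hilbert, second_countable_topology} \<Rightarrow> 'x) \<Rightarrow>
     (real \<Rightarrow> 'x \<Rightarrow> (real \<Rightarrow> 'x) \<Rightarrow> 'x) \<Rightarrow> (nat \<Rightarrow> 'x \<Rightarrow> 'x) \<Rightarrow>
     ((real \<Rightarrow> 'x) \<Rightarrow> real \<Rightarrow> 'x) \<Rightarrow> (real \<Rightarrow> 'x) \<Rightarrow> bool"
  where "approximately_controllable r T K tt S B f I g \<phi> \<longleftrightarrow>
    closure (reachable_set r T K tt S B f I g \<phi>) = UNIV"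

end

theory Submission
  imports Defs "HOL-Complex_Analysis.Cauchy_Integral_Formula"
begin

text \<open>Because the nonlinearity is bounded by an integrable function, what it contributes during a
  short final interval \<open>[T - \<eta>, T]\<close> is small whatever the control does there.  So a target \<open>h\<close> is
  approached as follows.  Up to time \<open>T - \<eta>\<close>, chosen after the last impulse, no control is applied;
  this fixes the impulses and, up to a small error, the nonlinear integral in the formula for the
  state at time \<open>T\<close>.  In the remaining time a control is applied under which the linear part
  \<open>\<integral> S (T - s) (B (u s)) ds\<close> makes up for the difference.  The one term that depends on the final
  state itself, \<open>S T (g0 (x T))\<close>, is Lipschitz with constant \<open>M lg < 1\<close>, hence amplifies the error
  only by the factor \<open>1 / (1 - M lg)\<close> (\<open>approximately_controllableI\<close>).

  This needs two things.  First, the solution must exist for every control and must not depend on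
  future controls (\<open>solution_exists\<close>, \<open>solution_causal\<close>).  The second factor in the smallness
  condition on the constants is at least \<open>1\<close>, so the first one is less than \<open>1\<close> and the right-hand
  side of the integral equation is a contraction for the supremum norm, with any control.  That it
  maps piecewise continuous functions to such functions rests on the strong continuity of \<open>S\<close>, also
  at \<open>t = 0\<close>, where it is read off from the path integral: for \<open>x\<close> in the domain of \<open>A\<close> the difference
  \<open>S t x - x\<close> is a path integral whose limit vanishes by Cauchy's theorem (\<open>S_tendsto_id_domain\<close>).

  Second, the states that linear controls reach within a short final interval must be dense.  Let
  \<open>Y\<close> be their closure.  It contains \<open>S t (B v)\<close> for small \<open>t\<close>, and since \<open>t \<mapsto> S t (B v)\<close> is analytic on
  \<open>(0, \<infinity>)\<close> it contains these vectors for all \<open>t\<close> (\<open>S_in_closed_subspace\<close>).  Then \<open>Y\<close> contains all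
  values of the controllability operator and with them \<open>h - z \<delta> h = \<Gamma> (J (z \<delta> h)) / \<delta>\<close>, which tends to
  \<open>h\<close> as \<open>\<delta>\<close> decreases to \<open>0\<close>; so \<open>Y\<close> is the whole space.\<close>

section \<open>Complex scalars\<close>

lemma bounded_bilinear_scaleC:
  "bounded_bilinear (scaleC :: complex \<Rightarrow> 'a::complex_banach \<Rightarrow> 'a)"
proof
  fix a b :: complex and x y :: 'a and r :: real
  show "(a + b) *\<^sub>C x = a *\<^sub>C x + b *\<^sub>C x" by (rule scaleC_add_left)
  show "a *\<^sub>C (x + y) = a *\<^sub>C x + a *\<^sub>C y" by (rule scaleC_add_right)
  show "(r *\<^sub>R a) *\<^sub>C x = r *\<^sub>R a *\<^sub>C x"
    by (metis scaleC_of_real scaleC_scaleC scaleR_conv_of_real)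
  show "a *\<^sub>C r *\<^sub>R x = r *\<^sub>R a *\<^sub>C x"
    by (metis mult.commute scaleC_of_real scaleC_scaleC)
  show "\<exists>K. \<forall>a x. norm (a *\<^sub>C (x::'a)) \<le> norm a * norm x * K"
    by (rule exI[of _ 1]) (simp add: norm_scaleC)
qed

interpretation scaleC: bounded_bilinear "scaleC :: complex \<Rightarrow> 'a::complex_banach \<Rightarrow> 'a"
  by (rule bounded_bilinear_scaleC)

declare scaleC.continuous_on [continuous_intros]

lemma scaleC_one [simp]: "1 *\<^sub>C (x::'a::complex_banach) = x"
  using scaleC_of_real[of 1 x] by simp

lemma bounded_clinear_scaleC: "bounded_clinear (\<lambda>x::'a::complex_banach. c *\<^sub>C x)"
  by (simp add: bounded_clinear_def scaleC.bounded_linear_right scaleC_scaleC mult.commute)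

lemma duality_map_clinear:
  assumes "\<forall>x. duality_set x = {J (x::'x::complex_banach)}"
  shows "bounded_clinear (J x)" and "J x x = complex_of_real ((norm x)\<^sup>2)"
proof -
  have "J x \<in> duality_set x" using assms by simp
  then show "bounded_clinear (J x)" and "J x x = complex_of_real ((norm x)\<^sup>2)"
    by (auto simp: duality_set_def dual_space_def)
qed

section \<open>Integrals along Hankel paths\<close>

abbreviation polar :: "real \<Rightarrow> real \<Rightarrow> complex"
  where "polar s \<xi> \<equiv> complex_of_real s * cis \<xi>"


definition hankel_path :: "real \<Rightarrow> real \<Rightarrow> complex set"
  where "hankel_path \<rho> \<beta> =
    (\<lambda>\<xi>. complex_of_real \<rho> * cis \<xi>) ` {- \<beta>..\<beta>} \<union>
    (\<lambda>s. complex_of_real s * cis \<beta>) ` {\<rho>..} \<union> (\<lambda>s. complex_of_real s * cis (- \<beta>)) ` {\<rho>..}"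

abbreviation arc_integrand :: "(complex \<Rightarrow> 'x::complex_banach) \<Rightarrow> real \<Rightarrow> real \<Rightarrow> 'x"
  where "arc_integrand G R \<equiv> \<lambda>\<xi>. (\<i> * complex_of_real R * cis \<xi>) *\<^sub>C G (polar R \<xi>)"

abbreviation ray_integrand :: "(complex \<Rightarrow> 'x::complex_banach) \<Rightarrow> real \<Rightarrow> real \<Rightarrow> 'x"
  where "ray_integrand G \<phi> \<equiv> \<lambda>s. cis \<phi> *\<^sub>C G (polar s \<phi>)"

definition hankel_integrable ::
    "real \<Rightarrow> real \<Rightarrow> (complex \<Rightarrow> 'x::{complex_banach, second_countable_topology}) \<Rightarrow> bool"
  where "hankel_integrable \<rho> \<beta> G \<longleftrightarrow>
    set_integrable lborel {- \<beta>..\<beta>} (arc_integrand G \<rho>) \<and>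
    set_integrable lborel {\<rho>..} (ray_integrand G \<beta>) \<and>
    set_integrable lborel {\<rho>..} (ray_integrand G (- \<beta>))"

lemma set_integral_commute_bounded_linear:
  fixes h :: "'a \<Rightarrow> 'b::{banach, second_countable_topology}"
    and L :: "'b \<Rightarrow> 'c::{banach, second_countable_topology}"
  assumes "bounded_linear L" "set_integrable N E h"
  shows "set_integrable N E (\<lambda>s. L (h s))" and "(LINT s:E|N. L (h s)) = L (LINT s:E|N. h s)"
proof -
  interpret L: bounded_linear L by fact
  have eq: "(\<lambda>x. indicat_real E x *\<^sub>R L (h x)) = (\<lambda>x. L (indicat_real E x *\<^sub>R h x))"
    by (simp add: L.scaleR)
  show "set_integrable N E (\<lambda>s. L (h s))" "(LINT s:E|N. L (h s)) = L (LINT s:E|N. h s)"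
    using assms(2) unfolding set_integrable_def set_lebesgue_integral_def eq
    by (auto intro: integrable_bounded_linear[OF assms(1)] integral_bounded_linear[OF assms(1)])
qed

lemma hankel_integral_add:
  assumes "hankel_integrable \<rho> \<beta> G" "hankel_integrable \<rho> \<beta> H"
  shows "hankel_integral \<rho> \<beta> (\<lambda>\<zeta>. G \<zeta> + H \<zeta>) = hankel_integral \<rho> \<beta> G + hankel_integral \<rho> \<beta> H"
  using assms unfolding hankel_integrable_def hankel_integral_def
  by (simp add: scaleC_add_right algebra_simps)

lemma hankel_integrable_add:
  assumes "hankel_integrable \<rho> \<beta> G" "hankel_integrable \<rho> \<beta> H"
  shows "hankel_integrable \<rho> \<beta> (\<lambda>\<zeta>. G \<zeta> + H \<zeta>)"
  using assms unfolding hankel_integrable_def by (simp add: scaleC_add_right)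

lemma hankel_integral_bounded_clinear:
  assumes L: "bounded_clinear L" and G: "hankel_integrable \<rho> \<beta> G"
  shows "hankel_integral \<rho> \<beta> (\<lambda>\<zeta>. L (G \<zeta>)) = L (hankel_integral \<rho> \<beta> G)"
proof -
  have lin: "bounded_linear L" and C: "c *\<^sub>C L x = L (c *\<^sub>C x)" for c x
    using L by (auto simp: bounded_clinear_def)
  interpret bounded_linear L by fact
  show ?thesis
    using G unfolding hankel_integrable_def hankel_integral_def C
    by (simp add: set_integral_commute_bounded_linear(2)[OF lin] add diff)
qed

lemma hankel_integrable_bounded_clinear:
  assumes L: "bounded_clinear L" and G: "hankel_integrable \<rho> \<beta> G"
  shows "hankel_integrable \<rho> \<beta> (\<lambda>\<zeta>. L (G \<zeta>))"
proof -
  have lin: "bounded_linear L" and C: "c *\<^sub>C L x = L (c *\<^sub>C x)" for c x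
    using L by (auto simp: bounded_clinear_def)
  show ?thesis
    using G unfolding hankel_integrable_def C
    by (auto intro: set_integral_commute_bounded_linear(1)[OF lin])
qed

lemma hankel_integral_cong:
  assumes "\<And>\<zeta>. \<zeta> \<in> hankel_path \<rho> \<beta> \<Longrightarrow> G \<zeta> = H \<zeta>"
  shows "hankel_integral \<rho> \<beta> G = hankel_integral \<rho> \<beta> H"
proof -
  have "G (polar \<rho> \<xi>) = H (polar \<rho> \<xi>)" if "\<xi> \<in> {- \<beta>..\<beta>}" for \<xi>
    using that by (intro assms) (auto simp: hankel_path_def)
  moreover have "G (polar s \<phi>) = H (polar s \<phi>)"
    if "s \<in> {\<rho>..}" "\<phi> = \<beta> \<or> \<phi> = - \<beta>" for s \<phi>
    using that by (intro assms) (auto simp: hankel_path_def)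
  ultimately show ?thesis
    unfolding hankel_integral_def
    by (intro arg_cong2[where f = "(+)"] arg_cong2[where f = "(-)"] set_lebesgue_integral_cong allI impI) simp_all
qed

lemma set_integral_dominated_continuous:
  fixes G :: "nat \<Rightarrow> real \<Rightarrow> 'x::{banach, second_countable_topology}"
  assumes E: "E \<in> sets borel" and cont: "\<And>n. continuous_on E (G n)" "continuous_on E H"
    and w: "set_integrable lborel E w"
    and bnd: "\<And>n s. s \<in> E \<Longrightarrow> norm (G n s) \<le> w s"
    and lim: "\<And>s. s \<in> E \<Longrightarrow> (\<lambda>n. G n s) \<longlonglongrightarrow> H s"
  shows "(\<lambda>n. LINT s:E|lborel. G n s) \<longlonglongrightarrow> (LINT s:E|lborel. H s)"
    "set_integrable lborel E (G n)" "set_integrable lborel E H"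
proof -
  have m: "(\<lambda>s. indicat_real E s *\<^sub>R K s) \<in> borel_measurable lborel"
    if "continuous_on E K" for K :: "real \<Rightarrow> 'x"
    using borel_measurable_continuous_on_indicator[OF E that] by simp
  have b: "AE s in lborel. norm (indicat_real E s *\<^sub>R G n s) \<le> indicat_real E s *\<^sub>R w s" for n
    using bnd by (auto simp: indicator_def)
  have l: "AE s in lborel. (\<lambda>n. indicat_real E s *\<^sub>R G n s) \<longlonglongrightarrow> indicat_real E s *\<^sub>R H s"
    using lim by (intro AE_I2) (auto simp: indicator_def)
  note dom = integral_dominated_convergence[OF m m w[unfolded set_integrable_def] l b]
    integrable_dominated_convergence[OF m m w[unfolded set_integrable_def] l b]
    integrable_dominated_convergence2[OF m m w[unfolded set_integrable_def] l b]
  show "(\<lambda>n. LINT s:E|lborel. G n s) \<longlonglongrightarrow> (LINT s:E|lborel. H s)"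
    "set_integrable lborel E (G n)" "set_integrable lborel E H"
    unfolding set_lebesgue_integral_def set_integrable_def using dom cont by blast+
qed

text \<open>The arc has finite length, so there a constant dominates; along the two rays an integrable
  function of the modulus is required.\<close>

lemma hankel_dominated_convergence:
  fixes G :: "nat \<Rightarrow> complex \<Rightarrow> 'x::{complex_banach, second_countable_topology}"
  assumes cont: "\<And>n. continuous_on (hankel_path \<rho> \<beta>) (G n)" "continuous_on (hankel_path \<rho> \<beta>) H"
    and "0 < \<rho>"
    and arc: "\<And>n \<xi>. \<bar>\<xi>\<bar> \<le> \<beta> \<Longrightarrow> norm (G n (polar \<rho> \<xi>)) \<le> k"
    and w: "set_integrable lborel {\<rho>..} w"
    and ray: "\<And>n s \<phi>. \<rho> \<le> s \<Longrightarrow> \<phi> \<in> {\<beta>, - \<beta>} \<Longrightarrow> norm (G n (polar s \<phi>)) \<le> w s"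
    and lim: "\<And>\<zeta>. \<zeta> \<in> hankel_path \<rho> \<beta> \<Longrightarrow> (\<lambda>n. G n \<zeta>) \<longlonglongrightarrow> H \<zeta>"
  shows "(\<lambda>n. hankel_integral \<rho> \<beta> (G n)) \<longlonglongrightarrow> hankel_integral \<rho> \<beta> H"
    and "hankel_integrable \<rho> \<beta> (G n)" and "hankel_integrable \<rho> \<beta> H"
proof -
  let ?P = "hankel_path \<rho> \<beta>"
  have c1: "continuous_on {- \<beta>..\<beta>} (arc_integrand F \<rho>)"
    if "continuous_on ?P F" for F :: "complex \<Rightarrow> 'x"
    by (intro continuous_intros continuous_on_compose2[OF that]) (auto simp: hankel_path_def)
  have c2: "continuous_on {\<rho>..} (ray_integrand F \<phi>)"
    if "continuous_on ?P F" "\<phi> \<in> {\<beta>, - \<beta>}" for F :: "complex \<Rightarrow> 'x" and \<phi>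
    by (intro continuous_intros continuous_on_compose2[OF that(1)])
      (use that(2) in \<open>auto simp: hankel_path_def\<close>)
  have arc': "norm (arc_integrand (G n) \<rho> \<xi>) \<le> \<rho> * k" if "\<xi> \<in> {- \<beta>..\<beta>}" for n \<xi>
    using arc[of \<xi> n] that \<open>0 < \<rho>\<close> by (simp add: norm_scaleC norm_mult abs_le_iff)
  have arc_lim: "(\<lambda>n. arc_integrand (G n) \<rho> \<xi>) \<longlonglongrightarrow> arc_integrand H \<rho> \<xi>" if "\<xi> \<in> {- \<beta>..\<beta>}" for \<xi>
    by (intro scaleC.tendsto tendsto_const lim) (use that in \<open>auto simp: hankel_path_def\<close>)
  have "set_integrable lborel {- \<beta>..\<beta>} (\<lambda>_. \<rho> * k)"
    by (intro borel_integrable_atLeastAtMost' continuous_intros)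
  note d1 = set_integral_dominated_continuous[where G = "\<lambda>n. arc_integrand (G n) \<rho>",
      OF _ c1[OF cont(1)] c1[OF cont(2)] this arc' arc_lim]
  have ray': "norm (ray_integrand (G n) \<phi> s) \<le> w s" if "\<phi> \<in> {\<beta>, - \<beta>}" "s \<in> {\<rho>..}" for \<phi> n s
    using ray[of s \<phi> n] that by (simp add: norm_scaleC)
  have ray_lim: "(\<lambda>n. ray_integrand (G n) \<phi> s) \<longlonglongrightarrow> ray_integrand H \<phi> s"
    if "\<phi> \<in> {\<beta>, - \<beta>}" "s \<in> {\<rho>..}" for \<phi> s
    by (intro scaleC.tendsto tendsto_const lim) (use that in \<open>auto simp: hankel_path_def\<close>)
  note d2 = set_integral_dominated_continuous[where G = "\<lambda>n. ray_integrand (G n) \<phi>" for \<phi>,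
      OF _ c2[OF cont(1)] c2[OF cont(2)] w ray' ray_lim]
  show "(\<lambda>n. hankel_integral \<rho> \<beta> (G n)) \<longlonglongrightarrow> hankel_integral \<rho> \<beta> H"
    unfolding hankel_integral_def by (intro tendsto_add tendsto_diff d1 d2) auto
  show "hankel_integrable \<rho> \<beta> (G n)" "hankel_integrable \<rho> \<beta> H"
    unfolding hankel_integrable_def using d1 d2 by auto
qed

lemma hankel_integrableI:
  fixes G :: "complex \<Rightarrow> 'x::{complex_banach, second_countable_topology}"
  assumes "continuous_on (hankel_path \<rho> \<beta>) G" "0 < \<rho>"
    and "\<And>\<xi>. \<bar>\<xi>\<bar> \<le> \<beta> \<Longrightarrow> norm (G (polar \<rho> \<xi>)) \<le> k"
    and "set_integrable lborel {\<rho>..} w"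
    and "\<And>s \<phi>. \<rho> \<le> s \<Longrightarrow> \<phi> \<in> {\<beta>, - \<beta>} \<Longrightarrow> norm (G (polar s \<phi>)) \<le> w s"
  shows "hankel_integrable \<rho> \<beta> G"
  by (rule hankel_dominated_convergence(3)[where G = "\<lambda>_. G"]) (use assms in auto)

definition arc_integral :: "real \<Rightarrow> (complex \<Rightarrow> complex) \<Rightarrow> real \<Rightarrow> complex"
  where "arc_integral \<beta> G R =
    integral {- \<beta>..\<beta>} (\<lambda>\<xi>. \<i> * complex_of_real R * cis \<xi> * G (polar R \<xi>))"

text \<open>The derivative in \<open>R\<close> of the integral over the arc of radius \<open>R\<close> is the difference of the
  values of the integrand on the two rays, because \<open>\<i> d/dR (R e\<^sup>i\<^sup>\<xi> G(R e\<^sup>i\<^sup>\<xi>)) = d/d\<xi> (e\<^sup>i\<^sup>\<xi> G(R e\<^sup>i\<^sup>\<xi>))\<close>.\<close>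

lemma arc_integral_derivative:
  fixes G :: "complex \<Rightarrow> complex"
  assumes U: "open U" and hol: "G holomorphic_on U"
    and sub: "\<And>s \<xi>. a < s \<Longrightarrow> \<bar>\<xi>\<bar> \<le> \<beta> \<Longrightarrow> polar s \<xi> \<in> U"
    and R: "a < R" and \<beta>: "0 < \<beta>"
  shows "(arc_integral \<beta> G has_vector_derivative
      (cis \<beta> * G (polar R \<beta>) - cis (- \<beta>) * G (polar R (- \<beta>)))) (at R)"
proof -
  let ?G' = "deriv G"
  have hol': "?G' holomorphic_on U" using hol U by (rule holomorphic_deriv)
  have dG: "(G has_field_derivative ?G' \<zeta>) (at \<zeta>)" if "\<zeta> \<in> U" for \<zeta>
    using hol U that by (rule holomorphic_derivI)
  define f where "f = (\<lambda>R \<xi>. \<i> * complex_of_real R * cis \<xi> * G (polar R \<xi>))"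
  define f' where "f' = (\<lambda>R \<xi>. \<i> * cis \<xi> * (G (polar R \<xi>)
      + complex_of_real R * cis \<xi> * ?G' (polar R \<xi>)))"
  have fx: "((\<lambda>R. f R \<xi>) has_vector_derivative f' R \<xi>) (at R within {a<..})"
    if "R \<in> {a<..}" "\<xi> \<in> cbox (- \<beta>) \<beta>" for R \<xi>
  proof -
    have U: "complex_of_real R * cis \<xi> \<in> U" using that by (intro sub) auto
    have d1: "((\<lambda>R. complex_of_real R * cis \<xi>) has_vector_derivative cis \<xi>) (at R within {a<..})"
      by (auto intro!: derivative_eq_intros has_vector_derivative_of_real simp: has_vector_derivative_mult_left)
    have "(G \<circ> (\<lambda>R. complex_of_real R * cis \<xi>) has_vector_derivative cis \<xi> * ?G' (polar R \<xi>))
        (at R within {a<..})"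
      by (rule field_vector_diff_chain_within[OF d1]) (rule has_field_derivative_at_within[OF dG[OF U]])
    then have d2: "((\<lambda>R. G (polar R \<xi>)) has_vector_derivative
        cis \<xi> * ?G' (polar R \<xi>)) (at R within {a<..})"
      by (simp add: o_def)
    have "((\<lambda>R. \<i> * ((polar R \<xi>) * G (polar R \<xi>))) has_vector_derivative
        \<i> * ((polar R \<xi>) * (cis \<xi> * ?G' (polar R \<xi>))
          + cis \<xi> * G (polar R \<xi>))) (at R within {a<..})"
      by (intro has_vector_derivative_mult_right has_vector_derivative_mult d1 d2)
    then show ?thesis by (simp add: f_def f'_def algebra_simps)
  qed
  have contG: "continuous_on U G" "continuous_on U ?G'"
    using hol hol' holomorphic_on_imp_continuous_on by blast+
  have cont: "continuous_on ({a<..} \<times> cbox (- \<beta>) \<beta>) (\<lambda>(R, \<xi>). f' R \<xi>)"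
    unfolding f'_def split_beta
    by (intro continuous_intros continuous_on_compose2[OF contG(1)] continuous_on_compose2[OF contG(2)])
      (auto intro!: sub)
  have int: "f R integrable_on cbox (- \<beta>) \<beta>" if "R \<in> {a<..}" for R
    unfolding f_def
    by (intro integrable_continuous continuous_intros continuous_on_compose2[OF contG(1)])
      (use that in \<open>auto intro!: sub\<close>)
  have "((\<lambda>x. integral (cbox (- \<beta>) \<beta>) (f x)) has_vector_derivative
      integral (cbox (- \<beta>) \<beta>) (f' R)) (at R within {a<..})"
    by (rule leibniz_rule_vector_derivative[OF fx int cont]) (use R in auto)
  then have D: "((\<lambda>x. integral {- \<beta>..\<beta>} (f x)) has_vector_derivative
      integral {- \<beta>..\<beta>} (f' R)) (at R)"
    using R by (simp add: at_within_open[of R "{a<..}"])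
  have "(f' R has_integral (cis \<beta> * G (polar R \<beta>)
      - cis (- \<beta>) * G (polar R (- \<beta>)))) {- \<beta>..\<beta>}"
  proof (rule fundamental_theorem_of_calculus)
    fix \<xi> assume \<xi>: "\<xi> \<in> {- \<beta>..\<beta>}"
    have U: "complex_of_real R * cis \<xi> \<in> U" using R \<xi> by (intro sub) auto
    have d0: "(cis has_vector_derivative \<i> * cis \<xi>) (at \<xi> within {- \<beta>..\<beta>})"
      unfolding has_vector_derivative_def by (auto intro!: derivative_eq_intros)
    have d1: "((\<lambda>\<xi>. complex_of_real R * cis \<xi>) has_vector_derivative
        complex_of_real R * (\<i> * cis \<xi>)) (at \<xi> within {- \<beta>..\<beta>})"
      by (intro has_vector_derivative_mult_right d0)
    have "(G \<circ> (\<lambda>\<xi>. complex_of_real R * cis \<xi>) has_vector_derivative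
        (complex_of_real R * (\<i> * cis \<xi>)) * ?G' (polar R \<xi>)) (at \<xi> within {- \<beta>..\<beta>})"
      by (rule field_vector_diff_chain_within[OF d1]) (rule has_field_derivative_at_within[OF dG[OF U]])
    then have d2: "((\<lambda>\<xi>. G (polar R \<xi>)) has_vector_derivative
        (complex_of_real R * (\<i> * cis \<xi>)) * ?G' (polar R \<xi>)) (at \<xi> within {- \<beta>..\<beta>})"
      by (simp add: o_def)
    show "((\<lambda>\<xi>. cis \<xi> * G (polar R \<xi>)) has_vector_derivative f' R \<xi>) (at \<xi> within {- \<beta>..\<beta>})"
      using has_vector_derivative_mult[OF d0 d2] by (simp add: f'_def algebra_simps)
  qed (use \<beta> in auto)
  then have "integral {- \<beta>..\<beta>} (f' R) = cis \<beta> * G (polar R \<beta>)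
      - cis (- \<beta>) * G (polar R (- \<beta>))" by (rule integral_unique)
  with D show ?thesis by (simp add: f_def arc_integral_def[abs_def])
qed

section \<open>Scalar Hankel integrals\<close>

lemma set_integrable_ray:
  assumes "continuous_on {\<rho>..} w" "w integrable_on {\<rho>..}" "\<And>s. \<rho> \<le> s \<Longrightarrow> 0 \<le> w s"
  shows "set_integrable lborel {\<rho>..} (w :: real \<Rightarrow> real)"
proof -
  have "integrable lebesgue (\<lambda>s. indicat_real {\<rho>..} s *\<^sub>R w s)"
    using nonnegative_absolutely_integrable_1[OF assms(2)] assms(3)
    by (simp add: set_integrable_def)
  moreover have "(\<lambda>s. indicat_real {\<rho>..} s *\<^sub>R w s) \<in> borel_measurable lborel"
    using borel_measurable_continuous_on_indicator[OF _ assms(1)] by simp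
  ultimately show ?thesis by (simp add: set_integrable_def integrable_completion)
qed

lemma set_integrable_exp_ray:
  assumes "(a::real) > 0"
  shows "set_integrable lborel {\<rho>..} (\<lambda>s. k * exp (- a * s))"
proof -
  have "set_integrable lborel {\<rho>..} (\<lambda>s. exp (- a * s))"
  proof (rule set_integrable_ray)
    show "continuous_on {\<rho>..} (\<lambda>s. exp (- a * s))" by (intro continuous_intros)
    show "(\<lambda>s. exp (- a * s)) integrable_on {\<rho>..}"
      by (rule integrable_on_exp_minus_to_infinity[OF assms])
  qed simp
  then show ?thesis by (rule set_integrable_mult_right)
qed

lemma set_integrable_powr_ray:
  assumes "a > 1" "(\<rho>::real) > 0"
  shows "set_integrable lborel {\<rho>..} (\<lambda>s. k * s powr - a)"
proof -
  have "set_integrable lborel {\<rho>..} (\<lambda>s. s powr - a)"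
  proof (rule set_integrable_ray)
    show "(\<lambda>s. s powr - a) integrable_on {\<rho>..}"
      using has_integral_powr_to_inf[of "- a" \<rho>] assms by auto
  qed (use assms in \<open>auto intro!: continuous_intros\<close>)
  then show ?thesis by (rule set_integrable_mult_right)
qed

text \<open>When the arc moves outwards, its integral changes by exactly what the integrals over the rays
  lose; in the limit only the arc remains.\<close>

lemma arc_integral_tendsto_hankel_integral:
  fixes G :: "complex \<Rightarrow> complex"
  assumes U: "open U" and hol: "G holomorphic_on U"
    and sub: "\<And>s \<xi>. 0 < s \<Longrightarrow> \<bar>\<xi>\<bar> \<le> \<beta> \<Longrightarrow> polar s \<xi> \<in> U"
    and \<rho>: "0 < \<rho>" and \<beta>: "0 < \<beta>" and int: "hankel_integrable \<rho> \<beta> G"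
  shows "(arc_integral \<beta> G \<longlongrightarrow> hankel_integral \<rho> \<beta> G) at_top"
proof -
  define d where "d = (\<lambda>s. cis \<beta> * G (polar s \<beta>) - cis (- \<beta>) * G (polar s (- \<beta>)))"
  have contG: "continuous_on U G" using hol holomorphic_on_imp_continuous_on by blast
  have contd: "continuous_on {\<rho>..R} d" for R
    unfolding d_def by (intro continuous_intros continuous_on_compose2[OF contG])
      (use \<rho> \<beta> in \<open>auto intro!: sub\<close>)
  have int': "set_integrable lborel {\<rho>..} (\<lambda>s. cis \<beta> * G (polar s \<beta>))"
      "set_integrable lborel {\<rho>..} (\<lambda>s. cis (- \<beta>) * G (polar s (- \<beta>)))"
    using int by (auto simp: hankel_integrable_def scaleC_complex_def)
  have arc: "arc_integral \<beta> G \<rho> =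
      (LINT \<xi>:{- \<beta>..\<beta>}|lborel. \<i> * complex_of_real \<rho> * cis \<xi> * G (polar \<rho> \<xi>))"
    unfolding arc_integral_def using int
    by (subst set_borel_integral_eq_integral(2)) (auto simp: hankel_integrable_def scaleC_complex_def)
  have eq: "hankel_integral \<rho> \<beta> G = arc_integral \<beta> G \<rho> + (LINT s:{\<rho>..}|lborel. d s)"
    unfolding hankel_integral_def arc d_def scaleC_complex_def
    by (subst set_integral_diff(2)[OF int']) (rule add_diff_eq[symmetric])
  have fin: "arc_integral \<beta> G R = arc_integral \<beta> G \<rho> + (LINT s:{\<rho>..R}|lborel. d s)" if "\<rho> \<le> R" for R
  proof -
    have "(d has_integral (arc_integral \<beta> G R - arc_integral \<beta> G \<rho>)) {\<rho>..R}"
    proof (rule fundamental_theorem_of_calculus[OF that])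
      fix s assume s: "s \<in> {\<rho>..R}"
      have "(arc_integral \<beta> G has_vector_derivative d s) (at s)"
        unfolding d_def by (rule arc_integral_derivative[OF U hol sub]) (use s \<rho> \<beta> in auto)
      then show "(arc_integral \<beta> G has_vector_derivative d s) (at s within {\<rho>..R})"
        by (rule has_vector_derivative_at_within)
    qed
    then have "integral {\<rho>..R} d = arc_integral \<beta> G R - arc_integral \<beta> G \<rho>" by (rule integral_unique)
    moreover have "(LINT s:{\<rho>..R}|lborel. d s) = integral {\<rho>..R} d"
      by (intro set_borel_integral_eq_integral borel_integrable_atLeastAtMost' contd)
    ultimately show ?thesis by simp
  qed
  have "((\<lambda>R. LINT s:{\<rho>..R}|lborel. d s) \<longlongrightarrow> (LINT s:{\<rho>..}|lborel. d s)) at_top"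
    unfolding d_def by (rule tendsto_set_lebesgue_integral_at_top[OF _ set_integral_diff(1)[OF int']]) simp
  then have "((\<lambda>R. arc_integral \<beta> G \<rho> + (LINT s:{\<rho>..R}|lborel. d s)) \<longlongrightarrow> hankel_integral \<rho> \<beta> G) at_top"
    unfolding eq by (intro tendsto_intros)
  moreover have "eventually (\<lambda>R. arc_integral \<beta> G \<rho> + (LINT s:{\<rho>..R}|lborel. d s) = arc_integral \<beta> G R) at_top"
    using eventually_ge_at_top[of \<rho>] by eventually_elim (rule fin[symmetric])
  ultimately show ?thesis by (rule Lim_transform_eventually)
qed

text \<open>The arc of radius \<open>R\<close> contributes at most its length times \<open>k R\<^sup>-\<^sup>1\<^sup>-\<^sup>a\<close>, which tends to \<open>0\<close>.\<close>

lemma hankel_integral_eq_0: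
  fixes G :: "complex \<Rightarrow> complex"
  assumes U: "open U" and hol: "G holomorphic_on U"
    and sub: "\<And>s \<xi>. 0 < s \<Longrightarrow> \<bar>\<xi>\<bar> \<le> \<beta> \<Longrightarrow> polar s \<xi> \<in> U"
    and \<rho>: "0 < \<rho>" and \<beta>: "0 < \<beta>" and int: "hankel_integrable \<rho> \<beta> G"
    and a: "0 < a"
    and bnd: "\<And>s \<xi>. 0 < s \<Longrightarrow> \<bar>\<xi>\<bar> \<le> \<beta> \<Longrightarrow> norm (G (polar s \<xi>)) \<le> k * s powr (- 1 - a)"
  shows "hankel_integral \<rho> \<beta> G = 0"
proof -
  have contG: "continuous_on U G" using hol holomorphic_on_imp_continuous_on by blast
  have le: "norm (arc_integral \<beta> G R) \<le> 2 * \<beta> * k * R powr - a" if "0 < R" for R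
  proof -
    have "norm (arc_integral \<beta> G R) \<le> k * R powr - a * (\<beta> - (- \<beta>))"
      unfolding arc_integral_def
    proof (rule integral_bound)
      show "continuous_on {- \<beta>..\<beta>} (\<lambda>\<xi>. \<i> * complex_of_real R * cis \<xi> * G (polar R \<xi>))"
        by (intro continuous_intros continuous_on_compose2[OF contG])
          (use that in \<open>auto intro!: sub\<close>)
      fix \<xi> assume "\<xi> \<in> {- \<beta>..\<beta>}"
      then have "norm (\<i> * complex_of_real R * cis \<xi> * G (polar R \<xi>)) \<le> R * (k * R powr (- 1 - a))"
        using bnd[of R \<xi>] that by (simp add: norm_mult abs_le_iff)
      also have "R * (k * R powr (- 1 - a)) = k * R powr - a"
        using that by (simp add: powr_diff powr_minus field_simps)
      finally show "norm (\<i> * complex_of_real R * cis \<xi> * G (polar R \<xi>)) \<le> k * R powr - a" .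
    qed (use \<beta> in auto)
    then show ?thesis by (simp add: algebra_simps)
  qed
  have "((\<lambda>R. 2 * \<beta> * k * R powr - a) \<longlongrightarrow> 2 * \<beta> * k * 0) at_top"
    by (intro tendsto_intros tendsto_neg_powr filterlim_ident) (use a in auto)
  then have "(arc_integral \<beta> G \<longlongrightarrow> 0) at_top"
    by (intro Lim_null_comparison[of "arc_integral \<beta> G" "\<lambda>R. 2 * \<beta> * k * R powr - a"]
        eventually_mono[OF eventually_gt_at_top[of 0]] le) auto
  then show ?thesis
    using arc_integral_tendsto_hankel_integral[OF U hol sub \<rho> \<beta> int] tendsto_unique trivial_limit_at_top_linorder
    by blast
qed

text \<open>The integral over the full circle does not depend on its radius, since \<open>cis (- \<pi>) = cis \<pi>\<close> makes
  the two rays cancel; its limit at radius \<open>0\<close> is \<open>\<integral> \<i> d\<xi> = 2 \<pi> \<i>\<close>.\<close>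

lemma arc_integral_exp_circle:
  assumes "0 < R"
  shows "arc_integral pi (\<lambda>\<zeta>. exp (\<zeta> * complex_of_real t) / \<zeta>) R = 2 * complex_of_real pi * \<i>"
proof -
  let ?G = "\<lambda>\<zeta>. exp (\<zeta> * complex_of_real t) / \<zeta>"
  define h where "h = (\<lambda>R. integral {- pi..pi} (\<lambda>\<xi>. \<i> * exp (polar R \<xi> * complex_of_real t)))"
  have arc: "arc_integral pi ?G R = h R" if "0 < R" for R
    unfolding arc_integral_def h_def using that by (intro integral_cong) simp
  have hol: "?G holomorphic_on - {0}" by (auto intro!: holomorphic_intros)
  have "(arc_integral pi ?G has_vector_derivative 0) (at R)" if "0 < R" for R
  proof -
    have "cis (- pi) = cis pi" by (simp add: complex_eq_iff)
    then show ?thesis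
      using arc_integral_derivative[OF open_Compl[OF closed_singleton] hol, where a = 0 and R = R and \<beta> = pi] that by simp
  qed
  then have "(arc_integral pi ?G has_derivative (\<lambda>_. 0)) (at R within {0<..})" if "R \<in> {0<..}" for R
    using that by (auto simp: has_vector_derivative_def intro: has_derivative_at_withinI)
  then obtain c where c: "\<And>R. 0 < R \<Longrightarrow> arc_integral pi ?G R = c"
    using has_derivative_zero_constant[of "{0<..}" "arc_integral pi ?G"] by auto
  have "continuous_on UNIV h"
  proof -
    have "continuous_on UNIV (\<lambda>R. integral (cbox (- pi) pi) (\<lambda>\<xi>. \<i> * exp (polar R \<xi> * complex_of_real t)))"
      by (rule integral_continuous_on_param) (auto intro!: continuous_intros simp: split_beta)
    then show ?thesis by (simp add: h_def)
  qed
  then have "(h \<longlongrightarrow> h 0) (at_right 0)"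
    by (auto simp: continuous_on_def intro: tendsto_within_subset)
  moreover have "(h \<longlongrightarrow> c) (at_right 0)"
  proof (rule Lim_transform_eventually[OF tendsto_const])
    show "eventually (\<lambda>R. c = h R) (at_right 0)"
      using eventually_at_right_less[of 0] by (rule eventually_mono) (metis arc c)
  qed
  ultimately have "h 0 = c" using tendsto_unique trivial_limit_at_right_real by blast
  moreover have "h 0 = 2 * complex_of_real pi * \<i>"
    by (simp add: h_def scaleR_conv_of_real)
  ultimately show ?thesis using c assms by simp
qed

text \<open>Outside the arc \<open>\<bar>\<xi>\<bar> \<le> \<beta>\<close> the exponential decays on a large circle, since there
  \<open>cos \<xi> \<le> cos \<beta> < 0\<close>.  So the integral over the arc tends to that over the whole circle.\<close>

lemma hankel_integral_exp:
  assumes t: "0 < t" and \<rho>: "0 < \<rho>" and \<beta>: "pi / 2 < \<beta>" "\<beta> < pi"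
  shows "hankel_integrable \<rho> \<beta> (\<lambda>\<zeta>. exp (\<zeta> * complex_of_real t) / \<zeta>)"
    and "hankel_integral \<rho> \<beta> (\<lambda>\<zeta>. exp (\<zeta> * complex_of_real t) / \<zeta>) = 2 * complex_of_real pi * \<i>"
proof -
  let ?G = "\<lambda>\<zeta>. exp (\<zeta> * complex_of_real t) / \<zeta>"
  have cos: "cos \<beta> < 0" using \<beta> cos_lt_zero_pi[of \<beta>] cos_monotone_0_pi[of "pi/2" \<beta>] by simp
  have pos: "0 < \<beta>" using \<beta> pi_gt_zero by linarith
  have path: "hankel_path \<rho> \<beta> \<subseteq> - {0}" using \<rho> by (auto simp: hankel_path_def)
  show int: "hankel_integrable \<rho> \<beta> ?G"
  proof (rule hankel_integrableI)
    show "continuous_on (hankel_path \<rho> \<beta>) ?G"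
      using path by (intro continuous_intros) auto
    fix \<xi> :: real assume "\<bar>\<xi>\<bar> \<le> \<beta>"
    have "\<rho> * cos \<xi> * t \<le> \<rho> * 1 * t"
      by (intro mult_right_mono mult_left_mono) (use \<rho> t in auto)
    then show "norm (?G (polar \<rho> \<xi>)) \<le> exp (\<rho> * t) / \<rho>"
      using \<rho> by (simp add: norm_divide norm_mult divide_right_mono)
  next
    show "set_integrable lborel {\<rho>..} (\<lambda>s. (1 / \<rho>) * exp (- (- cos \<beta> * t) * s))"
      by (rule set_integrable_exp_ray) (use cos t in \<open>simp add: mult_neg_pos\<close>)
    fix s \<phi> assume "\<rho> \<le> s" "\<phi> \<in> {\<beta>, - \<beta>}"
    then show "norm (?G (polar s \<phi>)) \<le> (1 / \<rho>) * exp (- (- cos \<beta> * t) * s)"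
      using \<rho> by (auto simp: norm_divide norm_mult mult_ac intro!: frac_le)
  qed fact
  have lim: "(arc_integral \<beta> ?G \<longlongrightarrow> hankel_integral \<rho> \<beta> ?G) at_top"
    by (rule arc_integral_tendsto_hankel_integral[where U = "- {0}"])
      (use \<rho> pos int in \<open>auto intro!: holomorphic_intros\<close>)
  let ?g = "\<lambda>R \<xi>. \<i> * complex_of_real R * cis \<xi> * ?G (polar R \<xi>)"
  have le: "norm (arc_integral \<beta> ?G R - 2 * complex_of_real pi * \<i>) \<le> 2 * (pi - \<beta>) * exp (- (- cos \<beta> * t) * R)"
    if R: "0 < R" for R
  proof -
    have cont: "continuous_on T (?g R)" for T
      using R by (intro continuous_intros) auto
    have int: "?g R integrable_on {a..b}" for a b
      by (rule integrable_continuous_interval[OF cont])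
    have "2 * complex_of_real pi * \<i> = integral {- pi..pi} (?g R)"
      using arc_integral_exp_circle[OF R] by (simp add: arc_integral_def)
    also have "\<dots> = integral {- pi..-\<beta>} (?g R) + integral {-\<beta>..\<beta>} (?g R) + integral {\<beta>..pi} (?g R)"
    proof -
      have "integral {- pi..-\<beta>} (?g R) + integral {-\<beta>..pi} (?g R) = integral {- pi..pi} (?g R)"
        by (rule Henstock_Kurzweil_Integration.integral_combine[OF _ _ int]) (use \<beta> pos in auto)
      moreover have "integral {-\<beta>..\<beta>} (?g R) + integral {\<beta>..pi} (?g R) = integral {-\<beta>..pi} (?g R)"
        by (rule Henstock_Kurzweil_Integration.integral_combine[OF _ _ int]) (use \<beta> pos in auto)
      moreover have "t = a + b + c" if "a + d = t" "b + c = d" for a b c d t :: complex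
        using that by (simp add: add.assoc)
      ultimately show ?thesis by blast
    qed
    finally have eq: "arc_integral \<beta> ?G R - 2 * complex_of_real pi * \<i> =
        - integral {- pi..-\<beta>} (?g R) - integral {\<beta>..pi} (?g R)"
      by (simp add: arc_integral_def)
    have g: "norm (?g R \<xi>) \<le> exp (- (- cos \<beta> * t) * R)" if "\<beta> \<le> \<bar>\<xi>\<bar>" "\<bar>\<xi>\<bar> \<le> pi" for \<xi>
    proof -
      have "cos \<bar>\<xi>\<bar> \<le> cos \<beta>" using that pos by (intro cos_monotone_0_pi_le) auto
      then have "R * cos \<xi> * t \<le> R * cos \<beta> * t" using R t by simp
      moreover have "norm (?g R \<xi>) = exp (R * cos \<xi> * t)"
        using R by (simp add: norm_mult norm_divide)
      ultimately show ?thesis by (simp add: mult_ac)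
    qed
    have "norm (integral {- pi..-\<beta>} (?g R)) \<le> exp (- (- cos \<beta> * t) * R) * (- \<beta> - (- pi))"
      by (rule integral_bound[OF _ cont g]) (use \<beta> pos in auto)
    moreover have "norm (integral {\<beta>..pi} (?g R)) \<le> exp (- (- cos \<beta> * t) * R) * (pi - \<beta>)"
      by (rule integral_bound[OF _ cont g]) (use \<beta> pos in auto)
    moreover have "norm (arc_integral \<beta> ?G R - 2 * complex_of_real pi * \<i>)
       \<le> norm (integral {- pi..-\<beta>} (?g R)) + norm (integral {\<beta>..pi} (?g R))"
      unfolding eq by (rule order_trans[OF norm_triangle_ineq4]) simp
    ultimately show ?thesis by (simp add: algebra_simps)
  qed
  have "filterlim (\<lambda>R. - (- cos \<beta> * t) * R) at_bot at_top"
    by (rule filterlim_tendsto_neg_mult_at_bot[OF tendsto_const _ filterlim_ident])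
      (use cos t in \<open>simp add: mult_neg_pos\<close>)
  then have "((\<lambda>R. exp (- (- cos \<beta> * t) * R)) \<longlongrightarrow> 0) at_top"
    by (rule filterlim_compose[OF exp_at_bot])
  then have "((\<lambda>R. 2 * (pi - \<beta>) * exp (- (- cos \<beta> * t) * R)) \<longlongrightarrow> 2 * (pi - \<beta>) * 0) at_top"
    by (intro tendsto_intros)
  then have "((\<lambda>R. 2 * (pi - \<beta>) * exp (- (- cos \<beta> * t) * R)) \<longlongrightarrow> 0) at_top"
    by (simp only: mult_zero_right)
  moreover have "eventually (\<lambda>R. norm (arc_integral \<beta> ?G R - 2 * complex_of_real pi * \<i>)
      \<le> 2 * (pi - \<beta>) * exp (- (- cos \<beta> * t) * R)) at_top"
    using eventually_gt_at_top[of 0] by (rule eventually_mono) (rule le)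
  ultimately have "((\<lambda>R. arc_integral \<beta> ?G R - 2 * complex_of_real pi * \<i>) \<longlongrightarrow> 0) at_top"
    by (rule Lim_null_comparison[rotated])
  then have "(arc_integral \<beta> ?G \<longlongrightarrow> 2 * complex_of_real pi * \<i>) at_top"
    by (simp add: LIM_zero_iff)
  with lim show "hankel_integral \<rho> \<beta> ?G = 2 * complex_of_real pi * \<i>"
    using tendsto_unique trivial_limit_at_top_linorder by blast
qed

section \<open>Sectors and resolvents\<close>

lemma powr_polar:
  assumes "0 < s" "\<bar>\<xi>\<bar> < pi"
  shows "(polar s \<xi>) powr complex_of_real a = complex_of_real (s powr a) * cis (a * \<xi>)"
proof -
  have "polar s \<xi> \<noteq> 0" using assms by simp
  moreover have "Ln (polar s \<xi>) = complex_of_real (ln s) + \<i> * complex_of_real \<xi>"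
  proof (rule Ln_unique)
    show "exp (complex_of_real (ln s) + \<i> * complex_of_real \<xi>) = complex_of_real s * cis \<xi>"
      using assms by (simp add: exp_add cis_conv_exp exp_of_real)
  qed (use assms in auto)
  ultimately show ?thesis
    using assms by (simp add: powr_def cis_conv_exp exp_of_real exp_add ring_distribs mult_ac
        flip: of_real_mult)
qed

text \<open>A sector with vertex \<open>\<omega> < 0\<close>, opening to the left, lies inside the sector of the same angle
  with vertex \<open>0\<close>: in both cases membership bounds \<open>\<bar>Im\<bar> cos \<theta>\<close> by \<open>- Re sin \<theta>\<close>, with \<open>Re\<close> measured from the
  vertex, and moving the vertex to the right only enlarges the right-hand side.\<close>

lemma not_in_sector:
  assumes "0 < s" "\<omega> < 0" "0 < \<theta>" "\<theta> < pi / 2" "\<bar>\<phi>\<bar> < pi - \<theta>"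
  shows "polar s \<phi> \<notin> sector \<omega> \<theta>"
proof
  assume "polar s \<phi> \<in> sector \<omega> \<theta>"
  then obtain \<mu> where \<mu>: "complex_of_real s * cis \<phi> = complex_of_real \<omega> + \<mu>" "\<bar>Arg (- \<mu>)\<bar> < \<theta>"
    by (auto simp: sector_def)
  define \<psi> m where "\<psi> = Arg (- \<mu>)" and "m = cmod \<mu>"
  have pol: "- \<mu> = complex_of_real m * cis \<psi>"
    using rcis_cmod_Arg[of "- \<mu>"] by (simp add: \<psi>_def m_def rcis_def)
  have re: "- s * cos \<phi> = - \<omega> + m * cos \<psi>" and im: "- s * sin \<phi> = m * sin \<psi>"
    using arg_cong[OF \<mu>(1), of Re] arg_cong[OF \<mu>(1), of Im] arg_cong[OF pol, of Re] arg_cong[OF pol, of Im]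
    by auto
  have abs: "\<bar>sin x\<bar> = sin \<bar>x\<bar>" if "\<bar>x\<bar> < pi" for x :: real
    using that sin_ge_zero[of x] sin_ge_zero[of "-x"] by (cases "x \<ge> 0") auto
  have "0 \<le> sin (\<theta> - \<bar>\<psi>\<bar>)" using \<mu>(2) assms by (intro sin_ge_zero) (auto simp: \<psi>_def)
  moreover have "\<bar>\<psi>\<bar> < pi" using \<mu>(2) assms by (auto simp: \<psi>_def)
  ultimately have 1: "\<bar>sin \<psi>\<bar> * cos \<theta> \<le> cos \<psi> * sin \<theta>" by (simp add: sin_diff abs mult.commute)
  have "0 < sin (\<theta> + \<bar>\<phi>\<bar>)" using assms by (intro sin_gt_zero) auto
  moreover have "\<bar>\<phi>\<bar> < pi" using assms by auto
  ultimately have 2: "- cos \<phi> * sin \<theta> < \<bar>sin \<phi>\<bar> * cos \<theta>" by (simp add: sin_add abs mult.commute)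
  have "\<bar>- s * sin \<phi>\<bar> * cos \<theta> = m * (\<bar>sin \<psi>\<bar> * cos \<theta>)" unfolding im by (simp add: abs_mult m_def)
  also have "\<dots> \<le> m * (cos \<psi> * sin \<theta>)" using 1 by (intro mult_left_mono) (auto simp: m_def)
  also have "\<dots> < (- \<omega> + m * cos \<psi>) * sin \<theta>"
    using assms sin_gt_zero[of \<theta>] by (simp add: algebra_simps mult_neg_pos)
  also have "\<dots> = s * (- cos \<phi> * sin \<theta>)" unfolding re[symmetric] by simp
  also have "\<dots> < s * (\<bar>sin \<phi>\<bar> * cos \<theta>)" by (rule mult_strict_left_mono[OF 2 assms(1)])
  finally show False using assms by (simp add: abs_mult)
qed

text \<open>In the right half-plane the negative vertex \<open>\<omega>\<close> is farther away than \<open>0\<close>; in the left half-plane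
  the imaginary part alone is large enough, since the argument is at most \<open>b\<close> in modulus.\<close>

lemma dist_vertex_ge:
  assumes "0 < s" "\<omega> < 0" "pi / 2 \<le> b" "b \<le> pi" "\<bar>\<phi>\<bar> \<le> b"
  shows "s * sin b \<le> cmod (complex_of_real s * cis \<phi> - complex_of_real \<omega>)"
proof (cases "0 \<le> cos \<phi>")
  case True
  have "s * sin b \<le> s" using assms by simp
  also have "s = cmod (polar s \<phi>)" using assms by (simp add: norm_mult)
  also have "\<dots> \<le> cmod (complex_of_real s * cis \<phi> - complex_of_real \<omega>)"
  proof (rule power2_le_imp_le)
    have "(s * cos \<phi>)\<^sup>2 \<le> (s * cos \<phi> - \<omega>)\<^sup>2"
      using True assms by (intro power_mono) auto
    then show "(cmod (polar s \<phi>))\<^sup>2 \<le> (cmod (complex_of_real s * cis \<phi> - complex_of_real \<omega>))\<^sup>2"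
      by (simp add: cmod_power2)
  qed simp
  finally show ?thesis .
next
  case False
  then have "pi / 2 \<le> \<bar>\<phi>\<bar>" using cos_ge_zero[of \<phi>] by (auto simp: abs_if split: if_splits)
  then have "sin b \<le> sin \<bar>\<phi>\<bar>"
    using assms sin_monotone_2pi_le[of "pi - b" "pi - \<bar>\<phi>\<bar>"] by simp
  then have "s * sin b \<le> s * \<bar>sin \<phi>\<bar>"
    using assms by (intro mult_left_mono) (auto simp: abs_if split: if_splits)
  also have "\<dots> = \<bar>Im (complex_of_real s * cis \<phi> - complex_of_real \<omega>)\<bar>" using assms by (simp add: abs_mult)
  also have "\<dots> \<le> cmod (complex_of_real s * cis \<phi> - complex_of_real \<omega>)" by (rule abs_Im_le_cmod)
  finally show ?thesis .
qed

text \<open>The duality map \<open>J\<close> supplies functionals that detect whether a vector is \<open>0\<close>; they reduce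
  Cauchy's theorem for vector-valued functions to the scalar one.\<close>

locale sectorial_family =
  fixes \<alpha> \<omega> \<theta> M0 \<rho> \<beta> :: real
    and D :: "'x::{complex_banach, second_countable_topology} set" and A :: "'x \<Rightarrow> 'x"
    and J :: "'x \<Rightarrow> 'x \<Rightarrow> complex"
  assumes alpha: "1 < \<alpha>" "\<alpha> < 2"
    and A: "closed_densely_defined D A" "sectorial D A \<omega> \<theta> M0"
    and sector: "\<omega> < 0" "0 < \<theta>" "\<theta> < pi * (1 - \<alpha> / 2)"
    and path: "0 < \<rho>" "pi / 2 < \<beta>" "\<beta> < (pi - \<theta>) / \<alpha>"
    and J: "\<forall>x. duality_set x = {J x}"
begin

abbreviation "R \<equiv> resolvent D A"

lemma angles: "\<theta> < pi / 2" "\<alpha> * \<beta> < pi - \<theta>" "pi / 2 \<le> \<alpha> * \<beta>" "\<beta> < pi" "0 < \<beta>" "cos \<beta> < 0"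
proof -
  have "pi * (1 - \<alpha> / 2) < pi * (1 / 2)" using alpha by (intro mult_strict_left_mono) auto
  with sector(3) have "\<theta> < pi * (1 / 2)" by (rule less_trans)
  then show "\<theta> < pi / 2" by simp
  show ab: "\<alpha> * \<beta> < pi - \<theta>" using path alpha by (simp add: field_simps)
  show "0 < \<beta>" using path pi_gt_zero by linarith
  then have "1 * \<beta> \<le> \<alpha> * \<beta>" using alpha by (intro mult_right_mono) auto
  then show "pi / 2 \<le> \<alpha> * \<beta>" "\<beta> < pi" using path ab sector by auto
  then show "cos \<beta> < 0" using path cos_monotone_0_pi[of "pi/2" \<beta>] by simp
qed

lemma
  assumes "\<zeta> \<notin> sector \<omega> \<theta>"
  shows resolvent_in_domain: "R \<zeta> x \<in> D"
    and resolvent_right_inverse: "\<zeta> *\<^sub>C R \<zeta> x - A (R \<zeta> x) = x"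
    and resolvent_left_inverse: "x \<in> D \<Longrightarrow> R \<zeta> (\<zeta> *\<^sub>C x - A x) = x"
    and bounded_clinear_resolvent: "bounded_clinear (R \<zeta>)"
    and norm_resolvent_le: "norm (R \<zeta> x) \<le> M0 / cmod (\<zeta> - complex_of_real \<omega>) * norm x"
proof -
  have bij: "bij_betw (\<lambda>x. \<zeta> *\<^sub>C x - A x) D UNIV" and lin: "bounded_clinear (R \<zeta>)"
    and on: "onorm (R \<zeta>) \<le> M0 / cmod (\<zeta> - complex_of_real \<omega>)"
    using A(2) assms by (auto simp: sectorial_def resolvent_set_def)
  show "bounded_clinear (R \<zeta>)" by fact
  have im: "(\<lambda>x. \<zeta> *\<^sub>C x - A x) ` D = UNIV" using bij by (rule bij_betw_imp_surj_on)
  show "R \<zeta> x \<in> D" unfolding resolvent_def by (rule inv_into_into) (simp add: im)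
  show "\<zeta> *\<^sub>C R \<zeta> x - A (R \<zeta> x) = x"
    unfolding resolvent_def by (rule f_inv_into_f[where f = "\<lambda>x. \<zeta> *\<^sub>C x - A x"]) (simp add: im)
  show "x \<in> D \<Longrightarrow> R \<zeta> (\<zeta> *\<^sub>C x - A x) = x"
    unfolding resolvent_def using bij_betw_imp_inj_on[OF bij] by (rule inv_into_f_f[where f = "\<lambda>x. \<zeta> *\<^sub>C x - A x"])
  have "norm (R \<zeta> x) \<le> onorm (R \<zeta>) * norm x"
    using lin by (intro onorm) (simp add: bounded_clinear_def)
  also have "\<dots> \<le> M0 / cmod (\<zeta> - complex_of_real \<omega>) * norm x" using on by (rule mult_right_mono) simp
  finally show "norm (R \<zeta> x) \<le> M0 / cmod (\<zeta> - complex_of_real \<omega>) * norm x" .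
qed

lemma
  assumes "\<zeta> \<notin> sector \<omega> \<theta>"
  shows resolvent_add: "R \<zeta> (x + y) = R \<zeta> x + R \<zeta> y"
    and resolvent_scaleC: "R \<zeta> (c *\<^sub>C x) = c *\<^sub>C R \<zeta> x"
  using bounded_clinear_resolvent[OF assms]
  by (auto simp: bounded_clinear_def bounded_linear.linear linear_add linear_scale)

lemma resolvent_identity:
  assumes "\<zeta> \<notin> sector \<omega> \<theta>" "\<eta> \<notin> sector \<omega> \<theta>"
  shows "R \<zeta> x - R \<eta> x = (\<eta> - \<zeta>) *\<^sub>C R \<zeta> (R \<eta> x)"
proof -
  have "R \<zeta> x = R \<zeta> ((\<zeta> *\<^sub>C R \<eta> x - A (R \<eta> x)) + (\<eta> - \<zeta>) *\<^sub>C R \<eta> x)"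
    using resolvent_right_inverse[OF assms(2), of x] by (simp add: scaleC.diff_left)
  also have "\<dots> = R \<eta> x + (\<eta> - \<zeta>) *\<^sub>C R \<zeta> (R \<eta> x)"
    using assms by (simp add: resolvent_add resolvent_scaleC resolvent_left_inverse resolvent_in_domain)
  finally show ?thesis by simp
qed

text \<open>For \<open>x\<close> in the domain this trades \<open>\<zeta> R \<zeta> x\<close>, which does not decay at infinity, for \<open>x\<close> plus a decaying
  remainder.\<close>

lemma resolvent_generator:
  assumes "\<zeta> \<notin> sector \<omega> \<theta>" "x \<in> D"
  shows "\<zeta> *\<^sub>C R \<zeta> x = x + R \<zeta> (A x)"
proof -
  have "R \<zeta> (\<zeta> *\<^sub>C x) = R \<zeta> (\<zeta> *\<^sub>C x - A x) + R \<zeta> (A x)"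
    using assms by (simp flip: resolvent_add)
  then show ?thesis using assms by (simp add: resolvent_left_inverse resolvent_scaleC)
qed

lemma continuous_on_resolvent: "continuous_on (- sector \<omega> \<theta>) (\<lambda>\<zeta>. R \<zeta> x)"
  unfolding continuous_on_def
proof
  fix \<eta> assume \<eta>: "\<eta> \<in> - sector \<omega> \<theta>"
  have "\<eta> \<noteq> complex_of_real \<omega>" using \<eta> sector Arg_zero by (auto simp: sector_def)
  then have "((\<lambda>\<zeta>. cmod (\<eta> - \<zeta>) * (M0 / cmod (\<zeta> - complex_of_real \<omega>) * norm (R \<eta> x))) \<longlongrightarrow>
      cmod (\<eta> - \<eta>) * (M0 / cmod (\<eta> - complex_of_real \<omega>) * norm (R \<eta> x))) (at \<eta> within - sector \<omega> \<theta>)"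
    by (intro tendsto_intros) auto
  then have lim: "((\<lambda>\<zeta>. cmod (\<eta> - \<zeta>) * (M0 / cmod (\<zeta> - complex_of_real \<omega>) * norm (R \<eta> x))) \<longlongrightarrow> 0)
      (at \<eta> within - sector \<omega> \<theta>)" by simp
  have ev: "eventually (\<lambda>\<zeta>. norm (R \<zeta> x - R \<eta> x)
      \<le> cmod (\<eta> - \<zeta>) * (M0 / cmod (\<zeta> - complex_of_real \<omega>) * norm (R \<eta> x))) (at \<eta> within - sector \<omega> \<theta>)"
    unfolding eventually_at_filter
  proof (intro always_eventually allI impI)
    fix \<zeta> assume "\<zeta> \<in> - sector \<omega> \<theta>"
    then show "norm (R \<zeta> x - R \<eta> x) \<le> cmod (\<eta> - \<zeta>) * (M0 / cmod (\<zeta> - complex_of_real \<omega>) * norm (R \<eta> x))"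
      using \<eta> resolvent_identity[of \<zeta> \<eta> x] norm_resolvent_le[of \<zeta> "R \<eta> x"]
      by (simp only: norm_scaleC ComplD mult_left_mono norm_ge_zero not_False_eq_True)
  qed
  show "((\<lambda>\<zeta>. R \<zeta> x) \<longlongrightarrow> R \<eta> x) (at \<eta> within - sector \<omega> \<theta>)"
    by (rule LIM_zero_cancel, rule Lim_null_comparison[OF ev lim])
qed

text \<open>By the resolvent identity the derivative of the resolvent is minus its square.\<close>

lemma holomorphic_resolvent:
  assumes \<xi>: "bounded_clinear \<xi>"
  shows "(\<lambda>\<zeta>. \<xi> (R \<zeta> x)) holomorphic_on - sector \<omega> \<theta>"
proof (rule holomorphic_onI)
  fix \<eta> assume \<eta>: "\<eta> \<in> - sector \<omega> \<theta>"
  interpret bounded_linear \<xi> using \<xi> by (simp add: bounded_clinear_def)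
  have sc: "\<xi> (c *\<^sub>C y) = c * \<xi> y" for c y
    using \<xi> by (simp add: bounded_clinear_def scaleC_complex_def)
  have "((\<lambda>\<zeta>. - \<xi> (R \<zeta> (R \<eta> x))) \<longlongrightarrow> - \<xi> (R \<eta> (R \<eta> x))) (at \<eta> within - sector \<omega> \<theta>)"
    using continuous_on_resolvent[of "R \<eta> x"] \<eta>
    by (intro tendsto_minus tendsto) (auto simp: continuous_on_def)
  then have "((\<lambda>\<zeta>. (\<xi> (R \<zeta> x) - \<xi> (R \<eta> x)) / (\<zeta> - \<eta>)) \<longlongrightarrow> - \<xi> (R \<eta> (R \<eta> x))) (at \<eta> within - sector \<omega> \<theta>)"
  proof (rule Lim_transform_eventually)
    show "\<forall>\<^sub>F \<zeta> in at \<eta> within - sector \<omega> \<theta>. - \<xi> (R \<zeta> (R \<eta> x)) = (\<xi> (R \<zeta> x) - \<xi> (R \<eta> x)) / (\<zeta> - \<eta>)"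
      unfolding eventually_at_filter
    proof (intro always_eventually allI impI)
      fix \<zeta> assume "\<zeta> \<in> - sector \<omega> \<theta>" "\<zeta> \<noteq> \<eta>"
      then show "- \<xi> (R \<zeta> (R \<eta> x)) = (\<xi> (R \<zeta> x) - \<xi> (R \<eta> x)) / (\<zeta> - \<eta>)"
        using \<eta> resolvent_identity[of \<zeta> \<eta> x] by (simp add: sc field_simps flip: diff)
    qed
  qed
  then show "(\<lambda>\<zeta>. \<xi> (R \<zeta> x)) field_differentiable at \<eta> within - sector \<omega> \<theta>"
    unfolding field_differentiable_def has_field_derivative_iff by blast
qed

text \<open>An open neighbourhood of the path on which \<open>\<zeta> \<mapsto> (\<zeta>\<^sup>\<alpha> - A)\<^sup>-\<^sup>1\<close> is defined.\<close>

definition "W = {\<zeta> \<in> - \<real>\<^sub>\<le>\<^sub>0. \<bar>Arg \<zeta>\<bar> < (pi - \<theta>) / \<alpha>}"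

lemma open_W: "open W"
proof -
  have "open ({\<zeta> \<in> - \<real>\<^sub>\<le>\<^sub>0. Arg \<zeta> \<in> {- ((pi - \<theta>) / \<alpha>)<..<(pi - \<theta>) / \<alpha>}})"
    using continuous_open_preimage[OF continuous_on_Arg _ open_greaterThanLessThan,
        of "- ((pi - \<theta>) / \<alpha>)" "(pi - \<theta>) / \<alpha>"]
    by (simp add: vimage_def Int_def open_Compl)
  moreover have "W = {\<zeta> \<in> - \<real>\<^sub>\<le>\<^sub>0. Arg \<zeta> \<in> {- ((pi - \<theta>) / \<alpha>)<..<(pi - \<theta>) / \<alpha>}}"
    by (auto simp: W_def abs_less_iff)
  ultimately show ?thesis by simp
qed

lemma polar_in_W:
  assumes "0 < s" "\<bar>\<xi>\<bar> \<le> \<beta>"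
  shows "polar s \<xi> \<in> W"
proof -
  have "Arg (polar s \<xi>) = \<xi>"
    using Arg_rcis[of \<xi> s] assms angles by (simp add: rcis_def abs_le_iff)
  moreover have "polar s \<xi> \<notin> \<real>\<^sub>\<le>\<^sub>0"
  proof
    assume "polar s \<xi> \<in> \<real>\<^sub>\<le>\<^sub>0"
    then have "s * cos \<xi> \<le> 0" "s * sin \<xi> = 0" by (auto simp: complex_nonpos_Reals_iff)
    moreover from this(2) have "\<xi> = 0" using assms angles sin_eq_0_pi[of \<xi>] by auto
    ultimately show False using assms by simp
  qed
  ultimately show ?thesis using assms path by (simp add: W_def)
qed

lemma hankel_path_subset_W: "hankel_path \<rho> \<beta> \<subseteq> W"
proof
  fix \<zeta> assume "\<zeta> \<in> hankel_path \<rho> \<beta>"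
  then show "\<zeta> \<in> W"
    unfolding hankel_path_def
    using path angles by (elim UnE imageE) (auto intro!: polar_in_W simp del: cis_inverse)
qed

lemma powr_not_in_sector:
  assumes "\<zeta> \<in> W"
  shows "\<zeta> powr complex_of_real \<alpha> \<notin> sector \<omega> \<theta>"
proof -
  have \<zeta>: "\<zeta> \<noteq> 0" "\<bar>Arg \<zeta>\<bar> < (pi - \<theta>) / \<alpha>" "\<zeta> = complex_of_real (cmod \<zeta>) * cis (Arg \<zeta>)"
    using assms rcis_cmod_Arg[of \<zeta>] by (auto simp: W_def rcis_def)
  have "\<bar>\<alpha> * Arg \<zeta>\<bar> < pi - \<theta>" using \<zeta>(2) alpha by (simp add: abs_mult field_simps)
  moreover have "1 * \<bar>Arg \<zeta>\<bar> \<le> \<alpha> * \<bar>Arg \<zeta>\<bar>" using alpha by (intro mult_right_mono) auto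
  ultimately have "\<bar>Arg \<zeta>\<bar> < pi" using sector alpha by (simp add: abs_mult)
  have "\<zeta> powr complex_of_real \<alpha> = complex_of_real (cmod \<zeta> powr \<alpha>) * cis (\<alpha> * Arg \<zeta>)"
    by (subst (1) \<zeta>(3)) (rule powr_polar, use \<zeta>(1) \<open>\<bar>Arg \<zeta>\<bar> < pi\<close> in auto)
  then show ?thesis
    using not_in_sector[of "cmod \<zeta> powr \<alpha>" \<omega> \<theta> "\<alpha> * Arg \<zeta>"] \<open>\<bar>\<alpha> * Arg \<zeta>\<bar> < pi - \<theta>\<close> sector angles \<zeta>(1)
    by simp
qed

section \<open>The operators S\<close>

definition "K \<zeta> = R (\<zeta> powr complex_of_real \<alpha>)"

lemma nonpos_disjoint_W: "\<zeta> \<in> W \<Longrightarrow> \<zeta> \<notin> \<real>\<^sub>\<le>\<^sub>0" "\<zeta> \<in> W \<Longrightarrow> \<zeta> \<noteq> 0"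
  by (auto simp: W_def)

lemma continuous_on_K: "continuous_on W (\<lambda>\<zeta>. K \<zeta> x)"
  unfolding K_def
proof (rule continuous_on_compose2[OF continuous_on_resolvent])
  have "(\<lambda>\<zeta>. \<zeta> powr complex_of_real \<alpha>) holomorphic_on W"
    by (intro holomorphic_intros) (auto dest: nonpos_disjoint_W)
  then show "continuous_on W (\<lambda>\<zeta>. \<zeta> powr complex_of_real \<alpha>)" by (rule holomorphic_on_imp_continuous_on)
qed (auto dest: powr_not_in_sector)

lemma holomorphic_K:
  assumes "bounded_clinear \<xi>"
  shows "(\<lambda>\<zeta>. \<xi> (K \<zeta> x)) holomorphic_on W"
proof -
  have "(\<lambda>\<zeta>. \<zeta> powr complex_of_real \<alpha>) holomorphic_on W"
    by (intro holomorphic_intros) (auto dest: nonpos_disjoint_W)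
  moreover have "(\<lambda>\<zeta>. \<zeta> powr complex_of_real \<alpha>) ` W \<subseteq> - sector \<omega> \<theta>" by (auto dest: powr_not_in_sector)
  ultimately have "((\<lambda>\<zeta>. \<xi> (R \<zeta> x)) \<circ> (\<lambda>\<zeta>. \<zeta> powr complex_of_real \<alpha>)) holomorphic_on W"
    by (rule holomorphic_on_compose_gen[OF _ holomorphic_resolvent[OF assms]])
  then show ?thesis by (simp add: o_def K_def)
qed

definition "k0 = M0 / sin (\<alpha> * \<beta>)"

lemma sin_pos: "0 < sin (\<alpha> * \<beta>)"
  using angles sector by (intro sin_gt_zero) auto

lemma k0_pos: "0 < k0"
  using sin_pos A(2) by (simp add: k0_def sectorial_def)

lemma norm_K_le:
  assumes "0 < s" "\<bar>\<xi>\<bar> \<le> \<beta>"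
  shows "norm (K (polar s \<xi>) x) \<le> k0 * s powr - \<alpha> * norm x"
proof -
  let ?\<zeta> = "complex_of_real s * cis \<xi>"
  have eq: "?\<zeta> powr complex_of_real \<alpha> = complex_of_real (s powr \<alpha>) * cis (\<alpha> * \<xi>)"
    using assms angles by (intro powr_polar) auto
  have M0: "0 < M0" using A(2) by (simp add: sectorial_def)
  have "\<bar>\<alpha> * \<xi>\<bar> \<le> \<alpha> * \<beta>" using assms alpha by (simp add: abs_mult)
  then have d: "s powr \<alpha> * sin (\<alpha> * \<beta>) \<le> cmod (?\<zeta> powr complex_of_real \<alpha> - complex_of_real \<omega>)"
    unfolding eq using assms sector angles by (intro dist_vertex_ge) auto
  have "norm (K ?\<zeta> x) \<le> M0 / cmod (?\<zeta> powr complex_of_real \<alpha> - complex_of_real \<omega>) * norm x"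
    unfolding K_def by (intro norm_resolvent_le powr_not_in_sector polar_in_W assms)
  also have "\<dots> \<le> M0 / (s powr \<alpha> * sin (\<alpha> * \<beta>)) * norm x"
  proof (intro mult_right_mono divide_left_mono d mult_pos_pos)
    have "0 < s powr \<alpha> * sin (\<alpha> * \<beta>)" using assms sin_pos by simp
    with d show "0 < cmod (?\<zeta> powr complex_of_real \<alpha> - complex_of_real \<omega>)" by linarith
  qed (use M0 sin_pos assms in auto)
  also have "\<dots> = k0 * s powr - \<alpha> * norm x"
    by (simp add: k0_def powr_minus divide_simps)
  finally show ?thesis .
qed

abbreviation kernel :: "(complex \<Rightarrow> complex) \<Rightarrow> 'x \<Rightarrow> complex \<Rightarrow> 'x"
  where "kernel e x \<equiv> \<lambda>\<zeta>. (e \<zeta> * \<zeta> powr complex_of_real (\<alpha> - 1)) *\<^sub>C K \<zeta> x"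

text \<open>\<open>E e x\<close> is the integral that defines \<open>S t x\<close>, with a function \<open>e\<close> in place of \<open>exp (\<zeta> t)\<close>.
  Limits, derivatives and Taylor expansions in \<open>t\<close> become statements about the scalar function \<open>e\<close>.\<close>

definition E :: "(complex \<Rightarrow> complex) \<Rightarrow> 'x \<Rightarrow> 'x"
  where "E e x = (1 / (2 * complex_of_real pi * \<i>)) *\<^sub>C
    hankel_integral \<rho> \<beta> (kernel e x)"

abbreviation "P \<equiv> hankel_path \<rho> \<beta>"

lemma S_op_eq_E: "t \<noteq> 0 \<Longrightarrow> S_op \<alpha> D A \<rho> \<beta> t x = E (\<lambda>\<zeta>. exp (\<zeta> * complex_of_real t)) x"
  by (simp add: S_op_def E_def K_def)

lemma continuous_on_kernel:
  assumes "continuous_on P e"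
  shows "continuous_on P (\<lambda>\<zeta>. (e \<zeta> * \<zeta> powr complex_of_real a) *\<^sub>C K \<zeta> x)"
proof -
  have "(\<lambda>\<zeta>. \<zeta> powr complex_of_real a) holomorphic_on W"
    by (intro holomorphic_intros) (auto dest: nonpos_disjoint_W)
  then have "continuous_on P (\<lambda>\<zeta>. \<zeta> powr complex_of_real a)"
    using hankel_path_subset_W holomorphic_on_imp_continuous_on continuous_on_subset by blast
  moreover have "continuous_on P (\<lambda>\<zeta>. K \<zeta> x)"
    using continuous_on_K hankel_path_subset_W continuous_on_subset by blast
  ultimately show ?thesis using assms by (intro scaleC.continuous_on continuous_on_mult)
qed

lemma norm_kernel_le:
  assumes "0 < s" "\<bar>\<xi>\<bar> \<le> \<beta>" "\<zeta> = complex_of_real s * cis \<xi>"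
  shows "norm ((c * \<zeta> powr complex_of_real (\<alpha> - 1)) *\<^sub>C K \<zeta> x) \<le> cmod c * (k0 / s * norm x)"
proof -
  have "cmod (\<zeta> powr complex_of_real (\<alpha> - 1)) = s powr (\<alpha> - 1)"
    using assms angles powr_polar[of s \<xi> "\<alpha> - 1"] by (simp add: norm_mult)
  then have "norm ((c * \<zeta> powr complex_of_real (\<alpha> - 1)) *\<^sub>C K \<zeta> x) = cmod c * (s powr (\<alpha> - 1) * norm (K \<zeta> x))"
    by (simp add: norm_scaleC norm_mult)
  also have "\<dots> \<le> cmod c * (s powr (\<alpha> - 1) * (k0 * s powr - \<alpha> * norm x))"
    unfolding assms(3) using assms by (intro mult_left_mono norm_K_le) auto
  also have "s powr (\<alpha> - 1) * (k0 * s powr - \<alpha> * norm x) = k0 / s * norm x"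
    using assms by (simp add: powr_diff powr_minus field_simps)
  finally show ?thesis .
qed

lemma E_dominated:
  assumes cont: "\<And>n. continuous_on P (e n)" "continuous_on P e'"
    and a: "0 < a"
    and arc: "\<And>n \<xi>. \<bar>\<xi>\<bar> \<le> \<beta> \<Longrightarrow> cmod (e n (polar \<rho> \<xi>)) \<le> k"
    and ray: "\<And>n s \<phi>. \<rho> \<le> s \<Longrightarrow> \<phi> \<in> {\<beta>, - \<beta>} \<Longrightarrow> cmod (e n (polar s \<phi>)) \<le> c * exp (- a * s)"
    and lim: "\<And>\<zeta>. \<zeta> \<in> P \<Longrightarrow> (\<lambda>n. e n \<zeta>) \<longlonglongrightarrow> e' \<zeta>"
  shows "(\<lambda>n. E (e n) x) \<longlonglongrightarrow> E e' x"
    and "hankel_integrable \<rho> \<beta> (kernel (e n) x)"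
proof -
  let ?G = "\<lambda>e. kernel e x"
  have 1: "norm (?G (e n) (polar \<rho> \<xi>)) \<le> k * (k0 / \<rho> * norm x)" if "\<bar>\<xi>\<bar> \<le> \<beta>" for n \<xi>
    by (rule order_trans[OF norm_kernel_le mult_right_mono])
      (use that path k0_pos arc[OF that] in auto)
  have 2: "norm (?G (e n) (polar s \<phi>)) \<le> (c * (k0 / \<rho> * norm x)) * exp (- a * s)"
    if "\<rho> \<le> s" "\<phi> \<in> {\<beta>, - \<beta>}" for n s \<phi>
  proof -
    have "norm (?G (e n) (polar s \<phi>)) \<le> cmod (e n (polar s \<phi>)) * (k0 / s * norm x)"
      using that path angles by (intro norm_kernel_le) auto
    also have "\<dots> \<le> (c * exp (- a * s)) * (k0 / \<rho> * norm x)"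
      using that path k0_pos by (intro mult_mono ray divide_left_mono mult_nonneg_nonneg order_trans[OF norm_ge_zero ray[OF that]]) auto
    finally show ?thesis by (simp add: mult_ac)
  qed
  have 3: "(\<lambda>n. ?G (e n) \<zeta>) \<longlonglongrightarrow> ?G e' \<zeta>" if "\<zeta> \<in> P" for \<zeta>
    by (intro scaleC.tendsto tendsto_intros lim that)
  note dom = hankel_dominated_convergence[where G = "\<lambda>n. ?G (e n)" and H = "?G e'",
      OF continuous_on_kernel continuous_on_kernel path(1) 1 set_integrable_exp_ray[OF a] 2 3, OF cont]
  show "hankel_integrable \<rho> \<beta> (?G (e n))" using dom(2) by simp
  show "(\<lambda>n. E (e n) x) \<longlonglongrightarrow> E e' x"
    unfolding E_def by (intro scaleC.tendsto tendsto_const dom(1)) auto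
qed

definition path_integrable :: "(complex \<Rightarrow> complex) \<Rightarrow> bool"
  where "path_integrable e \<longleftrightarrow> (\<forall>x. hankel_integrable \<rho> \<beta> (kernel e x))"

lemma path_integrableD: "path_integrable e \<Longrightarrow> hankel_integrable \<rho> \<beta> (kernel e x)"
  by (simp add: path_integrable_def)

lemma E_add:
  assumes "path_integrable e1" "path_integrable e2"
  shows "E (\<lambda>\<zeta>. e1 \<zeta> + e2 \<zeta>) x = E e1 x + E e2 x"
  unfolding E_def using hankel_integral_add[OF path_integrableD[OF assms(1)] path_integrableD[OF assms(2)]]
  by (simp add: distrib_right scaleC_add_left scaleC_add_right)

lemma E_scaleC:
  assumes "path_integrable e"
  shows "E (\<lambda>\<zeta>. c * e \<zeta>) x = c *\<^sub>C E e x"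
  unfolding E_def using hankel_integral_bounded_clinear[OF bounded_clinear_scaleC path_integrableD[OF assms], of c x]
  by (simp add: scaleC_scaleC mult_ac)

lemma E_add_arg:
  assumes "path_integrable e"
  shows "E e (x + y) = E e x + E e y"
proof -
  have "hankel_integral \<rho> \<beta> (kernel e (x + y)) =
    hankel_integral \<rho> \<beta> (\<lambda>\<zeta>. kernel e x \<zeta> + kernel e y \<zeta>)"
    by (rule hankel_integral_cong)
      (use hankel_path_subset_W in \<open>auto simp: K_def resolvent_add powr_not_in_sector scaleC_add_right\<close>)
  then show ?thesis
    unfolding E_def using hankel_integral_add[OF path_integrableD[OF assms] path_integrableD[OF assms], of x y]
    by (simp add: scaleC_add_right)
qed

lemma E_scaleC_arg:
  assumes "path_integrable e"
  shows "E e (c *\<^sub>C x) = c *\<^sub>C E e x"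
proof -
  have "hankel_integral \<rho> \<beta> (kernel e (c *\<^sub>C x)) =
    hankel_integral \<rho> \<beta> (\<lambda>\<zeta>. c *\<^sub>C kernel e x \<zeta>)"
    by (rule hankel_integral_cong)
      (use hankel_path_subset_W in \<open>auto simp: K_def resolvent_scaleC powr_not_in_sector scaleC_scaleC mult_ac\<close>)
  then show ?thesis
    unfolding E_def using hankel_integral_bounded_clinear[OF bounded_clinear_scaleC path_integrableD[OF assms], of c x]
    by (simp add: scaleC_scaleC mult_ac)
qed

text \<open>The rate at which \<open>exp (\<zeta> t)\<close> decays along the rays.\<close>

definition "q = - cos \<beta>"

lemma q_pos: "0 < q" using angles by (simp add: q_def)

lemma norm_exp_arc: 
  assumes "0 \<le> t"
  shows "cmod (exp (polar \<rho> \<xi> * complex_of_real t)) \<le> exp (\<rho> * t)"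
proof -
  have "\<rho> * cos \<xi> * t \<le> \<rho> * 1 * t" by (intro mult_right_mono mult_left_mono) (use path assms in auto)
  then show ?thesis by simp
qed

lemma norm_exp_ray: 
  assumes "\<phi> \<in> {\<beta>, - \<beta>}"
  shows "cmod (exp (polar s \<phi> * complex_of_real t)) = exp (- (q * t) * s)"
  using assms by (auto simp: q_def mult_ac)

text \<open>Half of the exponential absorbs the power, because \<open>y\<^sup>m / m!\<close> is a term of the series of
  \<open>exp y\<close>.\<close>

lemma power_exp_le:
  assumes "0 < a" "0 \<le> (s::real)"
  shows "s ^ m * exp (- a * s) \<le> (fact m / (a / 2) ^ m) * exp (- (a / 2) * s)"
proof -
  let ?y = "a / 2 * s"
  have "?y ^ m /\<^sub>R fact m \<le> exp ?y"
    unfolding exp_def by (rule sum_le_suminf[where I = "{m}", simplified, OF summable_exp_generic])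
      (use assms in auto)
  then have "s ^ m \<le> (fact m / (a / 2) ^ m) * exp ?y"
    using assms by (simp add: power_mult_distrib power_divide field_simps)
  then have "s ^ m * exp (- a * s) \<le> (fact m / (a / 2) ^ m) * exp ?y * exp (- a * s)"
    by (rule mult_right_mono) simp
  also have "(fact m / (a / 2) ^ m) * exp ?y * exp (- a * s) = (fact m / (a / 2) ^ m) * exp (- (a / 2) * s)"
    by (simp add: mult.assoc flip: exp_add)
  finally show ?thesis .
qed

text \<open>The \<open>n\<close>-th derivative of \<open>exp (\<zeta> t)\<close> with respect to \<open>t\<close>.\<close>

definition "dexp n t \<zeta> = \<zeta> ^ n * exp (\<zeta> * complex_of_real t)"

lemma path_integrable_dexp:
  assumes "0 < t"
  shows "path_integrable (dexp n t)"
  unfolding path_integrable_def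
proof (intro allI E_dominated(2)[where e = "\<lambda>_. dexp n t" and e' = "dexp n t"])
  show "continuous_on P (dexp n t)" unfolding dexp_def by (intro continuous_intros)
  then show "continuous_on P (dexp n t)" .
  show "cmod (dexp n t (polar \<rho> \<xi>)) \<le> \<rho> ^ n * exp (\<rho> * t)" for \<xi>
    using norm_exp_arc[of t \<xi>] path assms by (simp add: dexp_def norm_mult norm_power mult_left_mono)
  show "0 < q * t / 2" using q_pos assms by simp
  fix s \<phi> assume *: "\<rho> \<le> s" "\<phi> \<in> {\<beta>, - \<beta>}"
  then have "0 \<le> s" using path by auto
  have "cmod (dexp n t (polar s \<phi>)) = s ^ n * exp (- (q * t) * s)"
    using * \<open>0 \<le> s\<close> unfolding dexp_def norm_mult norm_power norm_exp_ray[OF *(2)] by simp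
  also have "\<dots> \<le> fact n / (q * t / 2) ^ n * exp (- (q * t / 2) * s)"
    using q_pos assms \<open>0 \<le> s\<close> by (intro power_exp_le) auto
  finally show "cmod (dexp n t (polar s \<phi>)) \<le> fact n / (q * t / 2) ^ n * exp (- (q * t / 2) * s)" .
qed simp

lemma path_integrable_add:
  assumes "path_integrable e1" "path_integrable e2"
  shows "path_integrable (\<lambda>\<zeta>. e1 \<zeta> + e2 \<zeta>)"
  using hankel_integrable_add[OF path_integrableD[OF assms(1)] path_integrableD[OF assms(2)]]
  by (simp add: path_integrable_def distrib_right scaleC_add_left)

lemma path_integrable_cmult:
  assumes "path_integrable e"
  shows "path_integrable (\<lambda>\<zeta>. b * e \<zeta>)"
  using hankel_integrable_bounded_clinear[OF bounded_clinear_scaleC path_integrableD[OF assms], of b]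
  by (simp add: path_integrable_def scaleC_scaleC mult.assoc)

abbreviation "S \<equiv> S_op \<alpha> D A \<rho> \<beta>"

lemma S_eq_E: "t \<noteq> 0 \<Longrightarrow> S t x = E (dexp 0 t) x"
  by (simp add: S_op_eq_E dexp_def[abs_def])

lemma S_zero: "S 0 x = x"
  by (simp add: S_op_def)

lemma S_add: "0 \<le> t \<Longrightarrow> S t (x + y) = S t x + S t y"
  by (cases "t = 0") (simp_all add: S_zero S_eq_E E_add_arg path_integrable_dexp)

lemma S_scaleR: "0 \<le> t \<Longrightarrow> S t (c *\<^sub>R x) = c *\<^sub>R S t x"
  unfolding scaleC_of_real[symmetric]
  by (cases "t = 0") (simp_all add: S_zero S_eq_E E_scaleC_arg path_integrable_dexp)

lemma S_continuous_pos:
  assumes "0 < a"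
  shows "continuous_on {a..b} (\<lambda>t. S t x)"
  unfolding continuous_on_sequentially
proof (intro allI ballI impI)
  fix X :: "nat \<Rightarrow> real" and t assume t: "t \<in> {a..b}" and X: "(\<forall>n. X n \<in> {a..b}) \<and> X \<longlonglongrightarrow> t"
  have "(\<lambda>n. E (\<lambda>\<zeta>. exp (\<zeta> * complex_of_real (X n))) x) \<longlonglongrightarrow> E (\<lambda>\<zeta>. exp (\<zeta> * complex_of_real t)) x"
  proof (rule E_dominated(1))
    show "0 < q * a" using q_pos assms by simp
    show "cmod (exp (polar \<rho> \<xi> * complex_of_real (X n))) \<le> exp (\<rho> * b)" for n \<xi>
    proof -
      have "0 \<le> X n" "\<rho> * X n \<le> \<rho> * b" using X assms path by (auto intro: order_trans[of 0 a])
      then show ?thesis by (intro order_trans[OF norm_exp_arc]) auto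
    qed
    show "cmod (exp (polar s \<phi> * complex_of_real (X n))) \<le> 1 * exp (- (q * a) * s)"
      if "\<rho> \<le> s" "\<phi> \<in> {\<beta>, - \<beta>}" for n s \<phi>
    proof -
      have "q * a * s \<le> q * X n * s" using X that path q_pos by (intro mult_right_mono mult_left_mono) auto
      then show ?thesis unfolding norm_exp_ray[OF that(2)] by simp
    qed
  qed (use X in \<open>auto intro!: continuous_intros tendsto_intros\<close>)
  moreover have "0 \<notin> {a..b}" using assms by simp
  then have "t \<noteq> 0" "\<And>n. X n \<noteq> 0" using t X by metis+
  ultimately show "((\<lambda>t. S t x) \<circ> X) \<longlonglongrightarrow> S t x"
    by (simp add: S_op_eq_E o_def)
qed

text \<open>The difference quotients of the exponential are dominated by \<open>\<bar>\<zeta>\<bar> e\<^sup>\<bar>\<^sup>\<zeta>\<^sup>\<bar>\<^sup>h\<close>, which the decay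
  along the rays absorbs for small \<open>h\<close>.\<close>

lemma E_dexp_difference_quotient:
  assumes t: "0 < t" and d: "0 < d" "d \<le> q * t / 2"
  defines "h \<equiv> \<lambda>j. d / real (Suc j)"
  shows "(\<lambda>j. (1 / h j) *\<^sub>R (E (dexp n (t + h j)) x - E (dexp n t) x)) \<longlonglongrightarrow> E (dexp (Suc n) t) x"
proof -
  have h: "0 < h j" "h j \<le> d" for j
    using d by (auto simp: h_def field_simps)
  have h0: "h \<longlonglongrightarrow> 0"
    unfolding h_def using LIMSEQ_inverse_real_of_nat tendsto_mult_right_zero[of _ _ d]
    by (force simp: divide_inverse)
  define e where "e = (\<lambda>j \<zeta>. complex_of_real (1 / h j) * (dexp n (t + h j) \<zeta> + (- 1) * dexp n t \<zeta>))"
  have e: "e j \<zeta> = dexp n t \<zeta> * ((exp (\<zeta> * complex_of_real (h j)) - 1) / complex_of_real (h j))" for j \<zeta>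
    by (simp add: e_def dexp_def exp_add algebra_simps divide_simps)
  have ne: "cmod (e j \<zeta>) \<le> cmod (dexp (Suc n) t \<zeta>) * exp (cmod \<zeta> * d)" for j \<zeta>
  proof -
    let ?z = "\<zeta> * complex_of_real (h j)"
    have "cmod (exp ?z - 1) \<le> exp \<bar>Re ?z\<bar> * cmod ?z"
      using Taylor_exp[of ?z 0] by simp
    also have "\<dots> \<le> exp (cmod \<zeta> * d) * cmod ?z"
    proof (intro mult_right_mono)
      have "\<bar>Re ?z\<bar> \<le> cmod ?z" by (rule abs_Re_le_cmod)
      also have "\<dots> \<le> cmod \<zeta> * d" using h[of j] by (simp add: norm_mult mult_left_mono)
      finally show "exp \<bar>Re ?z\<bar> \<le> exp (cmod \<zeta> * d)" by simp
    qed simp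
    also have "\<dots> = exp (cmod \<zeta> * d) * cmod \<zeta> * h j" using h[of j] by (simp add: norm_mult)
    finally have "cmod (exp ?z - 1) / h j \<le> exp (cmod \<zeta> * d) * cmod \<zeta>"
      using h[of j] by (simp add: divide_le_eq)
    then have "cmod (dexp n t \<zeta>) * (cmod (exp ?z - 1) / h j) \<le> cmod (dexp n t \<zeta>) * (exp (cmod \<zeta> * d) * cmod \<zeta>)"
      by (rule mult_left_mono) simp
    then show ?thesis
      using h[of j] by (simp add: e dexp_def norm_mult norm_divide norm_power mult_ac)
  qed
  have cont: "continuous_on P (dexp n t)" for n t unfolding dexp_def by (intro continuous_intros)
  have "(\<lambda>j. E (e j) x) \<longlonglongrightarrow> E (dexp (Suc n) t) x"
  proof (rule E_dominated(1))
    show "continuous_on P (e j)" for j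
      unfolding e_def by (intro continuous_intros cont)
    show "cmod (e j (polar \<rho> \<xi>)) \<le> \<rho> ^ Suc n * exp (\<rho> * t) * exp (\<rho> * d)" for j \<xi>
    proof (rule order_trans[OF ne])
      have "cmod (dexp (Suc n) t (polar \<rho> \<xi>)) \<le> \<rho> ^ Suc n * exp (\<rho> * t)"
        using norm_exp_arc[of t \<xi>] path t by (simp add: dexp_def norm_mult norm_power mult_left_mono)
      then show "cmod (dexp (Suc n) t (polar \<rho> \<xi>)) * exp (cmod (polar \<rho> \<xi>) * d)
          \<le> \<rho> ^ Suc n * exp (\<rho> * t) * exp (\<rho> * d)"
        using path by (simp add: norm_mult)
    qed
    show "0 < q * t / 2 / 2" using q_pos t by simp
    show "cmod (e j (polar s \<phi>))
        \<le> (fact (Suc n) / (q * t / 2 / 2) ^ Suc n) * exp (- (q * t / 2 / 2) * s)"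
      if *: "\<rho> \<le> s" "\<phi> \<in> {\<beta>, - \<beta>}" for j s \<phi>
    proof (rule order_trans[OF ne])
      have s: "0 \<le> s" using path * by simp
      have "cmod (dexp (Suc n) t (polar s \<phi>)) * exp (cmod (polar s \<phi>) * d)
          = s ^ Suc n * (exp (- (q * t) * s) * exp (s * d))"
        unfolding dexp_def norm_mult norm_power norm_exp_ray[OF *(2)] using s by simp
      also have "\<dots> \<le> s ^ Suc n * exp (- (q * t / 2) * s)"
      proof (rule mult_left_mono)
        have "s * d \<le> s * (q * t / 2)" using d s by (intro mult_left_mono) auto
        then show "exp (- (q * t) * s) * exp (s * d) \<le> exp (- (q * t / 2) * s)"
          by (simp add: field_simps flip: exp_add)
      qed (use s in simp)
      also have "\<dots> \<le> (fact (Suc n) / (q * t / 2 / 2) ^ Suc n) * exp (- (q * t / 2 / 2) * s)"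
        using q_pos t s by (intro power_exp_le) auto
      finally show "cmod (dexp (Suc n) t (polar s \<phi>)) * exp (cmod (polar s \<phi>) * d)
        \<le> (fact (Suc n) / (q * t / 2 / 2) ^ Suc n) * exp (- (q * t / 2 / 2) * s)" .
    qed
    show "(\<lambda>j. e j \<zeta>) \<longlonglongrightarrow> dexp (Suc n) t \<zeta>" for \<zeta>
    proof -
      have "((\<lambda>z. exp (\<zeta> * z)) has_field_derivative \<zeta>) (at 0)"
        by (auto intro!: derivative_eq_intros)
      then have "(\<lambda>z. (exp (\<zeta> * z) - 1) / z) \<midarrow>0\<rightarrow> \<zeta>" by (simp add: DERIV_def)
      moreover have "filterlim (\<lambda>j. complex_of_real (h j)) (at 0) sequentially"
        unfolding filterlim_at using tendsto_of_real[OF h0, where 'a=complex] h(1)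
        by (auto intro!: always_eventually simp: less_imp_neq[symmetric])
      ultimately have "(\<lambda>j. (exp (\<zeta> * complex_of_real (h j)) - 1) / complex_of_real (h j)) \<longlonglongrightarrow> \<zeta>"
        by (rule filterlim_compose)
      then have "(\<lambda>j. e j \<zeta>) \<longlonglongrightarrow> dexp n t \<zeta> * \<zeta>" unfolding e by (intro tendsto_intros)
      then show ?thesis by (simp add: dexp_def mult_ac)
    qed
  qed (rule cont)
  moreover have "E (e j) x = (1 / h j) *\<^sub>R (E (dexp n (t + h j)) x - E (dexp n t) x)" for j
  proof -
    have dec: "path_integrable (dexp n (t + h j))" "path_integrable (dexp n t)"
      using t h[of j] by (auto intro: path_integrable_dexp)
    note dec = dec path_integrable_cmult[OF dec(2), of "- 1"]
    show ?thesis
      unfolding e_def E_scaleC[OF path_integrable_add[OF dec(1,3)]] E_add[OF dec(1,3)] E_scaleC[OF dec(2)] scaleC_of_real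
      by (simp add: scaleC.minus_left)
  qed
  ultimately show ?thesis by simp
qed

text \<open>The partial sums of the exponential series in \<open>\<zeta> h\<close> are at most \<open>exp (\<bar>\<zeta>\<bar> h)\<close> in modulus, and along
  the rays the decay \<open>exp (- q t \<bar>\<zeta>\<bar>)\<close> beats this as long as \<open>h < q t\<close>.\<close>

lemma E_dexp_Taylor:
  assumes t: "0 < t" and h: "0 \<le> h" "h < q * t"
  shows "(\<lambda>N. E (\<lambda>\<zeta>. \<Sum>k<N. complex_of_real (h ^ k / fact k) * dexp k t \<zeta>) x) \<longlonglongrightarrow> E (dexp 0 (t + h)) x"
proof (rule E_dominated(1))
  have e: "(\<Sum>k<N. complex_of_real (h ^ k / fact k) * dexp k t \<zeta>)
      = exp (\<zeta> * complex_of_real t) * (\<Sum>k<N. (\<zeta> * complex_of_real h) ^ k /\<^sub>R fact k)" for N \<zeta>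
    by (simp add: dexp_def sum_distrib_left scaleR_conv_of_real power_mult_distrib field_simps)
  have ne: "cmod (\<Sum>k<N. complex_of_real (h ^ k / fact k) * dexp k t \<zeta>)
      \<le> cmod (exp (\<zeta> * complex_of_real t)) * exp (cmod \<zeta> * h)" for N \<zeta>
  proof -
    have "cmod (\<Sum>k<N. (\<zeta> * complex_of_real h) ^ k /\<^sub>R fact k) \<le> (\<Sum>k<N. (cmod \<zeta> * h) ^ k /\<^sub>R fact k)"
      using h by (intro sum_norm_le) (simp add: norm_mult norm_power)
    also have "\<dots> \<le> exp (cmod \<zeta> * h)"
      unfolding exp_def using h by (intro sum_le_suminf summable_exp_generic) auto
    finally show ?thesis unfolding e norm_mult by (rule mult_left_mono) simp
  qed
  show "continuous_on P (\<lambda>\<zeta>. \<Sum>k<N. complex_of_real (h ^ k / fact k) * dexp k t \<zeta>)" for N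
    unfolding dexp_def by (intro continuous_intros)
  show "continuous_on P (dexp 0 (t + h))"
    unfolding dexp_def by (intro continuous_intros)
  show "0 < q * t - h" using h by simp
  show "cmod (\<Sum>k<N. complex_of_real (h ^ k / fact k) * dexp k t (polar \<rho> \<xi>))
      \<le> exp (\<rho> * t) * exp (\<rho> * h)" for N \<xi>
    using path norm_exp_arc[of t \<xi>] t by (intro order_trans[OF ne]) (simp add: norm_mult)
  show "cmod (\<Sum>k<N. complex_of_real (h ^ k / fact k) * dexp k t (polar s \<phi>))
      \<le> 1 * exp (- (q * t - h) * s)" if *: "\<rho> \<le> s" "\<phi> \<in> {\<beta>, - \<beta>}" for N s \<phi>
  proof (rule order_trans[OF ne])
    show "cmod (exp (polar s \<phi> * complex_of_real t)) * exp (cmod (polar s \<phi>) * h)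
        \<le> 1 * exp (- (q * t - h) * s)"
      unfolding norm_exp_ray[OF *(2)] using path * by (simp add: norm_mult algebra_simps flip: exp_add)
  qed
  show "(\<lambda>N. \<Sum>k<N. complex_of_real (h ^ k / fact k) * dexp k t \<zeta>) \<longlonglongrightarrow> dexp 0 (t + h) \<zeta>" for \<zeta>
  proof -
    have "(\<lambda>N. \<Sum>k<N. (\<zeta> * complex_of_real h) ^ k /\<^sub>R fact k) \<longlonglongrightarrow> exp (\<zeta> * complex_of_real h)"
      using exp_converges[of "\<zeta> * complex_of_real h"] by (simp add: sums_def)
    then have "(\<lambda>N. exp (\<zeta> * complex_of_real t) * (\<Sum>k<N. (\<zeta> * complex_of_real h) ^ k /\<^sub>R fact k))
        \<longlonglongrightarrow> exp (\<zeta> * complex_of_real t) * exp (\<zeta> * complex_of_real h)"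
      by (intro tendsto_intros)
    then show ?thesis unfolding e by (simp add: dexp_def distrib_left exp_add)
  qed
qed

text \<open>Analyticity of \<open>t \<mapsto> S t x\<close> on \<open>(0, \<infinity>)\<close>: what a closed subspace contains for small times it
  contains for all times.  The derivatives at a small time \<open>t\<close> lie in the subspace, as limits of
  difference quotients, and the Taylor series at \<open>t\<close> reaches the times below \<open>(1 + q) t\<close>; so every
  step gains a constant factor.\<close>

lemma S_in_closed_subspace:
  assumes Y: "subspace Y" "closed Y" and \<eta>: "0 < \<eta>" and start: "\<And>t. 0 < t \<Longrightarrow> t < \<eta> \<Longrightarrow> S t x \<in> Y"
    and "0 < t"
  shows "S t x \<in> Y"
proof -
  have step: "S t x \<in> Y" if start: "\<And>t. 0 < t \<Longrightarrow> t < \<eta> \<Longrightarrow> S t x \<in> Y" and t: "0 < t" "t < \<eta> * (1 + q / 2)" for \<eta> t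
  proof -
    have dexp: "E (dexp n t) x \<in> Y" if "0 < t" "t < \<eta>" for n t
      using that
    proof (induction n arbitrary: t)
      case 0
      then show ?case using start[of t] S_eq_E[of t x] by simp
    next
      case (Suc n)
      define d where "d = min (q * t / 2) ((\<eta> - t) / 2)"
      have d: "0 < d" "d \<le> q * t / 2" "d \<le> (\<eta> - t) / 2"
        unfolding d_def by (use Suc.prems q_pos in simp) (rule min.cobounded1, rule min.cobounded2)
      have "(1 / (d / real (Suc j))) *\<^sub>R (E (dexp n (t + d / real (Suc j))) x - E (dexp n t) x) \<in> Y" for j
      proof -
        have "d / real (Suc j) \<le> d" using d by (simp add: field_simps)
        moreover have "t + d < \<eta>" using d(1,3) by (simp add: field_simps)
        ultimately have "t + d / real (Suc j) < \<eta>" by (rule le_less_trans[OF add_left_mono])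
        then show ?thesis
          using Suc d by (intro subspace_scale subspace_diff Y Suc.IH) (auto intro: add_pos_pos)
      qed
      then show ?case
        using closed_sequentially[OF Y(2) _ E_dexp_difference_quotient[OF Suc.prems(1) d(1,2)]] by blast
    qed
    \<comment> \<open>an earlier time below \<open>\<eta>\<close>, from which \<open>t\<close> is within the radius \<open>q t0\<close> of convergence\<close>
    define t0 where "t0 = t / (1 + q / 2)"
    have q2: "0 < 1 + q / 2" using q_pos by simp
    then have "t0 * (1 + q / 2) = t" by (simp add: t0_def)
    then have t0: "0 < t0" "t0 < \<eta>" "t = t0 + t0 * (q / 2)"
      using t q2 by (auto simp: t0_def divide_less_eq distrib_left)
    have sums: "path_integrable (\<lambda>\<zeta>. \<Sum>k<N. complex_of_real (h ^ k / fact k) * dexp k t0 \<zeta>)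
       \<and> E (\<lambda>\<zeta>. \<Sum>k<N. complex_of_real (h ^ k / fact k) * dexp k t0 \<zeta>) x \<in> Y" for N h
    proof (induction N)
      case 0
      have "path_integrable (\<lambda>\<zeta>. 0 * dexp 0 t0 \<zeta>)" by (intro path_integrable_cmult path_integrable_dexp t0)
      moreover have "E (\<lambda>\<zeta>. 0 * dexp 0 t0 \<zeta>) x \<in> Y"
        by (subst E_scaleC) (use Y t0 in \<open>auto intro: path_integrable_dexp simp: subspace_0 scaleC.zero_left\<close>)
      ultimately show ?case by simp
    next
      case (Suc N)
      have dec: "path_integrable (dexp N t0)" by (intro path_integrable_dexp t0)
      show ?case
        unfolding sum.lessThan_Suc
        using Suc dec dexp[OF t0(1,2)] Y
        by (simp add: path_integrable_add path_integrable_cmult E_add E_scaleC subspace_add subspace_scale scaleC_of_real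
            del: of_real_divide of_real_power)
    qed
    have "E (dexp 0 (t0 + t0 * (q / 2))) x \<in> Y"
    proof (rule closed_sequentially[OF Y(2)])
      show "(\<lambda>N. E (\<lambda>\<zeta>. \<Sum>k<N. complex_of_real ((t0 * (q / 2)) ^ k / fact k) * dexp k t0 \<zeta>) x)
          \<longlonglongrightarrow> E (dexp 0 (t0 + t0 * (q / 2))) x"
        using q_pos t0 by (intro E_dexp_Taylor) auto
    qed (use sums in blast)
    then show ?thesis using t S_eq_E[of t x] t0(3) by simp
  qed
  have all: "S t x \<in> Y" if "0 < t" "t < \<eta> * (1 + q / 2) ^ n" for n t
    using that
  proof (induction n arbitrary: t)
    case 0
    then show ?case by (simp add: start)
  next
    case (Suc n)
    then show ?case by (intro step[of "\<eta> * (1 + q / 2) ^ n" t]) (auto simp: mult_ac)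
  qed
  obtain n where "t / \<eta> < (1 + q / 2) ^ n"
    using real_arch_pow[of "1 + q / 2" "t / \<eta>"] q_pos by auto
  then have "t < \<eta> * (1 + q / 2) ^ n" using \<eta> by (simp add: field_simps)
  then show ?thesis using all assms(5) by blast
qed

lemma norm_exp_remainder_le:
  assumes "0 < s" "\<bar>\<xi>\<bar> \<le> \<beta>" "cmod c \<le> b"
  shows "norm ((c / (polar s \<xi>)) *\<^sub>C K (polar s \<xi>) y)
    \<le> b * (k0 * norm y) * s powr (- 1 - \<alpha>)"
proof -
  have "0 \<le> b" using assms(3) norm_ge_zero order_trans by blast
  have "norm ((c / (polar s \<xi>)) *\<^sub>C K (polar s \<xi>) y)
      = cmod c / s * norm (K (polar s \<xi>) y)"
    using assms by (simp add: norm_scaleC norm_divide norm_mult)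
  also have "\<dots> \<le> b / s * (k0 * s powr - \<alpha> * norm y)"
    using assms \<open>0 \<le> b\<close> by (intro mult_mono divide_right_mono norm_K_le) auto
  also have "\<dots> = b * (k0 * norm y) * s powr (- 1 - \<alpha>)"
    using assms by (simp add: powr_diff powr_minus field_simps)
  finally show ?thesis .
qed

text \<open>At \<open>t = 0\<close> the integrand is \<open>O(\<bar>\<zeta>\<bar>\<^sup>-\<^sup>1\<^sup>-\<^sup>\<alpha>)\<close> and holomorphic to the right of the path, so the integral
  vanishes.  The duality map reduces this to a scalar integral: it provides, for the value \<open>w\<close> of
  the integral, a functional that takes the value \<open>\<parallel>w\<parallel>\<^sup>2\<close> at \<open>w\<close>.\<close>

lemma hankel_remainder_tendsto_0:
  assumes X: "\<And>n. 0 < X n" "\<And>n. X n \<le> 1" "X \<longlonglongrightarrow> 0"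
  shows "(\<lambda>n. hankel_integral \<rho> \<beta> (\<lambda>\<zeta>. (exp (\<zeta> * complex_of_real (X n)) / \<zeta>) *\<^sub>C K \<zeta> y)) \<longlonglongrightarrow> 0"
    and "hankel_integrable \<rho> \<beta> (\<lambda>\<zeta>. (exp (\<zeta> * complex_of_real (X n)) / \<zeta>) *\<^sub>C K \<zeta> y)"
proof -
  let ?H = "\<lambda>\<zeta>. (1 / \<zeta>) *\<^sub>C K \<zeta> y"
  let ?G = "\<lambda>n \<zeta>. (exp (\<zeta> * complex_of_real (X n)) / \<zeta>) *\<^sub>C K \<zeta> y"
  have contK: "continuous_on P (\<lambda>\<zeta>. K \<zeta> y)"
    using continuous_on_K hankel_path_subset_W continuous_on_subset by blast
  have P0: "\<zeta> \<noteq> 0" if "\<zeta> \<in> P" for \<zeta> using that hankel_path_subset_W nonpos_disjoint_W(2) by blast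
  have 1: "continuous_on P (?G n)" for n
    by (intro scaleC.continuous_on continuous_intros contK) (use P0 in auto)
  have 2: "continuous_on P ?H"
    by (intro scaleC.continuous_on continuous_intros contK) (use P0 in auto)
  have 3: "norm (?G n (polar \<rho> \<xi>)) \<le> exp \<rho> * (k0 * norm y) * \<rho> powr (- 1 - \<alpha>)" if "\<bar>\<xi>\<bar> \<le> \<beta>" for n \<xi>
  proof (rule norm_exp_remainder_le[OF path(1) that])
    have "\<rho> * X n \<le> \<rho> * 1" using X(2)[of n] path by (intro mult_left_mono) auto
    then show "cmod (exp (polar \<rho> \<xi> * complex_of_real (X n))) \<le> exp \<rho>"
      using X(1)[of n] by (intro order_trans[OF norm_exp_arc]) auto
  qed
  have 4: "norm (?G n (polar s \<phi>)) \<le> (1 * (k0 * norm y)) * s powr - (1 + \<alpha>)"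
    if "\<rho> \<le> s" "\<phi> \<in> {\<beta>, - \<beta>}" for n s \<phi>
  proof -
    have "cmod (exp (polar s \<phi> * complex_of_real (X n))) \<le> 1"
      unfolding norm_exp_ray[OF that(2)] using that path q_pos X(1)[of n] by simp
    then have "norm (?G n (polar s \<phi>)) \<le> 1 * (k0 * norm y) * s powr (- 1 - \<alpha>)"
      by (intro norm_exp_remainder_le) (use that path angles in auto)
    then show ?thesis by simp
  qed
  have 5: "(\<lambda>n. ?G n \<zeta>) \<longlonglongrightarrow> ?H \<zeta>" if "\<zeta> \<in> P" for \<zeta>
  proof -
    have "(\<lambda>n. exp (\<zeta> * complex_of_real (X n)) / \<zeta>) \<longlonglongrightarrow> exp (\<zeta> * complex_of_real 0) / \<zeta>"
      using P0[OF that] by (intro tendsto_intros X(3))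
    then show ?thesis by (intro scaleC.tendsto tendsto_const) simp
  qed
  have "1 < 1 + \<alpha>" using alpha by simp
  note dom = hankel_dominated_convergence[where G = ?G and H = ?H, OF 1 2 path(1) 3
      set_integrable_powr_ray[OF this path(1)] 4 5]
  show "hankel_integrable \<rho> \<beta> (?G n)" using dom(2) by simp
  define w where "w = hankel_integral \<rho> \<beta> ?H"
  have Jw: "bounded_clinear (J w)" "J w w = complex_of_real ((norm w)\<^sup>2)"
    using duality_map_clinear[OF J] by auto
  have int: "hankel_integrable \<rho> \<beta> ?H" using dom(3) by simp
  have "J w w = hankel_integral \<rho> \<beta> (\<lambda>\<zeta>. J w (?H \<zeta>))"
    unfolding w_def using hankel_integral_bounded_clinear[OF Jw(1) int] by (simp add: w_def)
  also have "\<dots> = 0"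
  proof (rule hankel_integral_eq_0[OF open_W])
    have "J w (c *\<^sub>C v) = c * J w v" for c v using Jw(1) by (simp add: bounded_clinear_def scaleC_complex_def)
    then show "(\<lambda>\<zeta>. J w (?H \<zeta>)) holomorphic_on W"
      by simp (intro holomorphic_intros holomorphic_K Jw(1), auto dest: nonpos_disjoint_W)
    show "hankel_integrable \<rho> \<beta> (\<lambda>\<zeta>. J w (?H \<zeta>))"
      by (rule hankel_integrable_bounded_clinear[OF Jw(1) int])
    show "norm (J w (?H (polar s \<xi>))) \<le> (onorm (J w) * (1 * (k0 * norm y))) * s powr (- 1 - \<alpha>)"
      if "0 < s" "\<bar>\<xi>\<bar> \<le> \<beta>" for s \<xi>
    proof -
      have lin: "bounded_linear (J w)" using Jw(1) by (simp add: bounded_clinear_def)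
      have "norm (J w (?H (polar s \<xi>))) \<le> onorm (J w) * norm (?H (polar s \<xi>))"
        by (rule onorm[OF lin])
      also have "\<dots> \<le> onorm (J w) * (1 * (k0 * norm y) * s powr (- 1 - \<alpha>))"
        by (intro mult_left_mono norm_exp_remainder_le that onorm_pos_le lin) simp
      finally show ?thesis by (simp only: mult.assoc)
    qed
  qed (use polar_in_W path angles alpha in auto)
  finally have "w = 0" using Jw(2) by simp
  then show "(\<lambda>n. hankel_integral \<rho> \<beta> (?G n)) \<longlonglongrightarrow> 0" using dom(1) by (simp add: w_def)
qed

text \<open>By the resolvent equation the integrand is \<open>exp (\<zeta> t) / \<zeta>\<close> times \<open>x + K \<zeta> (A x)\<close>, and the scalar
  integral of \<open>exp (\<zeta> t) / \<zeta>\<close> is \<open>2 \<pi> \<i>\<close>.\<close>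

lemma S_eq_domain:
  assumes x: "x \<in> D" and t: "0 < t"
    and int: "hankel_integrable \<rho> \<beta> (\<lambda>\<zeta>. (exp (\<zeta> * complex_of_real t) / \<zeta>) *\<^sub>C K \<zeta> (A x))"
  shows "S t x = x + (1 / (2 * complex_of_real pi * \<i>)) *\<^sub>C
    hankel_integral \<rho> \<beta> (\<lambda>\<zeta>. (exp (\<zeta> * complex_of_real t) / \<zeta>) *\<^sub>C K \<zeta> (A x))"
proof -
  let ?e = "\<lambda>\<zeta>. exp (\<zeta> * complex_of_real t) / \<zeta>"
  note exp = hankel_integral_exp[OF t path(1,2) angles(4)]
  have L: "bounded_clinear (\<lambda>c. c *\<^sub>C x)"
    by (simp add: bounded_clinear_def scaleC.bounded_linear_left scaleC_complex_def scaleC_scaleC)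
  have "hankel_integral \<rho> \<beta> (\<lambda>\<zeta>. (exp (\<zeta> * complex_of_real t) * \<zeta> powr complex_of_real (\<alpha> - 1)) *\<^sub>C K \<zeta> x)
      = hankel_integral \<rho> \<beta> (\<lambda>\<zeta>. ?e \<zeta> *\<^sub>C x + ?e \<zeta> *\<^sub>C K \<zeta> (A x))"
  proof (rule hankel_integral_cong)
    fix \<zeta> assume "\<zeta> \<in> P"
    then have \<zeta>: "\<zeta> \<noteq> 0" "\<zeta> powr complex_of_real \<alpha> \<notin> sector \<omega> \<theta>"
      using hankel_path_subset_W nonpos_disjoint_W(2) powr_not_in_sector by blast+
    have "exp (\<zeta> * complex_of_real t) * \<zeta> powr complex_of_real (\<alpha> - 1) = ?e \<zeta> * \<zeta> powr complex_of_real \<alpha>"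
      using \<zeta>(1) by (simp add: powr_diff)
    then show "(exp (\<zeta> * complex_of_real t) * \<zeta> powr complex_of_real (\<alpha> - 1)) *\<^sub>C K \<zeta> x = ?e \<zeta> *\<^sub>C x + ?e \<zeta> *\<^sub>C K \<zeta> (A x)"
      using resolvent_generator[OF \<zeta>(2) x] by (simp only: K_def scaleC_add_right[symmetric] scaleC_scaleC[symmetric])
  qed
  also have "\<dots> = hankel_integral \<rho> \<beta> (\<lambda>\<zeta>. ?e \<zeta> *\<^sub>C x) + hankel_integral \<rho> \<beta> (\<lambda>\<zeta>. ?e \<zeta> *\<^sub>C K \<zeta> (A x))"
    by (rule hankel_integral_add[OF hankel_integrable_bounded_clinear[OF L exp(1)] int])
  also have "hankel_integral \<rho> \<beta> (\<lambda>\<zeta>. ?e \<zeta> *\<^sub>C x) = (2 * complex_of_real pi * \<i>) *\<^sub>C x"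
    using hankel_integral_bounded_clinear[OF L exp(1)] exp(2) by simp
  finally show ?thesis
    using t by (simp add: S_op_eq_E E_def scaleC_add_right scaleC_scaleC)
qed

lemma S_tendsto_id_domain:
  assumes "x \<in> D"
  shows "((\<lambda>t. S t x) \<longlongrightarrow> x) (at_right 0)"
proof -
  have "((\<lambda>t. S t x) \<longlongrightarrow> x) (at 0 within {0..1})"
    unfolding tendsto_at_iff_sequentially
  proof (intro allI impI)
    fix X :: "nat \<Rightarrow> real" assume "\<forall>i. X i \<in> {0..1} - {0}" and X0: "X \<longlonglongrightarrow> 0"
    then have X: "0 < X n" "X n \<le> 1" for n by (auto simp: less_le)
    note lim = hankel_remainder_tendsto_0[where X = X and y = "A x", OF X X0]
    have "(\<lambda>n. x + (1 / (2 * complex_of_real pi * \<i>)) *\<^sub>C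
       hankel_integral \<rho> \<beta> (\<lambda>\<zeta>. (exp (\<zeta> * complex_of_real (X n)) / \<zeta>) *\<^sub>C K \<zeta> (A x)))
       \<longlonglongrightarrow> x + (1 / (2 * complex_of_real pi * \<i>)) *\<^sub>C 0"
      by (intro tendsto_add scaleC.tendsto tendsto_const lim(1))
    then show "((\<lambda>t. S t x) \<circ> X) \<longlonglongrightarrow> x"
      using S_eq_domain[OF assms X(1) lim(2)] by (simp add: o_def scaleC.zero_right)
  qed
  then show ?thesis by (simp add: at_within_Icc_at_right)
qed

text \<open>The domain of \<open>A\<close> is dense and the operators are uniformly bounded, so convergence carries over to
  all vectors.\<close>

lemma S_tendsto_id:
  assumes bound: "\<And>t v. 0 \<le> t \<Longrightarrow> norm (S t v) \<le> M * norm v"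
  shows "((\<lambda>t. S t x) \<longlongrightarrow> x) (at_right 0)"
proof (rule tendstoI)
  fix e :: real assume e: "0 < e"
  define d where "d = e / (2 * (\<bar>M\<bar> + 1))"
  have d: "0 < d" "(\<bar>M\<bar> + 1) * d = e / 2" using e by (auto simp: d_def field_simps)
  have "x \<in> closure D" using A(1) by (simp add: closed_densely_defined_def)
  then obtain y where y: "y \<in> D" "dist y x < d" using d(1) closure_approachable by blast
  have "eventually (\<lambda>t. dist (S t y) y < e / 2) (at_right 0)"
    using S_tendsto_id_domain[OF y(1)] e by (auto dest: tendstoD[of _ _ _ "e / 2"])
  then show "eventually (\<lambda>t. dist (S t x) x < e) (at_right 0)"
    using eventually_at_right_less[of 0]
  proof eventually_elim
    case (elim t)
    have "S t x = S t (x - y) + S t y" using S_add[of t "x - y" y] elim by simp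
    then have "dist (S t x) (S t y) \<le> M * norm (x - y)"
      using bound[of t "x - y"] elim by (simp add: dist_norm)
    also have "\<dots> \<le> \<bar>M\<bar> * d" using y(2) by (intro mult_mono) (auto simp: dist_norm norm_minus_commute)
    finally have "dist (S t x) (S t y) \<le> \<bar>M\<bar> * d" .
    moreover have "dist (S t x) x \<le> dist (S t x) (S t y) + dist (S t y) y + dist y x"
      by metric
    moreover have "\<bar>M\<bar> * d + d = e / 2" using d(2) by (simp add: algebra_simps)
    ultimately show ?case using elim y(2) by linarith
  qed
qed

lemma continuous_on_S:
  assumes bound: "\<And>t v. 0 \<le> t \<Longrightarrow> norm (S t v) \<le> M * norm v"
  shows "continuous_on {0..} (\<lambda>t. S t x)"
  unfolding continuous_on_eq_continuous_within
proof
  fix t :: real assume "t \<in> {0..}"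
  then consider "t = 0" | "0 < t" by force
  then show "continuous (at t within {0..}) (\<lambda>t. S t x)"
  proof cases
    case 1
    then show ?thesis
      using S_tendsto_id[OF bound] by (simp add: continuous_within at_within_Ici_at_right S_zero)
  next
    case 2
    then have "continuous_on {t / 2<..<t + 1} (\<lambda>t. S t x)"
      using S_continuous_pos[of "t / 2" "t + 1" x] by (auto intro: continuous_on_subset)
    then have "isCont (\<lambda>t. S t x) t"
      using 2 by (auto simp: continuous_on_eq_continuous_at)
    then show ?thesis by (rule continuous_at_imp_continuous_at_within)
  qed
qed

end

section \<open>Closed subspaces and Hoelder's inequality\<close>

text \<open>Simple functions that approximate \<open>h\<close> in mean may be moved into \<open>Y\<close>: replacing each value by
  a point of \<open>Y\<close> about as close to it as \<open>h\<close> costs only a constant factor.\<close>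

lemma integral_in_closed_subspace:
  fixes h :: "'a \<Rightarrow> 'b::{banach, second_countable_topology}"
  assumes Y: "subspace Y" "closed Y" and h: "\<And>s. s \<in> space N \<Longrightarrow> h s \<in> Y"
  shows "(\<integral>s. h s \<partial>N) \<in> Y"
proof (cases "integrable N h")
  case False
  then show ?thesis using Y by (simp add: not_integrable_integral_eq subspace_0)
next
  case True
  obtain s where s: "\<And>i. Bochner_Integration.simple_bochner_integrable N (s i)"
      and lim: "(\<lambda>i. \<integral>\<^sup>+x. norm (h x - s i x) \<partial>N) \<longlonglongrightarrow> 0"
    using has_bochner_integral_integrable[OF True] by (auto elim!: has_bochner_integral.cases)
  \<comment> \<open>points of \<open>Y\<close> stay where they are; for the point 0 this keeps the supports of finite measure\<close>
  have "\<exists>y'\<in>Y. (\<forall>z\<in>Y. dist y y' \<le> 2 * dist y z) \<and> (y \<in> Y \<longrightarrow> y' = y)" for y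
  proof (cases "y \<in> Y")
    case True
    then show ?thesis by (intro bexI[of _ y]) auto
  next
    case False
    have ne: "Y \<noteq> {}" using Y subspace_0 by blast
    have pos: "0 < infdist y Y" using infdist_pos_not_in_closed[OF Y(2) ne False] .
    then have "(INF a\<in>Y. dist y a) < 2 * infdist y Y" using ne by (simp add: infdist_notempty)
    then obtain y' where "y' \<in> Y" "dist y y' < 2 * infdist y Y"
      using ne by (subst (asm) cINF_less_iff) auto
    then show ?thesis
      using False infdist_le[of _ Y y] by (intro bexI[of _ y']) force+
  qed
  then obtain \<pi> where \<pi>: "\<And>y. \<pi> y \<in> Y" "\<And>y z. z \<in> Y \<Longrightarrow> dist y (\<pi> y) \<le> 2 * dist y z" "\<And>y. y \<in> Y \<Longrightarrow> \<pi> y = y"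
    by metis
  have \<pi>0: "\<pi> 0 = 0" using \<pi>(3) Y by (simp add: subspace_0)
  have s': "Bochner_Integration.simple_bochner_integrable N (\<lambda>x. \<pi> (s i x))" for i
    by (rule simple_bochner_integrable_compose2[where p = "\<lambda>x y. \<pi> x", OF _ s s]) (rule \<pi>0)
  have int: "integrable N (\<lambda>x. \<pi> (s i x))" for i
    using has_bochner_integral_simple_bochner_integrable[OF s'] by (auto intro: integrable.intros)
  have meas: "h \<in> borel_measurable N" "\<And>i. s i \<in> borel_measurable N" 
    using True s by (auto dest: borel_measurable_integrable has_bochner_integral_simple_bochner_integrable
        intro: borel_measurable_has_bochner_integral)
  have "(\<lambda>i. \<integral>x. \<pi> (s i x) \<partial>N) \<longlonglongrightarrow> (\<integral>x. h x \<partial>N)"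
  proof (rule tendsto_L1_int)
    show "(\<lambda>i. \<integral>\<^sup>+x. norm (\<pi> (s i x) - h x) \<partial>N) \<longlonglongrightarrow> 0"
    proof (rule tendsto_sandwich[OF always_eventually always_eventually tendsto_const])
      show "(\<lambda>i. 3 * (\<integral>\<^sup>+x. norm (h x - s i x) \<partial>N)) \<longlonglongrightarrow> 0"
        using ennreal_tendsto_cmult[OF _ lim, of 3] by simp
      show "\<forall>i. (\<integral>\<^sup>+x. norm (\<pi> (s i x) - h x) \<partial>N) \<le> 3 * (\<integral>\<^sup>+x. norm (h x - s i x) \<partial>N)"
      proof
        fix i
        have *: "ennreal (norm (\<pi> (s i x) - h x)) \<le> 3 * ennreal (norm (h x - s i x))" if "x \<in> space N" for x
        proof -
          have "norm (\<pi> (s i x) - h x) \<le> 3 * norm (h x - s i x)"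
            using \<pi>(2)[OF h[OF that], of "s i x"] norm_triangle_ineq4[of "\<pi> (s i x) - s i x" "h x - s i x"]
            by (simp add: dist_norm norm_minus_commute)
          then have "ennreal (norm (\<pi> (s i x) - h x)) \<le> ennreal (3 * norm (h x - s i x))" by (rule ennreal_leI)
          then show ?thesis by (simp add: ennreal_mult)
        qed
        then have "(\<integral>\<^sup>+x. norm (\<pi> (s i x) - h x) \<partial>N) \<le> (\<integral>\<^sup>+x. 3 * ennreal (norm (h x - s i x)) \<partial>N)"
          by (rule nn_integral_mono)
        also have "\<dots> = 3 * (\<integral>\<^sup>+x. norm (h x - s i x) \<partial>N)"
          using meas by (intro nn_integral_cmult) auto
        finally show "(\<integral>\<^sup>+x. norm (\<pi> (s i x) - h x) \<partial>N) \<le> 3 * (\<integral>\<^sup>+x. norm (h x - s i x) \<partial>N)" .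
      qed
    qed simp
  qed (rule int True)+
  moreover have "(\<integral>x. \<pi> (s i x) \<partial>N) \<in> Y" for i
  proof -
    have "(\<integral>x. \<pi> (s i x) \<partial>N) = Bochner_Integration.simple_bochner_integral N (\<lambda>x. \<pi> (s i x))"
      using simple_bochner_integrable_eq_integral[OF s'] by simp
    also have "\<dots> \<in> Y"
      unfolding simple_bochner_integral_def using Y(1) \<pi>(1) by (intro subspace_sum subspace_scale) auto
    finally show ?thesis .
  qed
  ultimately show ?thesis by (rule closed_sequentially[OF Y(2), rotated])
qed

lemma set_integral_in_closed_subspace:
  fixes h :: "'a \<Rightarrow> 'b::{banach, second_countable_topology}"
  assumes "subspace Y" "closed Y" "\<And>s. s \<in> E \<Longrightarrow> h s \<in> Y"
  shows "(LINT s:E|N. h s) \<in> Y"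
  unfolding set_lebesgue_integral_def
  using assms by (intro integral_in_closed_subspace) (auto simp: indicator_def subspace_0)

lemma set_integrable_const_interval: "set_integrable lebesgue {a..b::real} (\<lambda>_. c :: real)"
  using finite_measure_lebesgue_on[of "{a..b}"]
  by (auto simp: set_integrable_def integrable_indicator_iff emeasure_lborel_Icc_eq)

text \<open>Young's inequality bounds \<open>h t * y powr (1 - p)\<close> by \<open>p * h t powr (1 / p) + (1 - p) * y\<close>.  Integrated
  over \<open>[0, T]\<close>, this is sharpest when \<open>y\<close> is the mean of \<open>h powr (1 / p)\<close>.\<close>

lemma
  assumes p: "0 < p" "p < 1" and T: "0 < T" and h: "h \<in> Lp_nonneg (1 / p) T"
  shows set_integrable_Lp: "set_integrable lebesgue {0..T} h"
    and set_integral_Holder: "(LINT t:{0..T}|lebesgue. h t) \<le> T powr (1 - p) * Lp_norm (1 / p) T h"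
proof -
  let ?q = "1 / p"
  have pos: "0 \<le> h t" if "t \<in> {0..T}" for t using h that by (auto simp: Lp_nonneg_def)
  have meas: "set_borel_measurable lebesgue {0..T} h" and int: "set_integrable lebesgue {0..T} (\<lambda>t. h t powr ?q)"
  proof -
    have "set_integrable lebesgue {0..T} (\<lambda>t. \<bar>h t\<bar> powr ?q) \<longleftrightarrow> set_integrable lebesgue {0..T} (\<lambda>t. h t powr ?q)"
      by (rule set_integrable_cong) (use pos in auto)
    then show "set_borel_measurable lebesgue {0..T} h" "set_integrable lebesgue {0..T} (\<lambda>t. h t powr ?q)"
      using h by (auto simp: Lp_nonneg_def)
  qed
  have young: "h t * y powr (1 - p) \<le> p * (h t powr ?q) + (1 - p) * y" if "t \<in> {0..T}" "0 < y" for t y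
  proof (cases "h t = 0")
    case True
    then show ?thesis using p that by simp
  next
    case False
    then have "0 < h t" using pos[OF that(1)] by simp
    then show ?thesis
      using Youngs_inequality_0[of p "1 - p" "h t powr ?q" y] p that by (simp add: powr_powr)
  qed
  have int': "set_integrable lebesgue {0..T} (\<lambda>t. p * (h t powr ?q) + (1 - p) * y)" for y
    using int set_integrable_const_interval by (intro set_integral_add(1)) auto
  show hint: "set_integrable lebesgue {0..T} h"
  proof (rule set_integrable_bound[OF int'[of 1] meas], intro AE_I2 impI)
    fix t assume "t \<in> {0..T}"
    then show "norm (h t) \<le> norm (p * (h t powr ?q) + (1 - p) * 1)"
      using young[of t 1] pos[of t] by simp
  qed
  define a where "a = (LINT t:{0..T}|lebesgue. h t powr ?q)"
  have norm: "Lp_norm ?q T h = a powr p"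
    unfolding Lp_norm_def a_def using pos by (auto intro!: arg_cong2[where f = "(powr)"] set_lebesgue_integral_cong)
  have le: "(LINT t:{0..T}|lebesgue. h t) * y powr (1 - p) \<le> p * a + (1 - p) * y * T" if "0 < y" for y
  proof -
    have "(LINT t:{0..T}|lebesgue. h t * y powr (1 - p)) \<le> (LINT t:{0..T}|lebesgue. p * (h t powr ?q) + (1 - p) * y)"
      using hint young that by (intro set_integral_mono int') auto
    moreover have "(LINT t:{0..T}|lebesgue. p * (h t powr ?q) + (1 - p) * y) = p * a + (1 - p) * y * T"
      using int T set_integrable_const_interval[of 0 T "(1 - p) * y"]
      by (subst set_integral_add(2)) (auto simp: a_def set_lebesgue_integral_def)
    ultimately show ?thesis by simp
  qed
  have a0: "0 \<le> a" unfolding a_def set_lebesgue_integral_def by (intro Bochner_Integration.integral_nonneg) simp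
  show "(LINT t:{0..T}|lebesgue. h t) \<le> T powr (1 - p) * Lp_norm ?q T h"
  proof (cases "a = 0")
    case False
    then have a: "0 < a" using a0 by simp
    have "(LINT t:{0..T}|lebesgue. h t) * (a / T) powr (1 - p) \<le> p * a + (1 - p) * (a / T) * T"
      by (rule le) (use a T in simp)
    also have "(1 - p) * (a / T) * T = (1 - p) * a" using T by simp
    also have "p * a + (1 - p) * a = a" by (simp add: left_diff_distrib)
    finally have "(LINT t:{0..T}|lebesgue. h t) \<le> a / (a / T) powr (1 - p)"
      using a T by (simp add: pos_le_divide_eq)
    also have "\<dots> = T powr (1 - p) * a powr p"
      using a T by (simp add: powr_divide powr_diff)
    finally show ?thesis by (simp add: norm)
  next
    case True
    have "(LINT t:{0..T}|lebesgue. h t) \<le> 0"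
    proof (rule field_le_epsilon)
      fix e :: real assume e: "0 < e"
      \<comment> \<open>the mean of \<open>h powr (1 / p)\<close> is 0 here and not allowed as \<open>y\<close>, but any small \<open>y\<close> will do\<close>
      define y where "y = (e / T) powr (1 / p)"
      have y: "0 < y" "y powr p = e / T" using e T p by (auto simp: y_def powr_powr)
      have "(LINT t:{0..T}|lebesgue. h t) * y powr (1 - p) \<le> (1 - p) * y * T"
        using le[OF y(1)] True by simp
      also have "\<dots> \<le> 1 * y * T" using p y T by (intro mult_right_mono) auto
      also have "\<dots> = e * y powr (1 - p)" using y T e by (simp add: powr_diff)
      finally show "(LINT t:{0..T}|lebesgue. h t) \<le> 0 + e" using y by simp
    qed
    then show ?thesis using True by (simp add: norm)
  qed
qed

section \<open>Strongly continuous families and convolution\<close>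

locale strongly_continuous_family =
  fixes S :: "real \<Rightarrow> 'x::{banach, second_countable_topology} \<Rightarrow> 'x" and M :: real
  assumes S_add: "0 \<le> t \<Longrightarrow> S t (v + w) = S t v + S t w"
    and S_scaleR: "0 \<le> t \<Longrightarrow> S t (c *\<^sub>R v) = c *\<^sub>R S t v"
    and S_bound: "0 \<le> t \<Longrightarrow> norm (S t v) \<le> M * norm v"
    and S_cont: "continuous_on {0..} (\<lambda>t. S t v)"
    and S_zero: "S 0 v = v"
    and M_pos: "0 < M"
begin

lemma S_bounded_linear: "0 \<le> t \<Longrightarrow> bounded_linear (S t)"
  by (rule bounded_linear_intro[where K = M]) (auto simp: S_add S_scaleR mult.commute S_bound)

lemma S_diff: "0 \<le> t \<Longrightarrow> S t (v - w) = S t v - S t w"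
  using S_bounded_linear by (simp add: bounded_linear.linear linear_diff)

text \<open>The factor \<open>M\<close> may thus be inserted where no operator \<open>S t\<close> occurs, as in the history condition,
  so that one smallness condition on the constants covers these places too.\<close>

lemma norm_le_M: "norm (v::'x) \<le> M * norm v"
  using S_bound[of 0 v] by (simp add: S_zero)

text \<open>Strong continuity and the uniform bound give joint continuity in time and vector.\<close>

lemma tendsto_S:
  fixes v :: "'n \<Rightarrow> 'x"
  assumes \<tau>: "(\<tau> \<longlongrightarrow> t) F" "eventually (\<lambda>n. 0 \<le> \<tau> n) F" "0 \<le> t" and v: "(v \<longlongrightarrow> w) F"
  shows "((\<lambda>n. S (\<tau> n) (v n)) \<longlongrightarrow> S t w) F"
proof -
  have "((\<lambda>n. S (\<tau> n) w) \<longlongrightarrow> S t w) F"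
    using continuous_on_tendsto_compose[OF S_cont \<tau>(1)] \<tau>(2,3) by simp
  moreover have "((\<lambda>n. S (\<tau> n) (v n) - S (\<tau> n) w) \<longlongrightarrow> 0) F"
  proof (rule Lim_null_comparison)
    show "\<forall>\<^sub>F n in F. norm (S (\<tau> n) (v n) - S (\<tau> n) w) \<le> M * norm (v n - w)"
      using \<tau>(2) by eventually_elim (metis S_bound S_diff)
    have "((\<lambda>n. M * norm (v n - w)) \<longlongrightarrow> M * norm (w - w)) F" by (intro tendsto_intros v)
    then show "((\<lambda>n. M * norm (v n - w)) \<longlongrightarrow> 0) F" by simp
  qed
  ultimately show ?thesis using tendsto_add by fastforce
qed

lemma continuous_on_S:
  assumes "continuous_on E \<tau>" "continuous_on E v" "\<And>n. n \<in> E \<Longrightarrow> 0 \<le> \<tau> n"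
  shows "continuous_on E (\<lambda>n. S (\<tau> n) (v n))"
  using assms unfolding continuous_on_def
  by (auto intro!: tendsto_S simp: eventually_at_filter)

text \<open>Cutting the time off at \<open>0\<close> makes the family jointly continuous on the whole line, so that
  composition preserves measurability.\<close>

lemma measurable_S:
  assumes "w \<in> borel_measurable N" "\<tau> \<in> borel_measurable N"
  shows "(\<lambda>s. S (max 0 (\<tau> s)) (w s)) \<in> borel_measurable N"
proof -
  have "continuous_on UNIV (\<lambda>z. S (max 0 (fst z)) (snd z))"
    by (intro continuous_on_S continuous_intros) auto
  moreover have "(\<lambda>s. (\<tau> s, w s)) \<in> borel_measurable N"
    using assms by (intro borel_measurable_Pair)
  ultimately have "(\<lambda>s. S (max 0 (fst (\<tau> s, w s))) (snd (\<tau> s, w s))) \<in> borel_measurable N"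
    by (rule borel_measurable_continuous_on)
  then show ?thesis by simp
qed

lemma indicator_S:
  fixes s t T :: real
  assumes "0 \<le> t" "t \<le> T"
  shows "indicat_real {0..t} s *\<^sub>R S (t - s) (w s) =
    indicat_real {0..t} s *\<^sub>R S (max 0 (t - s)) (indicat_real {0..T} s *\<^sub>R w s)"
  using assms by (simp add: indicator_def max_def)

definition conv :: "(real \<Rightarrow> 'x) \<Rightarrow> real \<Rightarrow> 'x"
  where "conv w t = (LINT s:{0..t}|lebesgue. S (t - s) (w s))"

definition final_states :: "('u::{complex_hilbert, second_countable_topology} \<Rightarrow> 'x) \<Rightarrow> real \<Rightarrow> real \<Rightarrow> 'x set"
  where "final_states B T b = {conv (\<lambda>s. B (u s)) T | u. u \<in> L2_controls T \<and> (\<forall>s\<le>b. u s = 0)}"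

context
  fixes w :: "real \<Rightarrow> 'x" and T :: real
  assumes w: "set_integrable lebesgue {0..T} w"
begin

lemma meas_conv: "0 \<le> t \<Longrightarrow> t \<le> T \<Longrightarrow> (\<lambda>s. indicat_real {0..t} s *\<^sub>R S (t - s) (w s)) \<in> borel_measurable lebesgue"
proof -
  assume t: "0 \<le> t" "t \<le> T"
  have "(\<lambda>s. indicat_real {0..T} s *\<^sub>R w s) \<in> borel_measurable lebesgue"
    using w unfolding set_integrable_def by (rule borel_measurable_integrable)
  then have "(\<lambda>s. S (max 0 (t - s)) (indicat_real {0..T} s *\<^sub>R w s)) \<in> borel_measurable lebesgue"
    by (rule measurable_S) (intro measurable_completion, simp)
  then show ?thesis
    unfolding indicator_S[OF t] by (intro borel_measurable_scaleR borel_measurable_indicator) simp_all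
qed

lemma norm_conv_integrand_le:
  "0 \<le> t \<Longrightarrow> t \<le> T \<Longrightarrow> norm (indicat_real {0..t} s *\<^sub>R S (t - s) (w s)) \<le> M * norm (indicat_real {0..T} s *\<^sub>R w s)"
  using S_bound[of "t - s" "w s"] M_pos by (auto simp: indicator_def)

lemma conv_integrable: "0 \<le> t \<Longrightarrow> t \<le> T \<Longrightarrow> set_integrable lebesgue {0..t} (\<lambda>s. S (t - s) (w s))"
  unfolding set_integrable_def
proof (rule Bochner_Integration.integrable_bound)
  show "integrable lebesgue (\<lambda>s. M * norm (indicat_real {0..T} s *\<^sub>R w s))"
    using w unfolding set_integrable_def by (intro integrable_mult_right integrable_norm)
  show "AE s in lebesgue. norm (indicat_real {0..t} s *\<^sub>R S (t - s) (w s)) \<le> norm (M * norm (indicat_real {0..T} s *\<^sub>R w s))"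
    if "0 \<le> t" "t \<le> T"
    using norm_conv_integrand_le[OF that] M_pos by (intro AE_I2) (simp add: abs_mult)
qed (rule meas_conv)

text \<open>Dominated convergence: the integrands converge except possibly at the moving endpoint \<open>s = t\<close>.\<close>

lemma continuous_on_conv: "continuous_on {0..T} (conv w)"
  unfolding continuous_on_sequentially
proof (intro allI ballI impI)
  fix X :: "nat \<Rightarrow> real" and t assume t: "t \<in> {0..T}" and "(\<forall>n. X n \<in> {0..T}) \<and> X \<longlonglongrightarrow> t"
  then have X: "0 \<le> X n" "X n \<le> T" "X \<longlonglongrightarrow> t" for n by auto
  have "(\<lambda>n. integral\<^sup>L lebesgue (\<lambda>s. indicat_real {0..X n} s *\<^sub>R S (X n - s) (w s))) \<longlonglongrightarrow>
     integral\<^sup>L lebesgue (\<lambda>s. indicat_real {0..t} s *\<^sub>R S (t - s) (w s))"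
  proof (rule integral_dominated_convergence)
    show "integrable lebesgue (\<lambda>s. M * norm (indicat_real {0..T} s *\<^sub>R w s))"
      using w unfolding set_integrable_def by (intro integrable_mult_right integrable_norm)
    show "AE s in lebesgue. norm (indicat_real {0..X n} s *\<^sub>R S (X n - s) (w s)) \<le> M * norm (indicat_real {0..T} s *\<^sub>R w s)" for n
      using norm_conv_integrand_le X by (intro AE_I2) auto
    have "AE s in lebesgue. s \<noteq> t" by (intro AE_completion AE_lborel_singleton)
    then show "AE s in lebesgue. (\<lambda>n. indicat_real {0..X n} s *\<^sub>R S (X n - s) (w s)) \<longlonglongrightarrow> indicat_real {0..t} s *\<^sub>R S (t - s) (w s)"
    proof eventually_elim
      case (elim s)
      consider "s < 0 \<or> t < s" | "0 \<le> s" "s < t" using elim by linarith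
      then show ?case
      proof cases
        case 1
        then have "eventually (\<lambda>n. s \<notin> {0..X n}) sequentially"
        proof
          assume "t < s"
          then have "eventually (\<lambda>n. X n < s) sequentially" using order_tendstoD(2)[OF X(3)] by simp
          then show ?thesis by eventually_elim simp
        qed simp
        then have "eventually (\<lambda>n. 0 = indicat_real {0..X n} s *\<^sub>R S (X n - s) (w s)) sequentially"
          by eventually_elim simp
        then have "(\<lambda>n. indicat_real {0..X n} s *\<^sub>R S (X n - s) (w s)) \<longlonglongrightarrow> 0"
          by (rule Lim_transform_eventually[OF tendsto_const])
        moreover have "indicat_real {0..t} s *\<^sub>R S (t - s) (w s) = 0" using 1 by auto
        ultimately show ?thesis by (simp only:)
      next
        case 2
        then have ev: "eventually (\<lambda>n. s < X n) sequentially" using order_tendstoD(1)[OF X(3)] by simp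
        have "(\<lambda>n. S (X n - s) (w s)) \<longlonglongrightarrow> S (t - s) (w s)"
          using 2 ev by (intro tendsto_S tendsto_intros X(3)) (auto elim: eventually_mono)
        moreover have "eventually (\<lambda>n. S (X n - s) (w s) = indicat_real {0..X n} s *\<^sub>R S (X n - s) (w s)) sequentially"
          using ev by eventually_elim (use 2 in simp)
        ultimately have "(\<lambda>n. indicat_real {0..X n} s *\<^sub>R S (X n - s) (w s)) \<longlonglongrightarrow> S (t - s) (w s)"
          by (rule Lim_transform_eventually)
        then show ?thesis using 2 by simp
      qed
    qed
  qed (use meas_conv t X in auto)
  then show "(conv w \<circ> X) \<longlonglongrightarrow> conv w t"
    by (simp add: conv_def set_lebesgue_integral_def o_def)
qed

end

lemma norm_conv_diff_le:
  assumes w: "set_integrable lebesgue {0..T} w" "set_integrable lebesgue {0..T} w'" and t: "0 \<le> t" "t \<le> T"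
    and le: "\<And>s. 0 \<le> s \<Longrightarrow> s \<le> t \<Longrightarrow> norm (w s - w' s) \<le> b s"
    and b: "set_integrable lebesgue {0..T} b" "\<And>s. s \<in> {0..T} \<Longrightarrow> 0 \<le> b s"
  shows "norm (conv w t - conv w' t) \<le> M * (LINT s:{0..T}|lebesgue. b s)"
proof -
  note int = conv_integrable[OF w(1) t] conv_integrable[OF w(2) t]
  have "conv w t - conv w' t = (LINT s:{0..t}|lebesgue. S (t - s) (w s) - S (t - s) (w' s))"
    unfolding conv_def by (rule set_integral_diff(2)[OF int, symmetric])
  also have "norm \<dots> \<le> (LINT s|lebesgue. M * (indicat_real {0..T} s *\<^sub>R b s))"
    unfolding set_lebesgue_integral_def
  proof (rule Bochner_Integration.integral_norm_bound_integral)
    show "integrable lebesgue (\<lambda>s. indicat_real {0..t} s *\<^sub>R (S (t - s) (w s) - S (t - s) (w' s)))"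
      using set_integral_diff(1)[OF int] by (simp add: set_integrable_def)
    show "integrable lebesgue (\<lambda>s. M * (indicat_real {0..T} s *\<^sub>R b s))"
      using b(1) unfolding set_integrable_def by (rule integrable_mult_right)
    fix s
    show "norm (indicat_real {0..t} s *\<^sub>R (S (t - s) (w s) - S (t - s) (w' s))) \<le> M * (indicat_real {0..T} s *\<^sub>R b s)"
    proof (cases "s \<in> {0..t}")
      case True
      then have "norm (S (t - s) (w s - w' s)) \<le> M * norm (w s - w' s)" by (intro S_bound) auto
      also have "\<dots> \<le> M * b s" using True M_pos by (intro mult_left_mono le) auto
      finally show ?thesis using True t by (simp add: S_diff)
    next
      case False
      then show ?thesis using b(2)[of s] M_pos by (auto simp: indicator_def)
    qed
  qed
  also have "\<dots> = M * (LINT s:{0..T}|lebesgue. b s)" by (simp add: set_lebesgue_integral_def)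
  finally show ?thesis .
qed

end

section \<open>Piecewise continuous functions\<close>

lemma at_left_Ioc: "a < (b::real) \<Longrightarrow> at b within {a<..b} = at_left b"
  by (rule at_within_nhd[of b "{a<..}"]) auto

lemma at_right_Ioc: "(a::real) < b \<Longrightarrow> at a within {a<..b} = at_right a"
  by (rule at_within_nhd[of a "{..<b}"]) auto

lemma continuous_on_tendsto_subset:
  "continuous_on E x \<Longrightarrow> s \<in> E \<Longrightarrow> E' \<subseteq> E \<Longrightarrow> (x \<longlongrightarrow> x s) (at s within E')"
  by (auto simp: continuous_on_def intro: tendsto_within_subset)

lemma piecewise_continuous_cong:
  assumes "\<And>s. s \<in> {a..b} \<Longrightarrow> x s = y s" "piecewise_continuous a b x"
  shows "piecewise_continuous a b y"
proof -
  obtain F where F: "finite F" "\<And>s. s \<in> {a..b} - F \<Longrightarrow> continuous (at s within {a..b}) x"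
    and left: "\<And>s. s \<in> {a<..b} \<Longrightarrow> \<exists>l. (x \<longlongrightarrow> l) (at_left s)"
    and right: "\<And>s. s \<in> {a..<b} \<Longrightarrow> \<exists>l. (x \<longlongrightarrow> l) (at_right s)"
    using assms(2) unfolding piecewise_continuous_def by blast
  show ?thesis
    unfolding piecewise_continuous_def
  proof (intro conjI ballI exI[of _ F])
    show "finite F" by fact
    fix s assume s: "s \<in> {a..b} - F"
    have "continuous (at s within {a..b}) x" by (rule F(2)[OF s])
    then show "continuous (at s within {a..b}) y"
      using Lim_cong_within[of s s "x s" "y s" "{a..b}" "{a..b}" x y] s assms(1)
      unfolding continuous_within by auto
  next
    fix s assume s: "s \<in> {a<..b}"
    then obtain l where "(x \<longlongrightarrow> l) (at_left s)" using left by blast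
    moreover have "eventually (\<lambda>u. x u = y u) (at_left s)"
      using eventually_at_left_real[of a s] s by (auto elim!: eventually_mono intro!: assms(1))
    ultimately show "\<exists>l. (y \<longlongrightarrow> l) (at_left s)" using Lim_transform_eventually by blast
  next
    fix s assume s: "s \<in> {a..<b}"
    then obtain l where "(x \<longlongrightarrow> l) (at_right s)" using right by blast
    moreover have "eventually (\<lambda>u. x u = y u) (at_right s)"
      using eventually_at_right_real[of s b] s by (auto elim!: eventually_mono intro!: assms(1))
    ultimately show "\<exists>l. (y \<longlongrightarrow> l) (at_right s)" using Lim_transform_eventually by blast
  qed
qed

lemma piecewise_continuous_subset:
  assumes "piecewise_continuous a b x" "a \<le> c" "d \<le> b"
  shows "piecewise_continuous c d x"
proof -
  obtain F where F: "finite F" "\<And>s. s \<in> {a..b} - F \<Longrightarrow> continuous (at s within {a..b}) x"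
    using assms(1) unfolding piecewise_continuous_def by blast
  have "continuous (at s within {c..d}) x" if "s \<in> {c..d} - F" for s
    by (rule continuous_within_subset[OF F(2)]) (use that assms in auto)
  moreover have "{c<..d} \<subseteq> {a<..b}" "{c..<d} \<subseteq> {a..<b}" using assms by auto
  ultimately show ?thesis
    using assms(1) F(1) unfolding piecewise_continuous_def by blast
qed

lemma piecewise_continuous_split:
  assumes "piecewise_continuous a b x" "piecewise_continuous b c x" "a \<le> b" "b \<le> c"
  shows "piecewise_continuous a c x"
proof -
  obtain F where F: "finite F" "\<And>s. s \<in> {a..b} - F \<Longrightarrow> continuous (at s within {a..b}) x"
    using assms(1) unfolding piecewise_continuous_def by blast
  obtain G where G: "finite G" "\<And>s. s \<in> {b..c} - G \<Longrightarrow> continuous (at s within {b..c}) x"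
    using assms(2) unfolding piecewise_continuous_def by blast
  have "continuous (at s within {a..c}) x" if s: "s \<in> {a..c} - insert b (F \<union> G)" for s
  proof (cases "s < b")
    case True
    then have "at s within {a..c} = at s within {a..b}"
      using assms by (intro at_within_nhd[of s "{..<b}"]) auto
    then show ?thesis using F(2)[of s] True s by simp
  next
    case False
    then have "at s within {a..c} = at s within {b..c}"
      using assms s by (intro at_within_nhd[of s "{b<..}"]) auto
    then show ?thesis using G(2)[of s] False s by simp
  qed
  moreover have "finite (insert b (F \<union> G))" using F G by simp
  moreover have "\<exists>l. (x \<longlongrightarrow> l) (at_left s)" if "s \<in> {a<..c}" for s
    using that assms(1,2) unfolding piecewise_continuous_def by (cases "s \<le> b") auto
  moreover have "\<exists>l. (x \<longlongrightarrow> l) (at_right s)" if "s \<in> {a..<c}" for s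
    using that assms(1,2) unfolding piecewise_continuous_def by (cases "s < b") auto
  ultimately show ?thesis unfolding piecewise_continuous_def by blast
qed

lemma piecewise_continuous_shift:
  fixes x :: "real \<Rightarrow> 'a::topological_space"
  assumes "piecewise_continuous (a + t) (b + t) x"
  shows "piecewise_continuous a b (\<lambda>s. x (t + s))"
proof -
  obtain F where F: "finite F" "\<And>s. s \<in> {a + t..b + t} - F \<Longrightarrow> continuous (at s within {a + t..b + t}) x"
    and left: "\<And>s. s \<in> {a + t<..b + t} \<Longrightarrow> \<exists>l. (x \<longlongrightarrow> l) (at_left s)"
    and right: "\<And>s. s \<in> {a + t..<b + t} \<Longrightarrow> \<exists>l. (x \<longlongrightarrow> l) (at_right s)"
    using assms unfolding piecewise_continuous_def by blast
  have shift: "filterlim (\<lambda>s. t + s) (at (t + s) within B) (at s within A)"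
    if "\<And>u. u \<in> A \<Longrightarrow> t + u \<in> B" for s A B
    unfolding filterlim_at using that by (auto intro!: tendsto_intros simp: eventually_at_filter)
  show ?thesis
    unfolding piecewise_continuous_def
  proof (intro conjI ballI exI[of _ "(\<lambda>s. s - t) ` F"])
    show "finite ((\<lambda>s. s - t) ` F)" using F by simp
    fix s assume s: "s \<in> {a..b} - (\<lambda>s. s - t) ` F"
    then have "t + s \<notin> F" by force
    then have "(x \<longlongrightarrow> x (t + s)) (at (t + s) within {a + t..b + t})"
      using F(2)[of "t + s"] s by (simp add: continuous_within)
    then show "continuous (at s within {a..b}) (\<lambda>s. x (t + s))"
      unfolding continuous_within by (rule filterlim_compose[OF _ shift]) auto
  next
    fix s assume "s \<in> {a<..b}"
    then obtain l where "(x \<longlongrightarrow> l) (at_left (t + s))" using left[of "t + s"] by auto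
    then have "((\<lambda>s. x (t + s)) \<longlongrightarrow> l) (at_left s)" by (rule filterlim_compose[OF _ shift]) auto
    then show "\<exists>l. ((\<lambda>s. x (t + s)) \<longlongrightarrow> l) (at_left s)" by blast
  next
    fix s assume "s \<in> {a..<b}"
    then obtain l where "(x \<longlongrightarrow> l) (at_right (t + s))" using right[of "t + s"] by auto
    then have "((\<lambda>s. x (t + s)) \<longlongrightarrow> l) (at_right s)" by (rule filterlim_compose[OF _ shift]) auto
    then show "\<exists>l. ((\<lambda>s. x (t + s)) \<longlongrightarrow> l) (at_right s)" by blast
  qed
qed

lemma piecewise_continuous_Ioc:
  fixes x :: "real \<Rightarrow> 'a::topological_space"
  assumes x: "continuous_on {a<..b} x" "(x \<longlongrightarrow> l) (at_right a)"
  shows "piecewise_continuous a b x"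
  unfolding piecewise_continuous_def
proof (intro conjI ballI exI[of _ "{a}"])
  have lim: "(x \<longlongrightarrow> x s) (at s within {a<..b})" if "s \<in> {a<..b}" for s
    using x(1) that by (simp add: continuous_on_def)
  show "finite {a}" by simp
  fix s assume s: "s \<in> {a..b} - {a}"
  then have "at s within {a..b} = at s within {a<..b}"
    by (intro at_within_nhd[of s "{a<..}"]) auto
  then show "continuous (at s within {a..b}) x" using lim[of s] s by (simp add: continuous_within)
next
  fix s assume s: "s \<in> {a<..b}"
  then have "(x \<longlongrightarrow> x s) (at s within {a<..s})"
    by (intro continuous_on_tendsto_subset[OF x(1)]) auto
  then show "\<exists>l. (x \<longlongrightarrow> l) (at_left s)" using at_left_Ioc[of a s] s by auto
next
  fix s assume s: "s \<in> {a..<b}"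
  show "\<exists>l. (x \<longlongrightarrow> l) (at_right s)"
  proof (cases "s = a")
    case False
    then have "(x \<longlongrightarrow> x s) (at s within {s<..b})"
      using s by (intro continuous_on_tendsto_subset[OF x(1)]) auto
    then show ?thesis using at_right_Ioc[of s b] s by auto
  qed (use x in blast)
qed

lemma hist_norm_segment_diff_le:
  assumes "0 < r" "\<And>s. - r \<le> s \<Longrightarrow> s \<le> 0 \<Longrightarrow> norm (x (t + s) - y (t + s)) \<le> d"
  shows "hist_norm r (\<lambda>s. segment r x t s - segment r y t s) \<le> d"
  unfolding hist_norm_def by (rule cSUP_least) (use assms in \<open>auto simp: segment_def\<close>)

text \<open>The limits of the approximating functions form a Cauchy sequence.\<close>

lemma convergent_uniform_limit:
  fixes X :: "nat \<Rightarrow> 'b::metric_space \<Rightarrow> 'a::banach"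
  assumes u: "uniform_limit E X x sequentially" and l: "\<And>n. \<exists>l. (X n \<longlongrightarrow> l) (at a within E)"
    and nt: "at a within E \<noteq> bot"
  shows "\<exists>l. (x \<longlongrightarrow> l) (at a within E)"
proof -
  obtain l where l: "\<And>n. (X n \<longlongrightarrow> l n) (at a within E)" using l by metis
  have "Cauchy l"
    unfolding Cauchy_def
  proof (intro allI impI)
    fix e :: real assume "0 < e"
    then have "uniformly_Cauchy_on E X" "0 < e / 2"
      using u uniformly_convergent_Cauchy unfolding uniformly_convergent_on_def by auto
    then obtain N where N: "\<And>t m n. t \<in> E \<Longrightarrow> m \<ge> N \<Longrightarrow> n \<ge> N \<Longrightarrow> dist (X m t) (X n t) < e / 2"
      unfolding uniformly_Cauchy_on_def by meson
    have "dist (l m) (l n) < e" if "m \<ge> N" "n \<ge> N" for m n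
    proof -
      have "((\<lambda>t. dist (X m t) (X n t)) \<longlongrightarrow> dist (l m) (l n)) (at a within E)"
        by (intro tendsto_intros l)
      moreover have "eventually (\<lambda>t. dist (X m t) (X n t) \<le> e / 2) (at a within E)"
        unfolding eventually_at_filter
        by (intro always_eventually allI impI less_imp_le N that)
      ultimately have "dist (l m) (l n) \<le> e / 2" by (rule tendsto_upperbound) (rule nt)
      then show ?thesis using \<open>0 < e\<close> by simp
    qed
    then show "\<exists>N. \<forall>m\<ge>N. \<forall>n\<ge>N. dist (l m) (l n) < e" by blast
  qed
  then obtain L where "l \<longlonglongrightarrow> L" unfolding Cauchy_convergent_iff convergent_def by blast
  moreover have "eventually (\<lambda>n. (X n \<longlongrightarrow> l n) (at a within E)) sequentially"
    using l by (intro always_eventually allI)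
  ultimately have "(x \<longlongrightarrow> L) (at a within E)"
    by (intro swap_uniform_limit[OF _ _ u]) auto
  then show ?thesis by blast
qed

locale impulse_times =
  fixes K :: nat and tt :: "nat \<Rightarrow> real" and T :: real
  assumes times: "tt 0 = 0" "\<forall>k\<le>K. tt k < tt (Suc k)" "tt (Suc K) = T"
begin

lemma tt_less: "i < j \<Longrightarrow> j \<le> Suc K \<Longrightarrow> tt i < tt j"
proof (induction j)
  case (Suc j)
  then have "tt j < tt (Suc j)" using times(2) by simp
  then show ?case using Suc by (cases "i = j") auto
qed simp

lemma tt_le: "i \<le> j \<Longrightarrow> j \<le> Suc K \<Longrightarrow> tt i \<le> tt j"
  using tt_less[of i j] by (cases "i = j") auto

lemma tt_range: "k \<le> Suc K \<Longrightarrow> 0 \<le> tt k \<and> tt k \<le> T"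
  using tt_le[of 0 k] tt_le[of k "Suc K"] times by simp

lemma T_pos: "0 < T" using tt_less[of 0 "Suc K"] times by simp

text \<open>The left-hand limits in the definition of \<^const>\<open>PC_space\<close> come from continuity on the
  half-open intervals.\<close>

lemma PC_spaceI:
  assumes "continuous_on {tt 0..tt 1} x"
    and "\<And>k. k \<in> {1..K} \<Longrightarrow> continuous_on {tt k<..tt (Suc k)} x"
    and "\<And>k. k \<in> {1..K} \<Longrightarrow> \<exists>l. (x \<longlongrightarrow> l) (at_right (tt k))"
  shows "x \<in> PC_space K tt"
proof -
  have "(x \<longlongrightarrow> x (tt k)) (at_left (tt k))" if k: "k \<in> {1..K}" for k
  proof -
    obtain j where j: "k = Suc j" using k by (cases k) auto
    have "continuous_on {tt j<..tt k} x"
      using assms(1) assms(2)[of j] j k by (cases "j = 0") (auto elim: continuous_on_subset)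
    moreover have "tt j < tt k" using tt_less[of j k] j k by simp
    ultimately show ?thesis
      using continuous_on_tendsto_subset[of "{tt j<..tt k}" x "tt k" "{tt j<..tt k}"]
      by (simp add: at_left_Ioc)
  qed
  then show ?thesis using assms by (simp add: PC_space_def)
qed

lemma PC_spaceD:
  assumes "x \<in> PC_space K tt"
  shows "continuous_on {tt 0..tt 1} x"
    and "k \<in> {1..K} \<Longrightarrow> continuous_on {tt k<..tt (Suc k)} x"
    and "k \<in> {1..K} \<Longrightarrow> \<exists>l. (x \<longlongrightarrow> l) (at_right (tt k))"
    and "k \<in> {1..K} \<Longrightarrow> (x \<longlongrightarrow> x (tt k)) (at_left (tt k))"
  using assms by (auto simp: PC_space_def)

lemma PC_space_add:
  fixes x y :: "real \<Rightarrow> 'a::real_normed_vector"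
  assumes "x \<in> PC_space K tt" "y \<in> PC_space K tt"
  shows "(\<lambda>t. x t + y t) \<in> PC_space K tt"
proof (rule PC_spaceI)
  fix k assume k: "k \<in> {1..K}"
  show "\<exists>l. ((\<lambda>t. x t + y t) \<longlongrightarrow> l) (at_right (tt k))"
    using PC_spaceD(3)[OF assms(1) k] PC_spaceD(3)[OF assms(2) k] tendsto_add by blast
qed (intro continuous_intros PC_spaceD assms; assumption)+

lemma PC_space_continuous:
  fixes x :: "real \<Rightarrow> 'a::topological_space"
  assumes "continuous_on {0..T} x"
  shows "x \<in> PC_space K tt"
proof (rule PC_spaceI)
  show "continuous_on {tt 0..tt 1} x"
    using assms tt_range[of 0] tt_range[of 1] by (auto elim!: continuous_on_subset)
  fix k assume k: "k \<in> {1..K}"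
  show "continuous_on {tt k<..tt (Suc k)} x"
    using assms tt_range[of k] tt_range[of "Suc k"] k by (auto elim!: continuous_on_subset)
  have kr: "0 \<le> tt k" "tt k < T" using tt_range[of k] tt_less[of k "Suc K"] times k by auto
  then have "(x \<longlongrightarrow> x (tt k)) (at (tt k) within {tt k<..T})"
    by (intro continuous_on_tendsto_subset[OF assms]) auto
  then show "\<exists>l. (x \<longlongrightarrow> l) (at_right (tt k))" using at_right_Ioc[of "tt k" T] kr by auto
qed

lemma PC_space_sum:
  fixes x :: "'b \<Rightarrow> real \<Rightarrow> 'a::real_normed_vector"
  assumes "finite F" "\<And>k. k \<in> F \<Longrightarrow> x k \<in> PC_space K tt"
  shows "(\<lambda>t. \<Sum>k\<in>F. x k t) \<in> PC_space K tt"
  using assms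
proof (induction F rule: finite_induct)
  case empty
  then show ?case by (simp add: PC_space_continuous)
next
  case (insert k F)
  then show ?case by (simp add: PC_space_add)
qed

lemma PC_space_compose:
  fixes x :: "real \<Rightarrow> 'a::topological_space" and F :: "real \<times> 'a \<Rightarrow> 'b::topological_space"
  assumes x: "x \<in> PC_space K tt" and F: "continuous_on ({0..} \<times> UNIV) F"
  shows "(\<lambda>t. F (t, x t)) \<in> PC_space K tt"
proof (rule PC_spaceI)
  show "continuous_on {tt 0..tt 1} (\<lambda>t. F (t, x t))"
    by (intro continuous_on_compose2[OF F] continuous_intros PC_spaceD[OF x]) (use times in auto)
  fix k assume k: "k \<in> {1..K}"
  have t0: "0 \<le> tt k" using tt_range[of k] k by simp
  show "continuous_on {tt k<..tt (Suc k)} (\<lambda>t. F (t, x t))"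
    by (intro continuous_on_compose2[OF F] continuous_intros PC_spaceD[OF x] k) (use t0 in auto)
  obtain l where l: "(x \<longlongrightarrow> l) (at_right (tt k))" using PC_spaceD(3)[OF x k] by blast
  have "((\<lambda>t. F (t, x t)) \<longlongrightarrow> F (tt k, l)) (at_right (tt k))"
  proof (rule continuous_on_tendsto_compose[OF F])
    show "((\<lambda>t. (t, x t)) \<longlongrightarrow> (tt k, l)) (at_right (tt k))" by (intro tendsto_intros l)
    show "eventually (\<lambda>t. (t, x t) \<in> {0..} \<times> UNIV) (at_right (tt k))"
      using eventually_at_right_less[of "tt k"] by eventually_elim (use t0 in auto)
  qed (use t0 in auto)
  then show "\<exists>l. ((\<lambda>t. F (t, x t)) \<longlongrightarrow> l) (at_right (tt k))" by blast
qed

lemma PC_space_jump: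
  fixes y :: "real \<Rightarrow> 'a::real_normed_vector"
  assumes k: "k \<in> {1..K}" and y: "continuous_on {0..} y"
  shows "(\<lambda>t. if tt k < t then y (t - tt k) else 0) \<in> PC_space K tt" (is "?x \<in> _")
proof (rule PC_spaceI)
  have "continuous_on {tt 0..tt 1} (\<lambda>_. 0 :: 'a)" by simp
  moreover have "continuous_on {tt 0..tt 1} ?x \<longleftrightarrow> continuous_on {tt 0..tt 1} (\<lambda>_. 0 :: 'a)"
    using tt_le[of 1 k] k by (intro continuous_on_cong) auto
  ultimately show "continuous_on {tt 0..tt 1} ?x" by simp
  fix j assume j: "j \<in> {1..K}"
  have late: "?x t = y (t - tt k)" if "k \<le> j" "tt j < t" for t
    using tt_le[of k j] that j by auto
  have early: "?x t = 0" if "j < k" "t \<le> tt (Suc j)" for t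
    using tt_le[of "Suc j" k] that k by auto
  show "continuous_on {tt j<..tt (Suc j)} ?x"
  proof (cases "k \<le> j")
    case True
    have "continuous_on {tt j<..tt (Suc j)} (\<lambda>t. y (t - tt k))"
      using tt_le[of k j] j True by (intro continuous_on_compose2[OF y] continuous_intros) auto
    moreover have "continuous_on {tt j<..tt (Suc j)} ?x \<longleftrightarrow> continuous_on {tt j<..tt (Suc j)} (\<lambda>t. y (t - tt k))"
      using late[OF True] by (intro continuous_on_cong) auto
    ultimately show ?thesis by simp
  next
    case False
    then have "continuous_on {tt j<..tt (Suc j)} ?x \<longleftrightarrow> continuous_on {tt j<..tt (Suc j)} (\<lambda>_. 0 :: 'a)"
      using early by (intro continuous_on_cong) auto
    then show ?thesis by simp
  qed
  have jr: "tt j < tt (Suc j)" using tt_less[of j "Suc j"] j by simp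
  show "\<exists>l. (?x \<longlongrightarrow> l) (at_right (tt j))"
  proof (cases "k \<le> j")
    case True
    have "((\<lambda>t. y (t - tt k)) \<longlongrightarrow> y (tt j - tt k)) (at_right (tt j))"
    proof (rule continuous_on_tendsto_compose[OF y])
      show "((\<lambda>t. t - tt k) \<longlongrightarrow> tt j - tt k) (at_right (tt j))" by (intro tendsto_intros)
      show "eventually (\<lambda>t. t - tt k \<in> {0..}) (at_right (tt j))"
        using eventually_at_right_less[of "tt j"] by eventually_elim (use tt_le[of k j] j True in auto)
    qed (use tt_le[of k j] j True in auto)
    moreover have "eventually (\<lambda>t. y (t - tt k) = ?x t) (at_right (tt j))"
      using eventually_at_right_less[of "tt j"] by eventually_elim (use late[OF True] in auto)
    ultimately have "(?x \<longlongrightarrow> y (tt j - tt k)) (at_right (tt j))" by (rule Lim_transform_eventually)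
    then show ?thesis by (rule exI)
  next
    case False
    have "eventually (\<lambda>t. 0 = ?x t) (at_right (tt j))"
      using eventually_at_right_real[OF jr] by eventually_elim (use early False in auto)
    then have "(?x \<longlongrightarrow> 0) (at_right (tt j))" by (rule Lim_transform_eventually[OF tendsto_const])
    then show ?thesis by (rule exI)
  qed
qed

lemma PC_space_cong:
  assumes "\<And>t. t \<in> {0..T} \<Longrightarrow> x t = y t" "x \<in> PC_space K tt"
  shows "y \<in> PC_space K tt"
proof (rule PC_spaceI)
  have "continuous_on {tt 0..tt 1} x \<longleftrightarrow> continuous_on {tt 0..tt 1} y"
    using assms(1) tt_range[of 0] tt_range[of 1] by (intro continuous_on_cong) auto
  then show "continuous_on {tt 0..tt 1} y" using PC_spaceD(1)[OF assms(2)] by simp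
  fix k assume k: "k \<in> {1..K}"
  have kr: "0 \<le> tt k" "tt k < T" "tt (Suc k) \<le> T"
    using tt_range[of k] tt_less[of k "Suc K"] tt_range[of "Suc k"] times k by auto
  have "continuous_on {tt k<..tt (Suc k)} x \<longleftrightarrow> continuous_on {tt k<..tt (Suc k)} y"
    using assms(1) kr by (intro continuous_on_cong) auto
  then show "continuous_on {tt k<..tt (Suc k)} y" using PC_spaceD(2)[OF assms(2) k] by simp
  have "eventually (\<lambda>t. x t = y t) (at_right (tt k))"
    using eventually_at_right_real[OF kr(2)] by eventually_elim (use assms(1) kr in auto)
  then show "\<exists>l. (y \<longlongrightarrow> l) (at_right (tt k))"
    using PC_spaceD(3)[OF assms(2) k] Lim_transform_eventually by blast
qed

lemma PC_space_uniform_limit: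
  fixes X :: "nat \<Rightarrow> real \<Rightarrow> 'a::banach"
  assumes X: "\<And>n. X n \<in> PC_space K tt" and u: "uniform_limit {0..T} X x sequentially"
  shows "x \<in> PC_space K tt"
proof (rule PC_spaceI)
  have "{tt 0..tt 1} \<subseteq> {0..T}" using tt_range[of 0] tt_range[of 1] by auto
  then show "continuous_on {tt 0..tt 1} x"
    using uniform_limit_theorem[OF _ uniform_limit_on_subset[OF u]] PC_spaceD(1)[OF X] by auto
  fix k assume k: "k \<in> {1..K}"
  have kr: "0 \<le> tt k" "tt k < T" "tt (Suc k) \<le> T"
    using tt_range[of k] tt_less[of k "Suc K"] tt_range[of "Suc k"] times k by auto
  then have "{tt k<..tt (Suc k)} \<subseteq> {0..T}" by auto
  then show "continuous_on {tt k<..tt (Suc k)} x"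
    using uniform_limit_theorem[OF _ uniform_limit_on_subset[OF u]] PC_spaceD(2)[OF X k] by auto
  have "uniform_limit {tt k<..T} X x sequentially"
    using kr by (intro uniform_limit_on_subset[OF u]) auto
  then show "\<exists>l. (x \<longlongrightarrow> l) (at_right (tt k))"
    using convergent_uniform_limit[where E = "{tt k<..T}" and X = X and a = "tt k"] PC_spaceD(3)[OF X k]
    unfolding at_right_Ioc[OF kr(2)] by simp
qed

lemma PC_space_piecewise_continuous:
  assumes x: "x \<in> PC_space K tt"
  shows "piecewise_continuous 0 T x"
proof -
  have step: "piecewise_continuous (tt k) (tt (Suc k)) x" if "k \<le> K" for k
  proof (cases "k = 0")
    case True
    have "(x \<longlongrightarrow> x (tt 0)) (at (tt 0) within {tt 0<..tt 1})"
      using tt_less[of 0 1] by (intro continuous_on_tendsto_subset[OF PC_spaceD(1)[OF x]]) auto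
    moreover have "continuous_on {tt 0<..tt 1} x"
      by (rule continuous_on_subset[OF PC_spaceD(1)[OF x]]) auto
    ultimately show ?thesis
      using True at_right_Ioc[of "tt 0" "tt 1"] tt_less[of 0 1] by (auto intro: piecewise_continuous_Ioc)
  next
    case False
    then show ?thesis using PC_spaceD(2,3)[OF x, of k] that by (auto intro: piecewise_continuous_Ioc)
  qed
  have "piecewise_continuous 0 (tt (Suc k)) x" if "k \<le> K" for k
    using that
  proof (induction k)
    case 0
    then show ?case using step[of 0] times by simp
  next
    case (Suc k)
    then show ?case
      using piecewise_continuous_split[OF _ step[of "Suc k"], of 0] tt_range[of "Suc k"]
        tt_le[of "Suc k" "Suc (Suc k)"] by simp
  qed
  from this[of K] show ?thesis using times by simp
qed

lemma state_space_piecewise_continuous: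
  fixes x :: "real \<Rightarrow> 'a::real_normed_vector"
  assumes x: "x \<in> state_space r K tt" and r: "0 < r"
  shows "piecewise_continuous (- r) T x"
proof (rule piecewise_continuous_split)
  have "piecewise_continuous (- r) 0 (segment r x 0)" using x by (simp add: state_space_def PC_hist_def)
  then show "piecewise_continuous (- r) 0 x"
    by (rule piecewise_continuous_cong[rotated]) (simp add: segment_def)
  show "piecewise_continuous 0 T x"
    using x by (intro PC_space_piecewise_continuous) (simp add: state_space_def)
qed (use r T_pos in auto)

text \<open>A segment may straddle time \<open>0\<close> and several impulse times; it inherits piecewise continuity from
  the whole trajectory on \<open>[- r, T]\<close>.\<close>

lemma segment_in_PC_hist:
  fixes x :: "real \<Rightarrow> 'a::real_normed_vector"
  assumes x: "x \<in> state_space r K tt" and r: "0 < r" and t: "t \<in> {0..T}"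
  shows "segment r x t \<in> PC_hist r"
proof -
  have "piecewise_continuous (- r + t) (0 + t) x"
    by (rule piecewise_continuous_subset[OF state_space_piecewise_continuous[OF x r]]) (use t in auto)
  then have "piecewise_continuous (- r) 0 (\<lambda>s. x (t + s))" by (rule piecewise_continuous_shift)
  then have "piecewise_continuous (- r) 0 (segment r x t)"
    by (rule piecewise_continuous_cong[rotated]) (simp add: segment_def)
  then show ?thesis by (simp add: PC_hist_def segment_def)
qed

lemma state_space_bounded:
  fixes x :: "real \<Rightarrow> 'a::real_normed_vector"
  assumes x: "x \<in> state_space r K tt" 
  obtains b where "\<And>t. t \<in> {0..T} \<Longrightarrow> norm (x t) \<le> b"
proof -
  have "bdd_above ((\<lambda>s. norm (x s)) ` {0..T})"
    using x by (intro piecewise_continuous_bdd_above PC_space_piecewise_continuous) (simp add: state_space_def)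
  then obtain b where "\<forall>s\<in>{0..T}. norm (x s) \<le> b" unfolding bdd_above_def by auto
  then show ?thesis using that by blast
qed

end

section \<open>Existence and causality of mild solutions\<close>

lemma piecewise_continuous_compose:
  fixes h :: "'a::topological_space \<Rightarrow> 'b::topological_space"
  assumes "continuous_on UNIV h" "piecewise_continuous a b x"
  shows "piecewise_continuous a b (\<lambda>t. h (x t))"
proof -
  have h: "((\<lambda>t. h (x t)) \<longlongrightarrow> h l) F" if "(x \<longlongrightarrow> l) F" for l F
    by (rule continuous_on_tendsto_compose[OF assms(1) that]) auto
  show ?thesis
    using assms(2) h unfolding piecewise_continuous_def continuous_within by meson
qed

lemma L2_controls_integrable:
  assumes "u \<in> L2_controls T"
  shows "set_integrable lebesgue {0..T} u"
proof (rule set_integrable_bound)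
  show "set_integrable lebesgue {0..T} (\<lambda>t. 1 + (norm (u t))\<^sup>2)"
    using assms set_integrable_const_interval by (intro set_integral_add(1)) (auto simp: L2_controls_def)
  show "set_borel_measurable lebesgue {0..T} u" using assms by (simp add: L2_controls_def)
  have "a \<le> 1 + a\<^sup>2" for a :: real
    using zero_le_power2[of "a - 1 / 2"] by (simp add: power2_eq_square algebra_simps)
  then show "AE t in lebesgue. t \<in> {0..T} \<longrightarrow> norm (u t) \<le> norm (1 + (norm (u t))\<^sup>2)"
    by (intro AE_I2) auto
qed

locale delay_system =
  strongly_continuous_family S M + impulse_times K tt T
  for S :: "real \<Rightarrow> 'x::{complex_banach, second_countable_topology} \<Rightarrow> 'x" and M
    and K :: nat and tt :: "nat \<Rightarrow> real" and T :: real +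
  fixes r p l2 lg :: real
    and f :: "real \<Rightarrow> 'x \<Rightarrow> (real \<Rightarrow> 'x) \<Rightarrow> 'x" and I :: "nat \<Rightarrow> 'x \<Rightarrow> 'x"
    and g :: "(real \<Rightarrow> 'x) \<Rightarrow> real \<Rightarrow> 'x" and g0 :: "'x \<Rightarrow> 'x" and \<phi> :: "real \<Rightarrow> 'x"
    and L1 L2 M1 :: "real \<Rightarrow> real"
  assumes r: "0 < r" and p: "0 < p" "p < 1"
    and phi: "\<phi> \<in> PC_hist r"
    and Lp: "L1 \<in> Lp_nonneg (1 / p) T" "L2 \<in> Lp_nonneg (1 / p) T" "M1 \<in> Lp_nonneg (1 / p) T"
    and l: "0 < l2" "0 < lg"
    and f_measurable: "\<And>x. x \<in> state_space r K tt \<Longrightarrow>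
      set_borel_measurable lebesgue {0..T} (\<lambda>s. f s (x s) (segment r x s))"
    and f_bound: "\<And>t x \<psi>. t \<in> {0..T} \<Longrightarrow> \<psi> \<in> PC_hist r \<Longrightarrow> norm (f t x \<psi>) \<le> M1 t"
    and f_Lipschitz: "\<And>t x y \<psi> \<kappa>. t \<in> {0..T} \<Longrightarrow> \<psi> \<in> PC_hist r \<Longrightarrow> \<kappa> \<in> PC_hist r \<Longrightarrow>
      norm (f t x \<psi> - f t y \<kappa>) \<le> L1 t * norm (x - y) + L2 t * hist_norm r (\<lambda>s. \<psi> s - \<kappa> s)"
    and I_Lipschitz: "\<And>k x y. k \<in> {1..K} \<Longrightarrow> norm (I k x - I k y) \<le> l2 * norm (x - y)"
    and g_Lipschitz: "\<And>\<psi> \<kappa> s. \<psi> \<in> PC_hist r \<Longrightarrow> \<kappa> \<in> PC_hist r \<Longrightarrow> s \<in> {- r..0} \<Longrightarrow>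
      norm (g \<psi> s - g \<kappa> s) \<le> lg * hist_norm r (\<lambda>s. \<psi> s - \<kappa> s)"
    and g_pointwise: "\<And>x t s. x \<in> state_space r K tt \<Longrightarrow> t \<in> {0..T} \<Longrightarrow> s \<in> {- r..0} \<Longrightarrow>
      g (segment r x t) s = g0 (x (t + s))"
    and contraction:
      "M * (real K * l2 + lg + T powr (1 - p) * (Lp_norm (1 / p) T L1 + Lp_norm (1 / p) T L2)) < 1"
begin

definition "c = M * (real K * l2 + lg + T powr (1 - p) * (Lp_norm (1 / p) T L1 + Lp_norm (1 / p) T L2))"

lemma c_less_1: "c < 1" using contraction by (simp add: c_def)

lemma Lp_norm_nonneg: "0 \<le> Lp_norm q T h" by (simp add: Lp_norm_def)

lemma M_lg_less_1: "M * lg < 1"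
proof -
  have "0 \<le> M * (real K * l2 + T powr (1 - p) * (Lp_norm (1 / p) T L1 + Lp_norm (1 / p) T L2))"
    using M_pos l by (intro mult_nonneg_nonneg add_nonneg_nonneg Lp_norm_nonneg) auto
  then show ?thesis using c_less_1 by (simp add: c_def algebra_simps)
qed

lemma c_nonneg: "0 \<le> c"
  unfolding c_def using M_pos l by (intro mult_nonneg_nonneg add_nonneg_nonneg Lp_norm_nonneg) auto

lemma g0_Lipschitz: "norm (g0 v - g0 w) \<le> lg * norm (v - w)"
proof -
  have const: "(\<lambda>_. u) \<in> state_space r K tt" for u :: 'x
  proof -
    have "piecewise_continuous (- r) 0 (\<lambda>_. u)" by (auto simp: piecewise_continuous_def)
    then have "piecewise_continuous (- r) 0 (segment r (\<lambda>_. u) 0)"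
      by (rule piecewise_continuous_cong[rotated]) (simp add: segment_def)
    then have "segment r (\<lambda>_. u) 0 \<in> PC_hist r" by (simp add: PC_hist_def segment_def)
    then show ?thesis by (simp add: state_space_def PC_space_continuous)
  qed
  have T: "0 \<in> {0..T}" using T_pos by simp
  have "norm (g (segment r (\<lambda>_. v) 0) 0 - g (segment r (\<lambda>_. w) 0) 0)
      \<le> lg * hist_norm r (\<lambda>s. segment r (\<lambda>_. v) 0 s - segment r (\<lambda>_. w) 0 s)"
    using r by (intro g_Lipschitz segment_in_PC_hist const T) auto
  also have "\<dots> \<le> lg * norm (v - w)"
    using l r by (intro mult_left_mono hist_norm_segment_diff_le) auto
  finally show ?thesis using g_pointwise[OF const T, of 0] r by simp
qed

lemma g0_Lipschitz': "norm (g0 v - g0 w) \<le> (M * lg) * norm (v - w)"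
proof -
  have "norm (g0 v - g0 w) \<le> lg * norm (v - w)" by (rule g0_Lipschitz)
  also have "\<dots> \<le> lg * (M * norm (v - w))" using l by (intro mult_left_mono norm_le_M) auto
  finally show ?thesis by (simp add: mult_ac)
qed

lemma continuous_on_g0: "continuous_on UNIV g0"
  unfolding continuous_on_def
proof
  fix v :: 'x
  have "((\<lambda>w. lg * norm (w - v)) \<longlongrightarrow> lg * norm (v - v)) (at v within UNIV)" by (intro tendsto_intros)
  then have "((\<lambda>w. g0 w - g0 v) \<longlongrightarrow> 0) (at v within UNIV)"
    by (intro Lim_null_comparison[of "\<lambda>w. g0 w - g0 v" "\<lambda>w. lg * norm (w - v)"] always_eventually allI g0_Lipschitz) auto
  then show "(g0 \<longlongrightarrow> g0 v) (at v within UNIV)" by (simp add: LIM_zero_iff)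
qed

text \<open>For given \<open>v\<close> the map \<open>q \<mapsto> v - g0 q\<close> is a contraction, and its fixed point depends continuously on
  \<open>v\<close>.  Applied to the values of \<open>\<phi>\<close>, this solves the nonlocal history condition pointwise.\<close>

lemma history_solution:
  obtains Q where "continuous_on UNIV Q" "\<And>v. Q v = v - g0 (Q v)"
proof -
  have "\<exists>q. q = v - g0 q" for v
  proof -
    have "\<exists>!q. v - g0 q = q"
    proof (rule banach_fix_type)
      show "0 \<le> M * lg" "M * lg < 1" using M_pos l M_lg_less_1 by auto
      show "\<forall>x y. dist (v - g0 x) (v - g0 y) \<le> (M * lg) * dist x y"
      proof (intro allI)
        fix x y
        have "dist (v - g0 x) (v - g0 y) = norm (g0 x - g0 y)"
          using norm_minus_commute[of "g0 x" "g0 y"] by (simp add: dist_norm)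
        then show "dist (v - g0 x) (v - g0 y) \<le> (M * lg) * dist x y"
          using g0_Lipschitz'[of x y] by (simp add: dist_norm)
      qed
    qed
    then show ?thesis by metis
  qed
  then obtain Q where Q: "\<And>v. Q v = v - g0 (Q v)" by metis
  have lip: "norm (Q v - Q w) \<le> norm (v - w) / (1 - M * lg)" for v w
  proof -
    have "Q v - Q w = (v - w) - (g0 (Q v) - g0 (Q w))" by (subst (1 2) Q) simp
    then have "norm (Q v - Q w) \<le> norm (v - w) + norm (g0 (Q v) - g0 (Q w))" by (metis norm_triangle_ineq4)
    also have "\<dots> \<le> norm (v - w) + (M * lg) * norm (Q v - Q w)" using g0_Lipschitz' by simp
    finally show ?thesis using M_lg_less_1 by (simp add: field_simps)
  qed
  have "continuous_on UNIV Q"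
    unfolding continuous_on_def
  proof
    fix v :: 'x
    have "((\<lambda>w. norm (w - v) / (1 - M * lg)) \<longlongrightarrow> norm (v - v) / (1 - M * lg)) (at v within UNIV)"
      using M_lg_less_1 by (intro tendsto_intros) auto
    then have "((\<lambda>w. Q w - Q v) \<longlongrightarrow> 0) (at v within UNIV)"
      by (intro Lim_null_comparison[of "\<lambda>w. Q w - Q v" "\<lambda>w. norm (w - v) / (1 - M * lg)"] always_eventually allI lip) auto
    then show "(Q \<longlongrightarrow> Q v) (at v within UNIV)" by (simp add: LIM_zero_iff)
  qed
  then show ?thesis using Q that by blast
qed

definition nonlin :: "(real \<Rightarrow> 'x) \<Rightarrow> real \<Rightarrow> 'x"
  where "nonlin x s = f s (x s) (segment r x s)"

lemma nonlin_bound: "x \<in> state_space r K tt \<Longrightarrow> s \<in> {0..T} \<Longrightarrow> norm (nonlin x s) \<le> M1 s"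
  unfolding nonlin_def by (intro f_bound segment_in_PC_hist r)

lemma M1_integrable: "set_integrable lebesgue {0..T} M1"
  by (rule set_integrable_Lp[OF p T_pos Lp(3)])

lemma nonlin_integrable:
  assumes x: "x \<in> state_space r K tt"
  shows "set_integrable lebesgue {0..T} (nonlin x)"
proof (rule set_integrable_bound[OF M1_integrable])
  show "set_borel_measurable lebesgue {0..T} (nonlin x)"
    using f_measurable[OF x] by (simp add: nonlin_def[abs_def])
  show "AE s in lebesgue. s \<in> {0..T} \<longrightarrow> norm (nonlin x s) \<le> norm (M1 s)"
    using nonlin_bound[OF x] by (intro AE_I2) (auto intro: order_trans[OF _ abs_ge_self])
qed

definition impulses :: "(real \<Rightarrow> 'x) \<Rightarrow> real \<Rightarrow> 'x"
  where "impulses x t = (\<Sum>k\<in>{1..K}. if tt k < t then S (t - tt k) (I k (x (tt k))) else 0)"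

text \<open>The right-hand side of the integral equation, with an integrable function \<open>w\<close> in place of
  the control term.\<close>

definition rhs :: "(real \<Rightarrow> 'x) \<Rightarrow> (real \<Rightarrow> 'x) \<Rightarrow> real \<Rightarrow> 'x"
  where "rhs w x t = S t (\<phi> 0 - g0 (x t))
    + impulses x t
    + conv w t + conv (nonlin x) t"

lemma conv_0: "conv w 0 = 0"
proof -
  have "AE s in lebesgue. s \<noteq> (0::real)" by (intro AE_completion AE_lborel_singleton)
  then have "AE s in lebesgue. indicat_real {0..0} s *\<^sub>R S (0 - s) (w s) = 0"
    by eventually_elim (simp add: indicator_def)
  then show ?thesis
    unfolding conv_def set_lebesgue_integral_def by (rule integral_eq_zero_AE)
qed

lemma rhs_0: "rhs w x 0 = \<phi> 0 - g0 (x 0)"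
proof -
  have "\<not> tt k < 0" if "k \<in> {1..K}" for k using tt_range[of k] that by auto
  then show ?thesis by (simp add: rhs_def impulses_def S_zero conv_0)
qed

lemma rhs_in_PC_space:
  assumes x: "x \<in> state_space r K tt" and w: "set_integrable lebesgue {0..T} w"
  shows "rhs w x \<in> PC_space K tt"
proof -
  have xPC: "x \<in> PC_space K tt" using x by (simp add: state_space_def)
  have "continuous_on ({0..} \<times> UNIV) (\<lambda>z. S (fst z) (\<phi> 0 - g0 (snd z)))"
    by (intro continuous_on_S continuous_intros continuous_on_compose2[OF continuous_on_g0]) auto
  from PC_space_compose[OF xPC this]
  have 1: "(\<lambda>t. S t (\<phi> 0 - g0 (x t))) \<in> PC_space K tt" by simp
  have 2: "impulses x \<in> PC_space K tt"
    unfolding impulses_def[abs_def]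
    by (intro PC_space_sum PC_space_jump continuous_on_S continuous_intros) auto
  have 3: "conv w \<in> PC_space K tt" "conv (nonlin x) \<in> PC_space K tt"
    by (intro PC_space_continuous continuous_on_conv w nonlin_integrable x)+
  show ?thesis
    unfolding rhs_def[abs_def] by (intro PC_space_add 1 2 3)
qed

text \<open>Each term contributes its summand of \<open>c\<close>; for the nonlinear integral this is Hoelder's inequality.
  Only the past of \<open>t\<close> matters, which is what makes solutions causal.\<close>

lemma rhs_contraction:
  assumes x: "x \<in> state_space r K tt" and y: "y \<in> state_space r K tt"
    and w: "set_integrable lebesgue {0..T} w" "set_integrable lebesgue {0..T} w'"
    and t: "0 \<le> t" "t \<le> T"
    and hist: "\<And>s. - r \<le> s \<Longrightarrow> s < 0 \<Longrightarrow> x s = y s"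
    and d: "\<And>s. 0 \<le> s \<Longrightarrow> s \<le> t \<Longrightarrow> norm (x s - y s) \<le> d"
    and ww: "\<And>s. 0 \<le> s \<Longrightarrow> s \<le> t \<Longrightarrow> w s = w' s"
  shows "norm (rhs w x t - rhs w' y t) \<le> c * d"
proof -
  have d0: "0 \<le> d" using d[of t] t norm_ge_zero order_trans by blast
  have Li: "set_integrable lebesgue {0..T} L1" "set_integrable lebesgue {0..T} L2"
    by (rule set_integrable_Lp[OF p T_pos] Lp)+
  have Lnn: "0 \<le> L1 s" "0 \<le> L2 s" if "s \<in> {0..T}" for s using Lp that by (auto simp: Lp_nonneg_def)
  have 1: "norm (S t (\<phi> 0 - g0 (x t)) - S t (\<phi> 0 - g0 (y t))) \<le> M * (lg * d)"
  proof -
    have "norm (S t (\<phi> 0 - g0 (x t)) - S t (\<phi> 0 - g0 (y t))) = norm (S t (g0 (y t) - g0 (x t)))"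
      using t by (simp flip: S_diff)
    also have "\<dots> \<le> M * norm (g0 (y t) - g0 (x t))" using t by (intro S_bound)
    also have "\<dots> \<le> M * (lg * norm (x t - y t))"
      using M_pos g0_Lipschitz[of "y t" "x t"] by (simp add: norm_minus_commute)
    also have "\<dots> \<le> M * (lg * d)" using M_pos l t d[of t] by simp
    finally show ?thesis .
  qed
  have 2: "norm (impulses x t - impulses y t) \<le> M * (real K * l2 * d)"
  proof -
    have "norm (\<Sum>k\<in>{1..K}. (if tt k < t then S (t - tt k) (I k (x (tt k))) else 0)
        - (if tt k < t then S (t - tt k) (I k (y (tt k))) else 0)) \<le> (\<Sum>k\<in>{1..K}. M * (l2 * d))"
    proof (rule sum_norm_le)
      fix k assume k: "k \<in> {1..K}"
      show "norm ((if tt k < t then S (t - tt k) (I k (x (tt k))) else 0)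
        - (if tt k < t then S (t - tt k) (I k (y (tt k))) else 0)) \<le> M * (l2 * d)"
      proof (cases "tt k < t")
        case True
        have "norm (S (t - tt k) (I k (x (tt k)) - I k (y (tt k)))) \<le> M * norm (I k (x (tt k)) - I k (y (tt k)))"
          using True by (intro S_bound) simp
        also have "\<dots> \<le> M * (l2 * norm (x (tt k) - y (tt k)))"
          using M_pos I_Lipschitz[OF k] by simp
        also have "\<dots> \<le> M * (l2 * d)" using M_pos l d[of "tt k"] True tt_range[of k] k by simp
        finally show ?thesis using True by (simp add: S_diff)
      qed (use M_pos l d0 in simp)
    qed
    then show ?thesis by (simp add: impulses_def sum_subtractf mult_ac)
  qed
  have 3: "conv w t = conv w' t"
    unfolding conv_def by (rule set_lebesgue_integral_cong) (use ww in auto)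
  have 4: "norm (conv (nonlin x) t - conv (nonlin y) t)
      \<le> M * (T powr (1 - p) * (Lp_norm (1 / p) T L1 + Lp_norm (1 / p) T L2) * d)"
  proof -
    have "norm (nonlin x s - nonlin y s) \<le> (L1 s + L2 s) * d" if s: "0 \<le> s" "s \<le> t" for s
    proof -
      have sT: "s \<in> {0..T}" using s t by simp
      have "norm (nonlin x s - nonlin y s)
          \<le> L1 s * norm (x s - y s) + L2 s * hist_norm r (\<lambda>u. segment r x s u - segment r y s u)"
        unfolding nonlin_def by (intro f_Lipschitz segment_in_PC_hist r sT x y)
      also have "\<dots> \<le> L1 s * d + L2 s * d"
      proof (intro add_mono mult_left_mono Lnn[OF sT])
        show "norm (x s - y s) \<le> d" by (rule d[OF s])
        show "hist_norm r (\<lambda>u. segment r x s u - segment r y s u) \<le> d"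
        proof (rule hist_norm_segment_diff_le[OF r])
        fix u assume "- r \<le> u" "u \<le> 0"
        then show "norm (x (s + u) - y (s + u)) \<le> d"
          using hist[of "s + u"] d[of "s + u"] d0 s by (cases "s + u < 0") auto
        qed
      qed
      finally show ?thesis by (simp add: distrib_right)
    qed
    then have "norm (conv (nonlin x) t - conv (nonlin y) t) \<le> M * (LINT s:{0..T}|lebesgue. (L1 s + L2 s) * d)"
      using Li Lnn d0 by (intro norm_conv_diff_le nonlin_integrable x y t) auto
    also have "(LINT s:{0..T}|lebesgue. (L1 s + L2 s) * d)
        = ((LINT s:{0..T}|lebesgue. L1 s) + (LINT s:{0..T}|lebesgue. L2 s)) * d"
      using Li by simp
    also have "M * \<dots> \<le> M * ((T powr (1 - p) * Lp_norm (1 / p) T L1 + T powr (1 - p) * Lp_norm (1 / p) T L2) * d)"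
      using M_pos d0 set_integral_Holder[OF p T_pos Lp(1)] set_integral_Holder[OF p T_pos Lp(2)]
      by (intro mult_left_mono mult_right_mono add_mono) auto
    finally show ?thesis by (simp add: distrib_left)
  qed
  have "norm (rhs w x t - rhs w' y t) \<le>
      norm (S t (\<phi> 0 - g0 (x t)) - S t (\<phi> 0 - g0 (y t)))
      + norm (impulses x t
      - impulses y t)
      + norm (conv (nonlin x) t - conv (nonlin y) t)"
    unfolding rhs_def 3
    by (rule order_trans[OF _ norm_triangle_mono[OF norm_triangle_ineq order_refl]]) (simp add: algebra_simps)
  also have "\<dots> \<le> M * (lg * d) + M * (real K * l2 * d)
      + M * (T powr (1 - p) * (Lp_norm (1 / p) T L1 + Lp_norm (1 / p) T L2) * d)"
    by (intro add_mono 1 2 4)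
  also have "\<dots> = c * d" by (simp add: c_def algebra_simps)
  finally show ?thesis .
qed

definition solves :: "(real \<Rightarrow> 'x) \<Rightarrow> (real \<Rightarrow> 'x) \<Rightarrow> bool"
  where "solves w x \<longleftrightarrow> x \<in> state_space r K tt \<and> (\<forall>s\<in>{- r..0}. x s = \<phi> s - g0 (x s)) \<and>
    (\<forall>t\<in>{0..T}. x t = rhs w x t)"

text \<open>Picard iteration, started from a function that satisfies the history condition.  The
  iterates agree with the solved history up to time \<open>0\<close>, where the integral equation reduces to the
  history condition.\<close>

lemma solution_exists:
  assumes w: "set_integrable lebesgue {0..T} w"
  shows "\<exists>x. solves w x"
proof -
  obtain Q where Q: "continuous_on UNIV Q" "\<And>v. Q v = v - g0 (Q v)" using history_solution by blast
  \<comment> \<open>the two branches agree at \<open>t = 0\<close> when \<open>x 0 = Q (\<phi> 0)\<close>, so no jump arises there\<close>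
  define G where "G = (\<lambda>x t. if t \<le> 0 then Q (\<phi> t) else rhs w x t)"
  define x0 where "x0 = (\<lambda>t. if t \<le> 0 then Q (\<phi> t) else Q (\<phi> 0))"
  have "piecewise_continuous (- r) 0 \<phi>" using phi by (simp add: PC_hist_def)
  then have pcQ: "piecewise_continuous (- r) 0 (\<lambda>t. Q (\<phi> t))" by (rule piecewise_continuous_compose[OF Q(1)])
  have state: "x \<in> state_space r K tt" if "x \<in> PC_space K tt" "\<And>t. t \<le> 0 \<Longrightarrow> x t = Q (\<phi> t)" for x
  proof -
    have "piecewise_continuous (- r) 0 (segment r x 0)"
      by (rule piecewise_continuous_cong[OF _ pcQ]) (simp add: segment_def that)
    then show ?thesis using that by (simp add: state_space_def PC_hist_def segment_def)
  qed
  have x0: "x0 \<in> state_space r K tt"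
  proof (rule state)
    have "(\<lambda>_. Q (\<phi> 0)) \<in> PC_space K tt" by (intro PC_space_continuous) simp
    then show "x0 \<in> PC_space K tt" by (rule PC_space_cong[rotated]) (auto simp: x0_def dest: order.antisym)
  qed (simp add: x0_def)
  have G_rhs: "G x t = rhs w x t" if "x 0 = Q (\<phi> 0)" "t \<in> {0..T}" for x t
    using that Q(2)[of "\<phi> 0"] rhs_0[of w x] by (cases "t = 0") (auto simp: G_def)
  have G_state: "G x \<in> state_space r K tt" if "x \<in> state_space r K tt" "x 0 = Q (\<phi> 0)" for x
  proof (rule state)
    show "G x \<in> PC_space K tt"
      by (rule PC_space_cong[OF _ rhs_in_PC_space[OF that(1) w]]) (simp add: G_rhs that)
  qed (simp add: G_def)
  define X where "X = (\<lambda>n. (G ^^ n) x0)"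
  have X_Suc: "X (Suc n) = G (X n)" for n by (simp add: X_def)
  have hist: "X n t = Q (\<phi> t)" if "t \<le> 0" for n t
    using that by (cases n) (simp_all add: X_def x0_def G_def)
  have X_state: "X n \<in> state_space r K tt" for n
  proof (induction n)
    case 0
    then show ?case by (simp add: X_def x0)
  next
    case (Suc n)
    then show ?case unfolding X_Suc by (rule G_state) (simp add: hist)
  qed
  have X_rhs: "X (Suc n) t = rhs w (X n) t" if "t \<in> {0..T}" for n t
    unfolding X_Suc using that by (intro G_rhs) (simp_all add: hist)
  obtain b0 where b0: "\<And>t. t \<in> {0..T} \<Longrightarrow> norm (X 0 t) \<le> b0" using state_space_bounded[OF X_state] by blast
  obtain b1 where b1: "\<And>t. t \<in> {0..T} \<Longrightarrow> norm (X 1 t) \<le> b1" using state_space_bounded[OF X_state] by blast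
  have step: "norm (X (Suc n) t - X n t) \<le> (b0 + b1) * c ^ n" if "t \<in> {0..T}" for n t
    using that
  proof (induction n arbitrary: t)
    case 0
    then show ?case using b1[OF 0] b0[OF 0] norm_triangle_ineq4[of "X 1 t" "X 0 t"] by simp
  next
    case (Suc n)
    have "norm (rhs w (X (Suc n)) t - rhs w (X n) t) \<le> c * ((b0 + b1) * c ^ n)"
      using Suc by (intro rhs_contraction X_state w) (auto simp: hist)
    then show ?case using X_rhs Suc.prems by (simp add: mult_ac)
  qed
  define y where "y = (\<lambda>t. X 0 t + (\<Sum>i. X (Suc i) t - X i t))"
  have "uniform_limit {0..T} (\<lambda>n t. \<Sum>i<n. X (Suc i) t - X i t) (\<lambda>t. \<Sum>i. X (Suc i) t - X i t) sequentially"
    using step c_nonneg c_less_1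
    by (intro Weierstrass_m_test[where M = "\<lambda>n. (b0 + b1) * c ^ n"] summable_mult summable_geometric) auto
  then have "uniform_limit {0..T} (\<lambda>n t. X 0 t + (\<Sum>i<n. X (Suc i) t - X i t)) y sequentially"
    unfolding y_def by (intro uniform_limit_intros)
  moreover have "X 0 t + (\<Sum>i<n. X (Suc i) t - X i t) = X n t" for n t
    using sum_lessThan_telescope[of "\<lambda>i. X i t" n] by simp
  ultimately have lim: "uniform_limit {0..T} X y sequentially" by simp
  define x where "x = (\<lambda>t. if t \<le> 0 then Q (\<phi> t) else y t)"
  have y0: "y 0 = Q (\<phi> 0)" by (simp add: y_def hist)
  have xy: "x t = y t" if "t \<in> {0..T}" for t using that y0 by (auto simp: x_def)
  have x_state: "x \<in> state_space r K tt"
  proof (rule state)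
    have "y \<in> PC_space K tt"
      using X_state by (intro PC_space_uniform_limit[OF _ lim]) (simp add: state_space_def)
    then show "x \<in> PC_space K tt" by (rule PC_space_cong[rotated]) (simp add: xy)
  qed (simp add: x_def)
  have "x t = rhs w x t" if t: "t \<in> {0..T}" for t
  proof -
    have "norm (x t - rhs w x t) \<le> 0"
    proof (rule field_le_epsilon)
      fix e :: real assume "0 < e"
      then have "eventually (\<lambda>n. \<forall>s\<in>{0..T}. dist (X n s) (y s) < e / 2) sequentially"
        using uniform_limitD[OF lim, of "e / 2"] by simp
      then obtain N where "\<forall>n\<ge>N. \<forall>s\<in>{0..T}. dist (X n s) (y s) < e / 2"
        unfolding eventually_sequentially by blast
      then have N: "norm (X n s - x s) < e / 2" if "n \<ge> N" "s \<in> {0..T}" for n s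
        using that by (simp only: dist_norm xy)
      have "norm (rhs w (X N) t - rhs w x t) \<le> c * (e / 2)"
      proof (rule rhs_contraction[OF X_state x_state w w])
        show "X N s = x s" if "s < 0" for s using that by (simp add: hist x_def)
        show "norm (X N s - x s) \<le> e / 2" if "0 \<le> s" "s \<le> t" for s
          using N[of N s] that t by (intro less_imp_le) simp
      qed (use t in auto)
      also have "\<dots> \<le> 1 * (e / 2)" using c_less_1 \<open>0 < e\<close> by (intro mult_right_mono) auto
      finally have "norm (X (Suc N) t - rhs w x t) \<le> e / 2" using X_rhs[OF t] by simp
      moreover have "norm (X (Suc N) t - x t) < e / 2" using N[of "Suc N" t] t by simp
      moreover have "norm (x t - rhs w x t) \<le> norm (X (Suc N) t - rhs w x t) + norm (X (Suc N) t - x t)"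
        using norm_triangle_ineq4[of "X (Suc N) t - rhs w x t" "X (Suc N) t - x t"] by simp
      ultimately show "norm (x t - rhs w x t) \<le> 0 + e" by simp
    qed
    then show ?thesis by simp
  qed
  moreover have "x s = \<phi> s - g0 (x s)" if "s \<in> {- r..0}" for s
    using that Q(2)[of "\<phi> s"] by (simp add: x_def)
  ultimately have "solves w x" using x_state by (simp add: solves_def)
  then show ?thesis by blast
qed

text \<open>On \<open>[0, t0]\<close> the two solutions solve the same equation, so a bound \<open>b\<close> on their distance there
  improves to \<open>c\<^sup>n b\<close> for every \<open>n\<close>.\<close>

lemma solution_causal:
  assumes x: "solves w x" and y: "solves w' y"
    and w: "set_integrable lebesgue {0..T} w" "set_integrable lebesgue {0..T} w'"
    and t0: "0 \<le> t0" "t0 \<le> T" and ww: "\<And>s. 0 \<le> s \<Longrightarrow> s \<le> t0 \<Longrightarrow> w s = w' s"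
    and t: "- r \<le> t" "t \<le> t0"
  shows "x t = y t"
proof -
  have xs: "x \<in> state_space r K tt" and ys: "y \<in> state_space r K tt" using x y by (auto simp: solves_def)
  have hist: "x s = y s" if "s \<in> {- r..0}" for s
  proof -
    have eqs: "x s = \<phi> s - g0 (x s)" "y s = \<phi> s - g0 (y s)" using x y that by (auto simp: solves_def)
    have "norm (x s - y s) = norm (g0 (x s) - g0 (y s))"
      by (subst eqs(1), subst eqs(2)) (simp add: norm_minus_commute)
    also have "\<dots> \<le> (M * lg) * norm (x s - y s)" by (rule g0_Lipschitz')
    finally have "(1 - M * lg) * norm (x s - y s) \<le> 0" by (simp add: algebra_simps)
    then show ?thesis using M_lg_less_1 by (simp add: mult_le_0_iff)
  qed
  obtain b0 where b0: "\<And>t. t \<in> {0..T} \<Longrightarrow> norm (x t) \<le> b0" using state_space_bounded[OF xs] by blast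
  obtain b1 where b1: "\<And>t. t \<in> {0..T} \<Longrightarrow> norm (y t) \<le> b1" using state_space_bounded[OF ys] by blast
  have le: "norm (x s - y s) \<le> (b0 + b1) * c ^ n" if "0 \<le> s" "s \<le> t0" for n s
    using that
  proof (induction n arbitrary: s)
    case 0
    then show ?case
      using b0[of s] b1[of s] norm_triangle_ineq4[of "x s" "y s"] t0 by simp
  next
    case (Suc n)
    have "norm (rhs w x s - rhs w' y s) \<le> c * ((b0 + b1) * c ^ n)"
      using Suc t0 ww hist by (intro rhs_contraction xs ys w) auto
    moreover have "x s = rhs w x s" "y s = rhs w' y s" using x y Suc.prems t0 by (auto simp: solves_def)
    ultimately show ?case by (simp add: mult_ac)
  qed
  show ?thesis
  proof (cases "t \<le> 0")
    case True
    then show ?thesis using hist t by simp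
  next
    case False
    have "(\<lambda>n. (b0 + b1) * c ^ n) \<longlonglongrightarrow> (b0 + b1) * 0"
      using c_nonneg c_less_1 by (intro tendsto_intros LIMSEQ_power_zero) auto
    then have "norm (x t - y t) \<le> (b0 + b1) * 0"
      by (rule tendsto_lowerbound) (use le False t in auto)
    then show ?thesis by simp
  qed
qed

lemma solves_imp_mild_solution:
  fixes B :: "'u::{complex_hilbert, second_countable_topology} \<Rightarrow> 'x"
  assumes x: "solves (\<lambda>s. B (u s)) x" and w: "set_integrable lebesgue {0..T} (\<lambda>s. B (u s))"
  shows "mild_solution r T K tt S B f I g \<phi> u x"
proof -
  have xs: "x \<in> state_space r K tt" using x by (simp add: solves_def)
  have g: "g (segment r x t) s = g0 (x (t + s))" if "t \<in> {0..T}" "s \<in> {- r..0}" for t s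
    by (rule g_pointwise[OF xs that])
  have Lim: "Lim (at_left (tt k)) x = x (tt k)" if "k \<in> {1..K}" for k
    using xs that by (intro tendsto_Lim) (auto simp: state_space_def PC_space_def)
  have sum: "(\<Sum>k | k \<in> {1..K} \<and> tt k < t. S (t - tt k) (I k (Lim (at_left (tt k)) x)))
      = impulses x t" for t
  proof -
    have "(\<Sum>k | k \<in> {1..K} \<and> tt k < t. S (t - tt k) (I k (Lim (at_left (tt k)) x)))
      = (\<Sum>k\<in>{1..K}. if tt k < t then S (t - tt k) (I k (Lim (at_left (tt k)) x)) else 0)"
      by (rule sum.inter_filter) simp
    also have "\<dots> = impulses x t"
      unfolding impulses_def by (rule sum.cong) (simp_all add: Lim)
    finally show ?thesis .
  qed
  have "0 \<in> {- r..0}" using r by simp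
  then show ?thesis
    using x xs g[of 0] g[of _ 0] T_pos conv_integrable[OF w] conv_integrable[OF nonlin_integrable[OF xs]]
    unfolding mild_solution_def sum
    by (simp add: solves_def rhs_def conv_def nonlin_def)
qed

lemma M1_nonneg: "s \<in> {0..T} \<Longrightarrow> 0 \<le> M1 s"
  using Lp(3) by (simp add: Lp_nonneg_def)

text \<open>A bound for the distance of two values of the nonlinearity along trajectories that agree up to
  time \<open>T - \<eta>\<close>.\<close>

definition tail :: "real \<Rightarrow> real \<Rightarrow> real"
  where "tail \<eta> s = 2 * (if T - \<eta> < s then M1 s else 0)"

lemma tail_measurable:
  "(\<lambda>s. indicat_real {0..T} s *\<^sub>R tail \<eta> s) \<in> borel_measurable lebesgue"
proof -
  have "(\<lambda>s. indicat_real {0..T} s *\<^sub>R M1 s) \<in> borel_measurable lebesgue"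
    using M1_integrable unfolding set_integrable_def by (rule borel_measurable_integrable)
  then have "(\<lambda>s. 2 * (indicat_real {T - \<eta><..} s * (indicat_real {0..T} s *\<^sub>R M1 s))) \<in> borel_measurable lebesgue"
    by (intro borel_measurable_times borel_measurable_const borel_measurable_indicator) simp_all
  moreover have "2 * (indicat_real {T - \<eta><..} s * (indicat_real {0..T} s *\<^sub>R M1 s))
      = indicat_real {0..T} s *\<^sub>R tail \<eta> s" for s
    by (simp add: tail_def indicator_def)
  ultimately show ?thesis by (simp only:)
qed

lemma M1_integrable': "integrable lebesgue (\<lambda>s. 2 * norm (indicat_real {0..T} s *\<^sub>R M1 s))"
  using M1_integrable unfolding set_integrable_def by (intro integrable_mult_right integrable_norm)

lemma tail_bound:
  "norm (indicat_real {0..T} s *\<^sub>R tail \<eta> s) \<le> 2 * norm (indicat_real {0..T} s *\<^sub>R M1 s)"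
  by (simp add: tail_def indicator_def abs_mult)

lemma tail_integrable: "set_integrable lebesgue {0..T} (\<lambda>s. tail \<eta> s)"
  unfolding set_integrable_def
  by (rule Bochner_Integration.integrable_bound[OF M1_integrable' tail_measurable])
    (use tail_bound in \<open>auto intro!: AE_I2 order_trans[OF tail_bound abs_ge_self]\<close>)

lemma small_tail:
  assumes "0 < b" "0 < d"
  shows "\<exists>\<eta>. 0 < \<eta> \<and> \<eta> < b \<and> M * (LINT s:{0..T}|lebesgue. tail \<eta> s) < d"
proof -
  define \<eta> where "\<eta> = (\<lambda>n. b / 2 / real (Suc n))"
  have \<eta>: "0 < \<eta> n" "\<eta> n < b" for n
  proof -
    show "0 < \<eta> n" using assms by (simp add: \<eta>_def)
    have "\<eta> n \<le> b / 2" using assms by (simp add: \<eta>_def field_simps)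
    then show "\<eta> n < b" using assms by simp
  qed
  have "(\<lambda>n. b / 2 * (1 / real (Suc n))) \<longlonglongrightarrow> b / 2 * 0"
    by (intro tendsto_intros) (use LIMSEQ_inverse_real_of_nat in \<open>simp add: divide_inverse\<close>)
  then have \<eta>0: "\<eta> \<longlonglongrightarrow> 0" by (simp add: \<eta>_def)
  have "(\<lambda>n. integral\<^sup>L lebesgue (\<lambda>s. indicat_real {0..T} s *\<^sub>R tail (\<eta> n) s))
      \<longlonglongrightarrow> integral\<^sup>L lebesgue (\<lambda>s::real. 0)"
  proof (rule integral_dominated_convergence[OF _ tail_measurable M1_integrable'])
    show "AE s in lebesgue. norm (indicat_real {0..T} s *\<^sub>R tail (\<eta> n) s)
        \<le> 2 * norm (indicat_real {0..T} s *\<^sub>R M1 s)" for n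
      by (intro AE_I2 tail_bound)
    have "AE s in lebesgue. s \<noteq> T" by (intro AE_completion AE_lborel_singleton)
    then show "AE s in lebesgue. (\<lambda>n. indicat_real {0..T} s *\<^sub>R tail (\<eta> n) s) \<longlonglongrightarrow> 0"
    proof eventually_elim
      case (elim s)
      have "eventually (\<lambda>n. 0 = indicat_real {0..T} s *\<^sub>R tail (\<eta> n) s) sequentially"
      proof (cases "s < T")
        case True
        then have "eventually (\<lambda>n. \<eta> n < T - s) sequentially" by (intro order_tendstoD(2)[OF \<eta>0]) simp
        then show ?thesis by eventually_elim (simp add: tail_def)
      next
        case False
        then show ?thesis using elim by (simp add: indicator_def)
      qed
      then show ?case by (rule Lim_transform_eventually[OF tendsto_const])
    qed
  qed simp
  then have "(\<lambda>n. M * (LINT s:{0..T}|lebesgue. tail (\<eta> n) s)) \<longlonglongrightarrow> M * 0"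
    unfolding set_lebesgue_integral_def by (intro tendsto_intros) simp
  then have "eventually (\<lambda>n. M * (LINT s:{0..T}|lebesgue. tail (\<eta> n) s) < d) sequentially"
    by (rule order_tendstoD(2)) (use assms in simp)
  then show ?thesis using \<eta> unfolding eventually_sequentially by blast
qed

text \<open>Steering in the last moment: up to time \<open>T - \<eta>\<close> no control is applied, so impulses and, up to
  an error of order \<open>\<integral> M1\<close> over \<open>[T - \<eta>, T]\<close>, the nonlinear integral at time \<open>T\<close> are those of the uncontrolled
  solution \<open>y\<close>.  A control on the rest of the interval corrects the final state as closely as desired.
  The nonlocal term, which depends on the final state, is Lipschitz with constant \<open>M lg < 1\<close>.\<close>

lemma approximately_controllableI:
  fixes B :: "'u::{complex_hilbert, second_countable_topology} \<Rightarrow> 'x"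
  assumes B: "bounded_linear B"
    and dense: "\<And>\<eta>. 0 < \<eta> \<Longrightarrow> \<eta> < T \<Longrightarrow>
      closure (final_states B T (T - \<eta>)) = UNIV"
  shows "approximately_controllable r T K tt S B f I g \<phi>"
proof -
  interpret B: bounded_linear B by (rule B)
  have Bint: "set_integrable lebesgue {0..T} (\<lambda>s. B (u s))" if "u \<in> L2_controls T" for u
    by (rule set_integral_commute_bounded_linear(1)[OF B L2_controls_integrable[OF that]])
  have zero: "set_integrable lebesgue {0..T} (\<lambda>_. 0 :: 'x)" by (simp add: set_integrable_def)
  obtain y where y: "solves (\<lambda>_. 0) y" using solution_exists[OF zero] by blast
  have ys: "y \<in> state_space r K tt" using y by (simp add: solves_def)
  have "h \<in> closure (reachable_set r T K tt S B f I g \<phi>)" for h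
    unfolding closure_approachable
  proof (intro allI impI)
    fix e :: real assume e: "0 < e"
    \<comment> \<open>two errors below \<open>d\<close> will occur, and their sum is amplified by \<open>1 / (1 - M lg)\<close>\<close>
    define d where "d = (1 - M * lg) * e / 2"
    have d: "0 < d" using e M_lg_less_1 by (simp add: d_def)
    obtain \<eta> where \<eta>: "0 < \<eta>" "\<eta> < T - tt K"
        "M * (LINT s:{0..T}|lebesgue. tail \<eta> s) < d"
      using small_tail[of "T - tt K" d] d tt_less[of K "Suc K"] times by auto
    have \<eta>T: "\<eta> < T" using \<eta> tt_range[of K] by simp
    define target where "target = h - S T (\<phi> 0 - g0 h)
      - impulses y T - conv (nonlin y) T"
    have "target \<in> closure (final_states B T (T - \<eta>))"
      using dense[OF \<eta>(1) \<eta>T] by simp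
    then obtain u where u: "u \<in> L2_controls T" "\<And>s. s \<le> T - \<eta> \<Longrightarrow> u s = 0"
        "dist (conv (\<lambda>s. B (u s)) T) target < d"
      using d unfolding closure_approachable final_states_def by blast
    obtain x where x: "solves (\<lambda>s. B (u s)) x" using solution_exists[OF Bint[OF u(1)]] by blast
    have xs: "x \<in> state_space r K tt" using x by (simp add: solves_def)
    have xy: "x t = y t" if "- r \<le> t" "t \<le> T - \<eta>" for t
      by (rule solution_causal[OF x y Bint[OF u(1)] zero _ _ _ that]) (use \<eta> \<eta>T u(2) in \<open>auto simp: B.zero\<close>)
    have nl: "nonlin x s = nonlin y s" if "0 \<le> s" "s \<le> T - \<eta>" for s
    proof -
      have "segment r x s = segment r y s"
        unfolding segment_def using that xy by (intro restrict_ext) auto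
      then show ?thesis using xy[of s] that r by (simp add: nonlin_def)
    qed
    have "norm (conv (nonlin x) T - conv (nonlin y) T) \<le> M * (LINT s:{0..T}|lebesgue. tail \<eta> s)"
    proof (rule norm_conv_diff_le)
      fix s assume s: "0 \<le> s" "s \<le> T"
      then have "norm (nonlin x s - nonlin y s) \<le> M1 s + M1 s"
        by (intro order_trans[OF norm_triangle_ineq4] add_mono nonlin_bound xs ys) auto
      then show "norm (nonlin x s - nonlin y s) \<le> tail \<eta> s"
        using nl[of s] s by (auto simp: tail_def)
    qed (use nonlin_integrable xs ys T_pos M1_nonneg tail_integrable in \<open>auto simp: tail_def\<close>)
    then have err: "norm (conv (nonlin x) T - conv (nonlin y) T) < d" using \<eta>(3) by linarith
    have imp: "impulses x T = impulses y T"
      unfolding impulses_def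
    proof (rule sum.cong[OF refl])
      fix k assume "k \<in> {1..K}"
      then have "tt k \<le> tt K" "0 \<le> tt k" using tt_le[of k K] tt_range[of k] by auto
      then have "x (tt k) = y (tt k)" using \<eta> r by (intro xy) auto
      then show "(if tt k < T then S (T - tt k) (I k (x (tt k))) else 0) = (if tt k < T then S (T - tt k) (I k (y (tt k))) else 0)"
        by simp
    qed
    have "x T = rhs (\<lambda>s. B (u s)) x T" using x T_pos by (simp add: solves_def)
    then have "x T - h = (S T (\<phi> 0 - g0 (x T)) - S T (\<phi> 0 - g0 h)) + ((conv (\<lambda>s. B (u s)) T - target)
        + (conv (nonlin x) T - conv (nonlin y) T))"
      unfolding rhs_def imp target_def by (simp add: algebra_simps)
    also have "S T (\<phi> 0 - g0 (x T)) - S T (\<phi> 0 - g0 h) = S T (g0 h - g0 (x T))"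
      using T_pos by (simp flip: S_diff)
    finally have "norm (x T - h) \<le> norm (S T (g0 h - g0 (x T))) + (norm (conv (\<lambda>s. B (u s)) T - target)
        + norm (conv (nonlin x) T - conv (nonlin y) T))"
      by (metis norm_triangle_mono norm_triangle_ineq order_refl)
    moreover have "norm (S T (g0 h - g0 (x T))) \<le> (M * lg) * norm (x T - h)"
    proof -
      have "norm (S T (g0 h - g0 (x T))) \<le> M * norm (g0 h - g0 (x T))" using T_pos by (intro S_bound) simp
      also have "\<dots> \<le> M * (lg * norm (h - x T))" using M_pos g0_Lipschitz by simp
      finally show ?thesis by (simp add: norm_minus_commute mult_ac)
    qed
    ultimately have "(1 - M * lg) * norm (x T - h) < 2 * d"
      using u(3) err by (simp add: dist_norm algebra_simps)
    also have "2 * d = (1 - M * lg) * e" by (simp add: d_def)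
    finally have "dist (x T) h < e" using M_lg_less_1 by (simp add: dist_norm)
    moreover have "x T \<in> reachable_set r T K tt S B f I g \<phi>"
      using u(1) solves_imp_mild_solution[OF x Bint[OF u(1)]] unfolding reachable_set_def by blast
    ultimately show "\<exists>z\<in>reachable_set r T K tt S B f I g \<phi>. dist z h < e" by blast
  qed
  then show ?thesis by (auto simp: approximately_controllable_def)
qed

end

section \<open>Controls on a short final interval\<close>

lemma subspace_closure:
  fixes Y :: "'a::real_normed_vector set"
  assumes "subspace Y"
  shows "subspace (closure Y)"
proof (rule subspaceI)
  show "0 \<in> closure Y" using assms closure_subset subspace_0 by blast
next
  fix x y assume "x \<in> closure Y" "y \<in> closure Y"
  then obtain X Z where "\<And>n. X n \<in> Y" "X \<longlonglongrightarrow> x" "\<And>n. Z n \<in> Y" "Z \<longlonglongrightarrow> y"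
    unfolding closure_sequential by blast
  then show "x + y \<in> closure Y"
    unfolding closure_sequential using assms
    by (intro exI[of _ "\<lambda>n. X n + Z n"]) (auto intro: tendsto_add subspace_add)
next
  fix a x assume "x \<in> closure Y"
  then obtain X where "\<And>n. X n \<in> Y" "X \<longlonglongrightarrow> x" unfolding closure_sequential by blast
  then show "a *\<^sub>R x \<in> closure Y"
    unfolding closure_sequential using assms
    by (intro exI[of _ "\<lambda>n. a *\<^sub>R X n"]) (auto intro: tendsto_scaleR subspace_scale)
qed

lemma L2_controls_add:
  assumes "u \<in> L2_controls T" "v \<in> L2_controls T"
  shows "(\<lambda>s. u s + v s) \<in> L2_controls T"
proof -
  have m: "set_borel_measurable lebesgue {0..T} (\<lambda>s. u s + v s)"
    using assms by (auto simp: L2_controls_def set_borel_measurable_def scaleR_add_right)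
  have "set_integrable lebesgue {0..T} (\<lambda>s. (norm (u s + v s))\<^sup>2)"
  proof (rule set_integrable_bound)
    show "set_integrable lebesgue {0..T} (\<lambda>s. 2 * (norm (u s))\<^sup>2 + 2 * (norm (v s))\<^sup>2)"
      using assms by (intro set_integral_add(1)) (auto simp: L2_controls_def)
    have "(\<lambda>s. (norm (indicat_real {0..T} s *\<^sub>R (u s + v s)))\<^sup>2) \<in> borel_measurable lebesgue"
      using m unfolding set_borel_measurable_def
      by (intro borel_measurable_power measurable_compose[OF _ borel_measurable_norm])
    moreover have "(norm (indicat_real {0..T} s *\<^sub>R (u s + v s)))\<^sup>2 = indicat_real {0..T} s *\<^sub>R (norm (u s + v s))\<^sup>2" for s
      by (simp add: indicator_def)
    ultimately show "set_borel_measurable lebesgue {0..T} (\<lambda>s. (norm (u s + v s))\<^sup>2)"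
      unfolding set_borel_measurable_def by (simp only:)
    have "(norm (a + b))\<^sup>2 \<le> 2 * (norm a)\<^sup>2 + 2 * (norm b)\<^sup>2" for a b :: 'a
    proof -
      have "(norm (a + b))\<^sup>2 \<le> (norm a + norm b)\<^sup>2" by (intro power_mono norm_triangle_ineq) simp
      also have "\<dots> \<le> 2 * (norm a)\<^sup>2 + 2 * (norm b)\<^sup>2"
        using zero_le_power2[of "norm a - norm b"] by (simp add: power2_eq_square algebra_simps)
      finally show ?thesis .
    qed
    then show "AE s in lebesgue. s \<in> {0..T} \<longrightarrow> norm ((norm (u s + v s))\<^sup>2) \<le> norm (2 * (norm (u s))\<^sup>2 + 2 * (norm (v s))\<^sup>2)"
      by (intro AE_I2) simp
  qed
  with m show ?thesis by (simp add: L2_controls_def)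
qed

lemma L2_controls_scaleR:
  assumes "u \<in> L2_controls T"
  shows "(\<lambda>s. a *\<^sub>R u s) \<in> L2_controls T"
proof -
  have "(\<lambda>s. a *\<^sub>R (indicat_real {0..T} s *\<^sub>R u s)) \<in> borel_measurable lebesgue"
    using assms unfolding L2_controls_def set_borel_measurable_def
    by (intro borel_measurable_scaleR[OF borel_measurable_const]) simp
  then have "set_borel_measurable lebesgue {0..T} (\<lambda>s. a *\<^sub>R u s)"
    by (simp add: set_borel_measurable_def mult.commute)
  then show ?thesis using assms by (simp add: L2_controls_def power_mult_distrib)
qed

lemma L2_controls_step:
  fixes v :: "'u::{complex_hilbert, second_countable_topology}"
  shows "(\<lambda>s. indicat_real {a..b} s *\<^sub>R v) \<in> L2_controls T"
proof -
  have "set_borel_measurable lebesgue {0..T} (\<lambda>s. indicat_real {a..b} s *\<^sub>R v)"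
    unfolding set_borel_measurable_def
    by (intro borel_measurable_scaleR borel_measurable_indicator borel_measurable_const) simp_all
  moreover have "set_integrable lebesgue {0..T} (\<lambda>s. (norm (indicat_real {a..b} s *\<^sub>R v))\<^sup>2)"
  proof (rule set_integrable_bound[OF set_integrable_const_interval[of 0 T "(norm v)\<^sup>2"]])
    have "(\<lambda>s. indicat_real {0..T} s *\<^sub>R (indicat_real {a..b} s * (norm v)\<^sup>2)) \<in> borel_measurable lebesgue"
      by (intro borel_measurable_scaleR borel_measurable_times borel_measurable_indicator borel_measurable_const) simp_all
    moreover have "indicat_real {a..b} s * (norm v)\<^sup>2 = (norm (indicat_real {a..b} s *\<^sub>R v))\<^sup>2" for s
      by (simp add: indicator_def)
    ultimately show "set_borel_measurable lebesgue {0..T} (\<lambda>s. (norm (indicat_real {a..b} s *\<^sub>R v))\<^sup>2)"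
      unfolding set_borel_measurable_def by (simp only:)
  qed (auto simp: indicator_def)
  ultimately show ?thesis by (simp add: L2_controls_def)
qed

context strongly_continuous_family
begin

lemma conv_add:
  assumes "set_integrable lebesgue {0..T} w" "set_integrable lebesgue {0..T} w'" "0 \<le> T"
  shows "conv (\<lambda>s. w s + w' s) T = conv w T + conv w' T"
proof -
  have "conv (\<lambda>s. w s + w' s) T = (LINT s:{0..T}|lebesgue. S (T - s) (w s) + S (T - s) (w' s))"
    unfolding conv_def by (rule set_lebesgue_integral_cong) (simp_all add: S_add)
  also have "\<dots> = conv w T + conv w' T"
    unfolding conv_def by (rule set_integral_add(2)[OF conv_integrable[OF assms(1)] conv_integrable[OF assms(2)]])
      (use assms in auto)
  finally show ?thesis .
qed

lemma conv_scaleR: "0 \<le> T \<Longrightarrow> conv (\<lambda>s. a *\<^sub>R w s) T = a *\<^sub>R conv w T"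
proof -
  have "conv (\<lambda>s. a *\<^sub>R w s) T = (LINT s:{0..T}|lebesgue. a *\<^sub>R S (T - s) (w s))"
    unfolding conv_def by (rule set_lebesgue_integral_cong) (simp_all add: S_scaleR)
  then show ?thesis by (simp add: conv_def)
qed

text \<open>The values \<open>S \<tau> (B v)\<close> for small \<open>\<tau>\<close> are limits of averages, that is, of final states reached
  with controls that are constant on a short interval starting at \<open>T - \<tau>\<close>.\<close>

lemma S_in_closure_conv:
  fixes B :: "'u::{complex_hilbert, second_countable_topology} \<Rightarrow> 'x"
  assumes B: "bounded_linear B" and \<tau>: "0 < \<tau>" "\<tau> < \<eta>" "\<eta> < T"
  shows "S \<tau> (B v) \<in> closure (final_states B T (T - \<eta>))"
  unfolding closure_approachable
proof (intro allI impI)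
  fix e :: real assume e: "0 < e"
  interpret B: bounded_linear B by (rule B)
  define a where "a = T - \<tau>"
  have "\<exists>d>0. \<forall>t\<in>{0..}. dist t \<tau> < d \<longrightarrow> dist (S t (B v)) (S \<tau> (B v)) < e / 2"
    using S_cont[of "B v", unfolded continuous_on_iff, rule_format, of \<tau> "e / 2"] \<tau> e by simp
  then obtain d where d: "0 < d" "\<And>t. 0 \<le> t \<Longrightarrow> dist t \<tau> < d \<Longrightarrow> dist (S t (B v)) (S \<tau> (B v)) < e / 2"
    by auto
  define h where "h = min (d / 2) \<tau>"
  have h: "0 < h" "h < d" "h \<le> \<tau>" using d \<tau> by (auto simp: h_def)
  define u where "u = (\<lambda>s. indicat_real {a..a + h} s *\<^sub>R ((1 / h) *\<^sub>R v))"
  have "conv (\<lambda>s. B (u s)) T = (LINT s:{0..T}|lebesgue. indicat_real {a..a + h} s *\<^sub>R ((1 / h) *\<^sub>R S (T - s) (B v)))"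
    unfolding conv_def u_def by (rule set_lebesgue_integral_cong) (simp_all add: B.scaleR S_scaleR)
  also have "\<dots> = (LINT s:{a..a + h}|lebesgue. (1 / h) *\<^sub>R S (T - s) (B v))"
    unfolding set_lebesgue_integral_def
    by (rule Bochner_Integration.integral_cong) (use h \<tau> in \<open>auto simp: indicator_def a_def\<close>)
  also have "\<dots> = (1 / h) *\<^sub>R (LINT s:{a..a + h}|lebesgue. S (T - s) (B v))" by simp
  finally have conv: "conv (\<lambda>s. B (u s)) T = (1 / h) *\<^sub>R (LINT s:{a..a + h}|lebesgue. S (T - s) (B v))" .
  have cont: "continuous_on {a..a + h} (\<lambda>s. S (T - s) (B v))"
    by (intro continuous_on_S continuous_intros) (use h in \<open>auto simp: a_def\<close>)
  have toint: "(LINT s:{a..a + h}|lebesgue. k s) = (LINT s:{a..a + h}|lborel. k s)"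
    if "continuous_on {a..a + h} k" for k :: "real \<Rightarrow> 'x"
    unfolding set_lebesgue_integral_def
    using borel_measurable_continuous_on_indicator[OF _ that] by (intro integral_completion) simp
  have int: "set_integrable lborel {a..a + h} (\<lambda>s. S (T - s) (B v))"
    by (rule borel_integrable_atLeastAtMost'[OF cont])
  have cint: "set_integrable lborel {a..a + h} (\<lambda>_. y)" for y :: 'x
    by (rule borel_integrable_atLeastAtMost') simp
  have "(LINT s:{a..a + h}|lborel. S (T - s) (B v)) - h *\<^sub>R S \<tau> (B v)
      = (LINT s:{a..a + h}|lborel. S (T - s) (B v) - S \<tau> (B v))"
    using set_integral_diff(2)[OF int cint[of "S \<tau> (B v)"]] h by (simp add: set_lebesgue_integral_def)
  also have "norm \<dots> \<le> (LINT s:{a..a + h}|lborel. norm (S (T - s) (B v) - S \<tau> (B v)))"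
    by (rule set_integral_norm_bound[OF set_integral_diff(1)[OF int cint]])
  also have "\<dots> \<le> (LINT s:{a..a + h}|lborel. e / 2)"
  proof (rule set_integral_mono)
    show "set_integrable lborel {a..a + h} (\<lambda>s. norm (S (T - s) (B v) - S \<tau> (B v)))"
      by (intro borel_integrable_atLeastAtMost' continuous_intros cont)
    show "set_integrable lborel {a..a + h} (\<lambda>_. e / 2)" by (rule borel_integrable_atLeastAtMost') simp
    fix s assume "s \<in> {a..a + h}"
    then have "0 \<le> T - s" "dist (T - s) \<tau> < d" using h by (auto simp: a_def dist_real_def)
    then show "norm (S (T - s) (B v) - S \<tau> (B v)) \<le> e / 2" using d(2) by (simp add: dist_norm less_imp_le)
  qed
  also have "\<dots> = h * (e / 2)" using h by (simp add: set_lebesgue_integral_def)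
  finally have le: "norm ((LINT s:{a..a + h}|lborel. S (T - s) (B v)) - h *\<^sub>R S \<tau> (B v)) \<le> h * (e / 2)" .
  have "conv (\<lambda>s. B (u s)) T - S \<tau> (B v) = (1 / h) *\<^sub>R ((LINT s:{a..a + h}|lborel. S (T - s) (B v)) - h *\<^sub>R S \<tau> (B v))"
    using h unfolding conv toint[OF cont] by (simp add: scaleR_diff_right)
  then have "norm (conv (\<lambda>s. B (u s)) T - S \<tau> (B v)) = (1 / h)
      * norm ((LINT s:{a..a + h}|lborel. S (T - s) (B v)) - h *\<^sub>R S \<tau> (B v))"
    using h by simp
  also have "\<dots> \<le> (1 / h) * (h * (e / 2))" using le h by (intro mult_left_mono) auto
  also have "\<dots> = e / 2" using h by simp
  finally have "norm (conv (\<lambda>s. B (u s)) T - S \<tau> (B v)) \<le> e / 2" .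
  then have "dist (conv (\<lambda>s. B (u s)) T) (S \<tau> (B v)) < e" using e by (simp add: dist_norm)
  moreover have "u \<in> L2_controls T" unfolding u_def by (rule L2_controls_step)
  moreover have "u s = 0" if "s \<le> T - \<eta>" for s using that \<tau> by (auto simp: u_def a_def indicator_def)
  ultimately show "\<exists>y\<in>final_states B T (T - \<eta>). dist y (S \<tau> (B v)) < e"
    unfolding final_states_def by blast
qed

lemma subspace_conv_controls:
  fixes B :: "'u::{complex_hilbert, second_countable_topology} \<Rightarrow> 'x"
  assumes B: "bounded_linear B" and T: "0 \<le> T"
  shows "subspace (final_states B T b)"
  unfolding final_states_def
proof (rule subspaceI)
  let ?Z = "{conv (\<lambda>s. B (u s)) T | u. u \<in> L2_controls T \<and> (\<forall>s\<le>b. u s = 0)}"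
  interpret B: bounded_linear B by (rule B)
  have int: "set_integrable lebesgue {0..T} (\<lambda>s. B (u s))" if "u \<in> L2_controls T" for u
    by (rule set_integral_commute_bounded_linear(1)[OF B L2_controls_integrable[OF that]])
  have scale: "a *\<^sub>R x \<in> ?Z" if x: "x \<in> ?Z" for a x
  proof -
    obtain u where u: "x = conv (\<lambda>s. B (u s)) T" "u \<in> L2_controls T" "\<forall>s\<le>b. u s = 0" using x by blast
    then have "a *\<^sub>R x = conv (\<lambda>s. B (a *\<^sub>R u s)) T" using T by (simp add: B.scaleR conv_scaleR)
    then show ?thesis using u L2_controls_scaleR[OF u(2), of a] by force
  qed
  have "conv (\<lambda>s. B (indicat_real {1..0} s *\<^sub>R 0)) T \<in> ?Z" using L2_controls_step[of 1 0 0 T] by force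
  from scale[OF this, of 0] show "0 \<in> ?Z" by simp
  show "a *\<^sub>R x \<in> ?Z" if "x \<in> ?Z" for a x by (rule scale[OF that])
  fix x y assume "x \<in> ?Z" "y \<in> ?Z"
  then obtain u v where u: "x = conv (\<lambda>s. B (u s)) T" "u \<in> L2_controls T" "\<forall>s\<le>b. u s = 0"
    and v: "y = conv (\<lambda>s. B (v s)) T" "v \<in> L2_controls T" "\<forall>s\<le>b. v s = 0" by blast
  then have "x + y = conv (\<lambda>s. B (u s + v s)) T" using T int by (simp add: B.add conv_add)
  then show "x + y \<in> ?Z" using u v L2_controls_add[OF u(2) v(2)] by force
qed

end

section \<open>Approximate controllability\<close>

theorem theorem3p4:
  fixes \<alpha> T r p \<omega> \<theta> M0 C M \<rho> \<beta> l1 l2 lg \<epsilon> :: real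
    and K :: nat and tt :: "nat \<Rightarrow> real"
    and D :: "'x::{complex_banach, second_countable_topology} set"
    and A :: "'x \<Rightarrow> 'x"
    and S :: "real \<Rightarrow> 'x \<Rightarrow> 'x"
    and B :: "'u::{complex_hilbert, second_countable_topology} \<Rightarrow> 'x"
    and f :: "real \<Rightarrow> 'x \<Rightarrow> (real \<Rightarrow> 'x) \<Rightarrow> 'x"
    and I :: "nat \<Rightarrow> 'x \<Rightarrow> 'x"
    and g :: "(real \<Rightarrow> 'x) \<Rightarrow> real \<Rightarrow> 'x" and g0 :: "'x \<Rightarrow> 'x"
    and \<phi> :: "real \<Rightarrow> 'x"
    and L1 L2 M1 :: "real \<Rightarrow> real"
    and J :: "'x \<Rightarrow> 'x \<Rightarrow> complex"
    and \<Gamma> :: "('x \<Rightarrow> complex) \<Rightarrow> 'x"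
    and z :: "real \<Rightarrow> 'x \<Rightarrow> 'x"
  assumes alpha: "1 < \<alpha>" "\<alpha> < 2"
    and r: "0 < r"
    and times: "tt 0 = 0" "\<forall>k\<le>K. tt k < tt (Suc k)" "tt (Suc K) = T"
    and B: "bounded_clinear B"
    and phi: "\<phi> \<in> PC_hist r"
    \<comment> \<open>the operator \<open>A\<close> and the family \<open>S\<^sub>\<alpha>\<close>\<close>
    and A: "closed_densely_defined D A" "sectorial D A \<omega> \<theta> M0"
    and sector: "\<omega> < 0" "0 < \<theta>" "\<theta> < pi * (1 - \<alpha> / 2)"
    and path: "0 < \<rho>" "pi / 2 < \<beta>" "\<beta> < (pi - \<theta>) / \<alpha>"
    and S: "S = S_op \<alpha> D A \<rho> \<beta>"
    and C: "0 < C"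
      "\<forall>t\<ge>0. \<forall>v. norm (S t v) \<le> C * M0 / (1 + \<bar>\<omega>\<bar> * t powr \<alpha>) * norm v"
    and M: "M = C * M0"
    \<comment> \<open>the constants\<close>
    and p: "0 < p" "p < \<alpha> - 1"
    and Lp: "L1 \<in> Lp_nonneg (1 / p) T" "L2 \<in> Lp_nonneg (1 / p) T" "M1 \<in> Lp_nonneg (1 / p) T"
    and l: "0 < l1" "0 < l2" "0 < lg"
    \<comment> \<open>implicit in writing the integral of \<open>f(s, x(s), x\<^sub>s)\<close>; see the notion of mild solution\<close>
    and f_measurable: "\<forall>x\<in>state_space r K tt.
      set_borel_measurable lebesgue {0..T} (\<lambda>s. f s (x s) (segment r x s))"
    and A1: "\<forall>t\<in>{0..T}. \<forall>x. \<forall>\<psi>\<in>PC_hist r. norm (f t x \<psi>) \<le> M1 t"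
      "\<forall>t\<in>{0..T}. \<forall>x y. \<forall>\<psi>\<in>PC_hist r. \<forall>\<kappa>\<in>PC_hist r.
        norm (f t x \<psi> - f t y \<kappa>) \<le> L1 t * norm (x - y) + L2 t * hist_norm r (\<lambda>s. \<psi> s - \<kappa> s)"
    and A2: "continuous_map
        (prod_topology (top_of_set {0..T}) (prod_topology euclidean (hist_topology r))) euclidean
        (\<lambda>(t, x, \<psi>). f t x \<psi>)"
      "\<forall>E. E \<subseteq> {0..T} \<times> UNIV \<times> PC_hist r \<and>
          (\<exists>R. \<forall>(t, x, \<psi>)\<in>E. norm x \<le> R \<and> hist_norm r \<psi> \<le> R) \<longrightarrow>
        compact (closure ((\<lambda>(t, x, \<psi>). f t x \<psi>) ` E))"
    and A3: "\<forall>k\<in>{1..K}. continuous_on UNIV (I k)"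
      "\<forall>k\<in>{1..K}. \<forall>x. norm (I k x) \<le> l1"
      "\<forall>k\<in>{1..K}. \<forall>x y. norm (I k x - I k y) \<le> l2 * norm (x - y)"
    and A4: "\<forall>\<psi>\<in>PC_hist r. uniform_limit {- r..0} g (g \<psi>) (atin (hist_topology r) \<psi>)"
      "\<forall>\<psi>\<in>PC_hist r. \<forall>\<kappa>\<in>PC_hist r. \<forall>s\<in>{- r..0}.
        norm (g \<psi> s - g \<kappa> s) \<le> lg * hist_norm r (\<lambda>s. \<psi> s - \<kappa> s)"
      "\<forall>x\<in>state_space r K tt. \<forall>t\<in>{0..T}. \<forall>s\<in>{- r..0}. g (segment r x t) s = g0 (x (t + s))"
    and J: "\<forall>x. duality_set x = {J x}"
    and Gamma: "\<Gamma> = controllability_operator T S B"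
    and z: "\<forall>\<delta> h. z \<delta> h = \<delta> *\<^sub>R inv (\<lambda>w. \<delta> *\<^sub>R w + \<Gamma> (J w)) h"
    and A5: "\<forall>\<delta>>0. bij (\<lambda>w. \<delta> *\<^sub>R w + \<Gamma> (J w))"
      "\<forall>\<delta>>0. \<forall>h. \<delta> *\<^sub>R z \<delta> h + \<Gamma> (J (z \<delta> h)) = \<delta> *\<^sub>R h"
      "\<forall>h. ((\<lambda>\<delta>. z \<delta> h) \<longlongrightarrow> 0) (at_right 0)"
    and eps: "0 < \<epsilon>"
    and A6: "M * (real K * l2 + lg + T powr (1 - p) * (Lp_norm (1 / p) T L1 + Lp_norm (1 / p) T L2))
        * (1 + M * (onorm B)\<^sup>2 * T / \<epsilon>) < 1"
  shows "approximately_controllable r T K tt S B f I g \<phi>"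
proof -
  have M0: "0 < M0" using A(2) by (simp add: sectorial_def)
  have M_pos: "0 < M" using C(1) M0 by (simp add: M)
  have T_pos: "0 < T"
    using impulse_times.T_pos[of K tt T] times by (simp add: impulse_times_def)
  have Bl: "bounded_linear B" using B by (simp add: bounded_clinear_def)
  interpret sf: sectorial_family \<alpha> \<omega> \<theta> M0 \<rho> \<beta> D A J
    by unfold_locales (rule alpha A sector path J)+
  have bound: "norm (S t v) \<le> M * norm v" if "0 \<le> t" for t v
  proof -
    have "C * M0 / (1 + \<bar>\<omega>\<bar> * t powr \<alpha>) \<le> C * M0 / 1"
      using C(1) M0 by (intro divide_left_mono) (auto intro: add_pos_nonneg)
    then have "C * M0 / (1 + \<bar>\<omega>\<bar> * t powr \<alpha>) * norm v \<le> M * norm v"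
      by (intro mult_right_mono) (simp_all add: M)
    then show ?thesis using C(2) that order_trans by blast
  qed
  \<comment> \<open>the second factor of the smallness condition is at least 1\<close>
  have small: "M * (real K * l2 + lg + T powr (1 - p) * (Lp_norm (1 / p) T L1 + Lp_norm (1 / p) T L2)) < 1"
  proof (rule le_less_trans[OF _ A6])
    let ?a = "M * (real K * l2 + lg + T powr (1 - p) * (Lp_norm (1 / p) T L1 + Lp_norm (1 / p) T L2))"
    have "0 \<le> ?a" using M_pos l by (intro mult_nonneg_nonneg add_nonneg_nonneg) (auto simp: Lp_norm_def)
    moreover have "0 \<le> M * (onorm B)\<^sup>2 * T / \<epsilon>" using M_pos T_pos eps by simp
    ultimately have "?a * 1 \<le> ?a * (1 + M * (onorm B)\<^sup>2 * T / \<epsilon>)" by (intro mult_left_mono) auto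
    then show "?a \<le> ?a * (1 + M * (onorm B)\<^sup>2 * T / \<epsilon>)" by simp
  qed
  interpret ds: delay_system S M K tt T r p l2 lg f I g g0 \<phi> L1 L2 M1
  proof unfold_locales
    show "S t (v + w) = S t v + S t w" if "0 \<le> t" for t v w unfolding S by (rule sf.S_add[OF that])
    show "S t (a *\<^sub>R v) = a *\<^sub>R S t v" if "0 \<le> t" for t a v unfolding S by (rule sf.S_scaleR[OF that])
    show "continuous_on {0..} (\<lambda>t. S t v)" for v unfolding S by (rule sf.continuous_on_S) (use bound S in simp)
    show "S 0 v = v" for v unfolding S by (rule sf.S_zero)
    show "p < 1" using p alpha by simp
  qed (use bound M_pos times r p phi Lp l f_measurable A1 A3(3) A4(2,3) small in \<open>simp_all\<close>)
  show ?thesis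
  proof (rule ds.approximately_controllableI[OF Bl])
    fix \<eta> assume \<eta>: "0 < \<eta>" "\<eta> < T"
    define Y where "Y = closure (ds.final_states B T (T - \<eta>))"
    have Y: "subspace Y" "closed Y"
      using ds.subspace_conv_controls[OF Bl] T_pos by (auto simp: Y_def intro: subspace_closure)
    have pos: "S t (B v) \<in> Y" if "0 < t" for t v
      using sf.S_in_closed_subspace[OF Y \<eta>(1), of "B v" t] ds.S_in_closure_conv[OF Bl _ _ \<eta>(2), of _ v] that
      by (simp add: Y_def S)
    \<comment> \<open>the integrand of the controllability operator at \<open>s = T\<close> involves \<open>S 0\<close>\<close>
    have SB: "S t (B v) \<in> Y" if "0 \<le> t" for t v
    proof (cases "t = 0")
      case True
      have "(\<lambda>n. S (1 / real (Suc n)) (B v)) \<longlonglongrightarrow> S 0 (B v)"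
        by (intro ds.tendsto_S tendsto_const always_eventually)
          (use LIMSEQ_inverse_real_of_nat in \<open>simp_all add: divide_inverse\<close>)
      then have "S 0 (B v) \<in> Y" by (rule closed_sequentially[OF Y(2), rotated]) (simp add: pos)
      then show ?thesis using True by simp
    qed (use pos that in auto)
    have "h \<in> Y" for h
    proof -
      have \<Gamma>: "\<Gamma> \<xi> \<in> Y" for \<xi>
        unfolding Gamma controllability_operator_def
        by (intro set_integral_in_closed_subspace Y SB) simp
      have "h - z \<delta> h \<in> Y" if "0 < \<delta>" for \<delta>
      proof -
        have "\<delta> *\<^sub>R (h - z \<delta> h) = \<Gamma> (J (z \<delta> h))"
          using A5(2) that by (simp add: scaleR_diff_right algebra_simps)
        then have "h - z \<delta> h = (1 / \<delta>) *\<^sub>R \<Gamma> (J (z \<delta> h))"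
          using that by (simp flip: \<open>\<delta> *\<^sub>R (h - z \<delta> h) = \<Gamma> (J (z \<delta> h))\<close>)
        then show ?thesis using \<Gamma> Y by (simp add: subspace_scale)
      qed
      then have "eventually (\<lambda>\<delta>. h - z \<delta> h \<in> Y) (at_right 0)"
        by (intro eventually_mono[OF eventually_at_right_less[of 0]])
      moreover have "((\<lambda>\<delta>. h - z \<delta> h) \<longlongrightarrow> h - 0) (at_right 0)"
        using A5(3) by (intro tendsto_intros) auto
      ultimately have "h - 0 \<in> Y" by (intro Lim_in_closed_set[OF Y(2)]) auto
      then show ?thesis by simp
    qed
    then show "closure (ds.final_states B T (T - \<eta>)) = UNIV"
      by (auto simp: Y_def)
  qed
qed

end
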